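(* Let $l>0$, $a\neq0$, $m\neq0$, and consider the rotating Dymnikova spacetime with $r\in(-\infty,\infty)$, i.e. the G\"urses-G\"ursey metric $$ds^2=-\Bigl(1-\frac{2M(r)r}{\Sigma}\Bigr)dt^2-\frac{4aM(r)r\sin^2\theta}{\Sigma}\,dt\,d\phi+\frac{\Sigma}{\Delta}dr^2+\Sigma\, d\theta^2+\Bigl(r^2+a^2+\frac{2a^2M(r)r\sin^2\theta}{\Sigma}\Bigr)\sin^2\theta\, d\phi^2,$$ $\Sigma=r^2+a^2\cos^2\theta$, $\Delta(r)=r^2+a^2-2rM(r)$, with $$M(r)=\frac{2m}{\pi}\left\{\arctan\left(\frac rl\right)-\frac{lr}{r^2+l^2}\right\}.$$ Then: (1) the spacetime contains no scalar polynomial curvature singularity: the metric is regular everywhere except at the ring $(r,\theta)=(0,\pi/2)$ (up to coordinate singularities at $\Delta=0$ and on the axis), and the ring is not a scalar polynomial curvature singularity; (2) if $m>0$, the spacetime is stably causal, and in particular contains no closed causal curves.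
   Context: Signature $(-,+,+,+)$. A point or set is a scalar polynomial curvature singularity if some scalar polynomial formed from $g_{\mu\nu}$, the Levi-Civita tensor and the Riemann tensor is unbounded on approach to it. The ring $(r,\theta)=(0,\pi/2)$ is not part of the spacetime manifold. Hypersurfaces $\Delta=0$ are coordinate singularities only; where $rM(r)\ge0$ (which for $m>0$ holds for all $r$) the spacetime is covered by Doran coordinates $(\bar t,r,\theta,\varphi)$, in which the metric is $$ds^2=-d\bar t^2+\Sigma\, d\theta^2+(r^2+a^2)\sin^2\theta\, d\varphi^2+\frac{\Sigma}{r^2+a^2}\Bigl\{dr+\frac{\sqrt{2M(r)r(r^2+a^2)}}{\Sigma}(d\bar t-a\sin^2\theta\, d\varphi)\Bigr\}^2,$$ and this is regular across $\Delta=0$; in (2) "the spacetime" is the manifold with these coordinates, $\bar t\in\mathbb R$, $r\in\mathbb R$, $(\theta,\varphi)$ on the sphere, ring removed. A time-orientable spacetime is stably causal if no closed causal curve appears even under any sufficiently small perturbation of the metric; equivalently, if there is a differentiable function $T$ with everywhere timelike gradient. *)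

theory Defs
  imports "HOL-Analysis.Analysis"
begin

section \<open>Smooth maps\<close>

primrec Ck_on :: "nat \<Rightarrow> 'a::real_normed_vector set \<Rightarrow> ('a \<Rightarrow> 'b::real_normed_vector) \<Rightarrow> bool" where
  "Ck_on 0 U f \<longleftrightarrow> continuous_on U f"
| "Ck_on (Suc k) U f \<longleftrightarrow>
     (\<exists>f'. (\<forall>x\<in>U. (f has_derivative f' x) (at x)) \<and> (\<forall>v. Ck_on k U (\<lambda>x. f' x v)))"

text \<open>On a subset of a Euclidean space (for instance an embedded submanifold), smooth means:
  restriction of a function that is smooth on an open neighbourhood.\<close>

definition smooth_on :: "'a::real_normed_vector set \<Rightarrow> ('a \<Rightarrow> 'b::real_normed_vector) \<Rightarrow> bool" where
  "smooth_on S f \<longleftrightarrow>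
     (\<exists>U F. open U \<and> S \<subseteq> U \<and> (\<forall>k. Ck_on k U F) \<and> (\<forall>x\<in>S. F x = f x))"

section \<open>Lorentzian metrics on embedded manifolds\<close>

text \<open>A manifold is a subset \<open>M\<close> of a Euclidean space, with tangent spaces \<open>T p\<close> (linear subspaces of
  that space, of dimension 4 throughout). A metric is a field of symmetric bilinear forms. The forms are
  taken to be defined on the whole ambient space, but only their restriction to \<open>T p\<close>
  is meaningful; every metric on the tangent spaces has such an extension, by orthogonal
  projection to \<open>T p\<close>.\<close>

definition lorentzian :: "'v::real_vector set \<Rightarrow> ('v \<Rightarrow> 'v \<Rightarrow> real) \<Rightarrow> bool" where
  "lorentzian V B \<longleftrightarrow>
     (\<exists>e :: 4 \<Rightarrow> 'v. span (range e) = V \<and>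
        (\<forall>i j. B (e i) (e j) = (if i \<noteq> j then 0 else if i = 1 then -1 else 1)))"

definition lorentz_field ::
  "'v::euclidean_space set \<Rightarrow> ('v \<Rightarrow> 'v set) \<Rightarrow> ('v \<Rightarrow> 'v \<Rightarrow> 'v \<Rightarrow> real) \<Rightarrow> bool" where
  "lorentz_field M T g \<longleftrightarrow>
     (\<forall>p\<in>M. bilinear (g p) \<and> (\<forall>u v. g p u v = g p v u) \<and> lorentzian (T p) (g p))"

definition continuous_metric ::
  "'v::euclidean_space set \<Rightarrow> ('v \<Rightarrow> 'v set) \<Rightarrow> ('v \<Rightarrow> 'v \<Rightarrow> 'v \<Rightarrow> real) \<Rightarrow> bool" where
  "continuous_metric M T g \<longleftrightarrow> lorentz_field M T g \<and> (\<forall>u v. continuous_on M (\<lambda>p. g p u v))"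

definition smooth_metric ::
  "'v::euclidean_space set \<Rightarrow> ('v \<Rightarrow> 'v set) \<Rightarrow> ('v \<Rightarrow> 'v \<Rightarrow> 'v \<Rightarrow> real) \<Rightarrow> bool" where
  "smooth_metric M T g \<longleftrightarrow> lorentz_field M T g \<and> (\<forall>u v. smooth_on M (\<lambda>p. g p u v))"

section \<open>Causality\<close>

definition time_orientation ::
  "'v::euclidean_space set \<Rightarrow> ('v \<Rightarrow> 'v set) \<Rightarrow> ('v \<Rightarrow> 'v \<Rightarrow> 'v \<Rightarrow> real) \<Rightarrow> ('v \<Rightarrow> 'v) \<Rightarrow> bool" where
  "time_orientation M T g X \<longleftrightarrow>
     continuous_on M X \<and> (\<forall>p\<in>M. X p \<in> T p \<and> g p (X p) (X p) < 0)"

definition time_orientable ::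
  "'v::euclidean_space set \<Rightarrow> ('v \<Rightarrow> 'v set) \<Rightarrow> ('v \<Rightarrow> 'v \<Rightarrow> 'v \<Rightarrow> real) \<Rightarrow> bool" where
  "time_orientable M T g \<longleftrightarrow> (\<exists>X. time_orientation M T g X)"

definition future_causal ::
  "('v::euclidean_space \<Rightarrow> 'v \<Rightarrow> 'v \<Rightarrow> real) \<Rightarrow> ('v \<Rightarrow> 'v) \<Rightarrow> 'v \<Rightarrow> 'v \<Rightarrow> bool" where
  "future_causal g X p v \<longleftrightarrow> v \<noteq> 0 \<and> g p v v \<le> 0 \<and> g p (X p) v < 0"

definition closed_causal_curve ::
  "'v::euclidean_space set \<Rightarrow> ('v \<Rightarrow> 'v \<Rightarrow> 'v \<Rightarrow> real) \<Rightarrow> ('v \<Rightarrow> 'v) \<Rightarrow> (real \<Rightarrow> 'v) \<Rightarrow> bool" where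
  "closed_causal_curve M g X \<gamma> \<longleftrightarrow>
     continuous_on {0..1} \<gamma> \<and> \<gamma> ` {0..1} \<subseteq> M \<and> \<gamma> 0 = \<gamma> 1 \<and>
     (\<exists>S. finite S \<and> \<gamma> C1_differentiable_on ({0..1} - S) \<and>
        (\<forall>s\<in>{0..1} - S. future_causal g X (\<gamma> s) (vector_derivative \<gamma> (at s))))"

definition contains_ccc ::
  "'v::euclidean_space set \<Rightarrow> ('v \<Rightarrow> 'v set) \<Rightarrow> ('v \<Rightarrow> 'v \<Rightarrow> 'v \<Rightarrow> real) \<Rightarrow> bool" where
  "contains_ccc M T g \<longleftrightarrow> (\<exists>X \<gamma>. time_orientation M T g X \<and> closed_causal_curve M g X \<gamma>)"

text \<open>The small perturbations are a neighbourhood of \<open>g\<close> in the fine (Whitney) \<open>C\<^sup>0\<close> topology: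
  the allowed size \<open>\<epsilon>\<close> is a positive continuous function on the (noncompact) manifold. The norms
  of the ambient Euclidean space serve as auxiliary Riemannian metric; the resulting
  topology does not depend on this choice.\<close>

definition stably_causal ::
  "'v::euclidean_space set \<Rightarrow> ('v \<Rightarrow> 'v set) \<Rightarrow> ('v \<Rightarrow> 'v \<Rightarrow> 'v \<Rightarrow> real) \<Rightarrow> bool" where
  "stably_causal M T g \<longleftrightarrow>
     time_orientable M T g \<and>
     (\<exists>\<epsilon>. continuous_on M \<epsilon> \<and> (\<forall>p\<in>M. 0 < \<epsilon> p) \<and>
        (\<forall>h. continuous_metric M T h \<and>
             (\<forall>p\<in>M. \<forall>u\<in>T p. \<forall>v\<in>T p. \<bar>h p u v - g p u v\<bar> \<le> \<epsilon> p * norm u * norm v)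
           \<longrightarrow> time_orientable M T h \<and> \<not> contains_ccc M T h))"

section \<open>Curvature in a coordinate chart\<close>

lemma vector_4 [simp]:
  "(vector [w, x, y, z] :: ('a::zero)^4) $ 1 = w"
  "(vector [w, x, y, z] :: ('a::zero)^4) $ 2 = x"
  "(vector [w, x, y, z] :: ('a::zero)^4) $ 3 = y"
  "(vector [w, x, y, z] :: ('a::zero)^4) $ 4 = z"
  unfolding vector_def by simp_all

type_synonym chart_metric = "real^4 \<Rightarrow> real^4^4"
type_synonym chart_tensor = "real^4 \<Rightarrow> 4 list \<Rightarrow> real"

definition form_of :: "chart_metric \<Rightarrow> real^4 \<Rightarrow> real^4 \<Rightarrow> real^4 \<Rightarrow> real" where
  "form_of g x u v = u \<bullet> (g x *v v)"

definition pd :: "4 \<Rightarrow> (real^4 \<Rightarrow> real) \<Rightarrow> real^4 \<Rightarrow> real" where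
  "pd k f x = deriv (\<lambda>s. f (x + s *\<^sub>R axis k 1)) 0"

definition christoffel :: "chart_metric \<Rightarrow> 4 \<Rightarrow> 4 \<Rightarrow> 4 \<Rightarrow> real^4 \<Rightarrow> real" where
  "christoffel g i j k x = (1/2) * (\<Sum>p\<in>UNIV. matrix_inv (g x) $ i $ p *
     (pd j (\<lambda>y. g y $ p $ k) x + pd k (\<lambda>y. g y $ p $ j) x - pd p (\<lambda>y. g y $ j $ k) x))"

text \<open>\<open>R\<^sup>i\<^sub>j\<^sub>k\<^sub>l = \<partial>\<^sub>k \<Gamma>\<^sup>i\<^sub>l\<^sub>j - \<partial>\<^sub>l \<Gamma>\<^sup>i\<^sub>k\<^sub>j + \<Gamma>\<^sup>i\<^sub>k\<^sub>p \<Gamma>\<^sup>p\<^sub>l\<^sub>j - \<Gamma>\<^sup>i\<^sub>l\<^sub>p \<Gamma>\<^sup>p\<^sub>k\<^sub>j\<close>\<close>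

definition riemann_up :: "chart_metric \<Rightarrow> 4 \<Rightarrow> 4 \<Rightarrow> 4 \<Rightarrow> 4 \<Rightarrow> real^4 \<Rightarrow> real" where
  "riemann_up g i j k l x =
     pd k (christoffel g i l j) x - pd l (christoffel g i k j) x
     + (\<Sum>p\<in>UNIV. christoffel g i k p x * christoffel g p l j x
                  - christoffel g i l p x * christoffel g p k j x)"

definition riemann :: "chart_metric \<Rightarrow> 4 \<Rightarrow> 4 \<Rightarrow> 4 \<Rightarrow> 4 \<Rightarrow> real^4 \<Rightarrow> real" where
  "riemann g i j k l x = (\<Sum>p\<in>UNIV. g x $ i $ p * riemann_up g p j k l x)"

text \<open>The determinant of the matrix with rows \<open>e\<^sub>i, e\<^sub>j, e\<^sub>k, e\<^sub>l\<close> is the permutation symbol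
  \<open>[ijkl]\<close>.\<close>

definition levi_civita :: "chart_metric \<Rightarrow> 4 \<Rightarrow> 4 \<Rightarrow> 4 \<Rightarrow> 4 \<Rightarrow> real^4 \<Rightarrow> real" where
  "levi_civita g i j k l x =
     sqrt \<bar>det (g x)\<bar> * det (vector [axis i 1, axis j 1, axis k 1, axis l 1] :: real^4^4)"

text \<open>\<open>curvature_tensor g k A\<close>: \<open>A\<close> is a covariant tensor field of rank \<open>k\<close> obtained from the metric,
  the Levi-Civita tensor and the Riemann tensor by tensor products, linear combinations, permutations of
  indices and contractions with the inverse metric. The component \<open>A x js\<close> matters only
  when \<open>js\<close> has length \<open>k\<close>.\<close>

inductive curvature_tensor :: "chart_metric \<Rightarrow> nat \<Rightarrow> chart_tensor \<Rightarrow> bool" for g where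
  ct_metric: "curvature_tensor g 2 (\<lambda>x js. g x $ (js!0) $ (js!1))"
| ct_levi_civita: "curvature_tensor g 4 (\<lambda>x js. levi_civita g (js!0) (js!1) (js!2) (js!3) x)"
| ct_riemann: "curvature_tensor g 4 (\<lambda>x js. riemann g (js!0) (js!1) (js!2) (js!3) x)"
| ct_const: "curvature_tensor g 0 (\<lambda>x js. c)"
| ct_add: "curvature_tensor g k A \<Longrightarrow> curvature_tensor g k B \<Longrightarrow>
    curvature_tensor g k (\<lambda>x js. A x js + B x js)"
| ct_prod: "curvature_tensor g k A \<Longrightarrow> curvature_tensor g n B \<Longrightarrow>
    curvature_tensor g (k + n) (\<lambda>x js. A x (take k js) * B x (drop k js))"
| ct_permute: "curvature_tensor g k A \<Longrightarrow> \<sigma> permutes {..<k} \<Longrightarrow>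
    curvature_tensor g k (\<lambda>x js. A x (map (\<lambda>i. js ! \<sigma> i) [0..<k]))"
| ct_contract: "curvature_tensor g (k + 2) A \<Longrightarrow>
    curvature_tensor g k
      (\<lambda>x js. \<Sum>i\<in>UNIV. \<Sum>j\<in>UNIV. matrix_inv (g x) $ i $ j * A x (i # j # js))"

definition scalar_polynomial :: "chart_metric \<Rightarrow> (real^4 \<Rightarrow> real) \<Rightarrow> bool" where
  "scalar_polynomial g I \<longleftrightarrow> (\<exists>A. curvature_tensor g 0 A \<and> I = (\<lambda>x. A x []))"

text \<open>\<open>U\<close> is the domain of the chart, \<open>\<Phi>\<close> the map that sends coordinates to
  points of an ambient topological space; \<open>S\<close> is a set of points of the ambient space, which need not belong to
  the spacetime itself. The set is singular if some scalar polynomial is unbounded on every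
  neighbourhood of \<open>S\<close>.\<close>

definition scalar_polynomial_singularity ::
  "chart_metric \<Rightarrow> (real^4) set \<Rightarrow> (real^4 \<Rightarrow> 'v::topological_space) \<Rightarrow> 'v set \<Rightarrow> bool" where
  "scalar_polynomial_singularity g U \<Phi> S \<longleftrightarrow>
     (\<exists>I. scalar_polynomial g I \<and>
        (\<forall>V. open V \<and> S \<subseteq> V \<longrightarrow> \<not> bounded (I ` {x \<in> U. \<Phi> x \<in> V})))"

definition isometric_chart ::
  "(real^4) set \<Rightarrow> chart_metric \<Rightarrow> (real^4 \<Rightarrow> 'v::euclidean_space) \<Rightarrow>
   ('v \<Rightarrow> 'v \<Rightarrow> 'v \<Rightarrow> real) \<Rightarrow> bool" where
  "isometric_chart U g \<Phi> h \<longleftrightarrow>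
     smooth_on U \<Phi> \<and>
     (\<forall>x\<in>U. \<exists>D. (\<Phi> has_derivative D) (at x) \<and> (\<forall>u v. h (\<Phi> x) (D u) (D v) = form_of g x u v))"

section \<open>The rotating Dymnikova metric in Boyer-Lindquist coordinates\<close>

definition mass :: "real \<Rightarrow> real \<Rightarrow> real \<Rightarrow> real" where
  "mass l m r = 2 * m / pi * (arctan (r / l) - l * r / (r\<^sup>2 + l\<^sup>2))"

definition Delta :: "real \<Rightarrow> real \<Rightarrow> real \<Rightarrow> real \<Rightarrow> real" where
  "Delta a l m r = r\<^sup>2 + a\<^sup>2 - 2 * r * mass l m r"

text \<open>The coordinates \<open>(t, r, \<theta>, \<phi>)\<close> are the components \<open>x$1, x$2, x$3, x$4\<close>.\<close>

definition bl_metric :: "real \<Rightarrow> real \<Rightarrow> real \<Rightarrow> chart_metric" where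
  "bl_metric a l m x =
     (let r = x$2; \<theta> = x$3; M = mass l m r; \<Sigma> = r\<^sup>2 + a\<^sup>2 * (cos \<theta>)\<^sup>2;
          g\<^sub>t\<^sub>\<phi> = - (2 * a * M * r * (sin \<theta>)\<^sup>2 / \<Sigma>)
      in vector
        [vector [- (1 - 2 * M * r / \<Sigma>), 0, 0, g\<^sub>t\<^sub>\<phi>],
         vector [0, \<Sigma> / Delta a l m r, 0, 0],
         vector [0, 0, \<Sigma>, 0],
         vector [g\<^sub>t\<^sub>\<phi>, 0, 0, (r\<^sup>2 + a\<^sup>2 + 2 * a\<^sup>2 * M * r * (sin \<theta>)\<^sup>2 / \<Sigma>) * (sin \<theta>)\<^sup>2]])"

definition bl_domain :: "real \<Rightarrow> real \<Rightarrow> real \<Rightarrow> (real^4) set" where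
  "bl_domain a l m =
     {x. Delta a l m (x$2) \<noteq> 0 \<and> 0 < x$3 \<and> x$3 < pi \<and> \<not> (x$2 = 0 \<and> x$3 = pi/2)}"

section \<open>The spacetime manifold and the Doran form of the metric\<close>

text \<open>Points are triples \<open>(t, r, n)\<close> with \<open>n\<close> on the unit sphere,
  \<open>n = (sin \<theta> cos \<phi>, sin \<theta> sin \<phi>, cos \<theta>)\<close>.\<close>

type_synonym point = "real \<times> real \<times> (real^3)"

definition all_points :: "point set" where
  "all_points = UNIV \<times> UNIV \<times> sphere 0 1"

definition ring_set :: "point set" where
  "ring_set = {(t, r, n). norm n = 1 \<and> r = 0 \<and> n$3 = 0}"

definition spacetime :: "point set" where
  "spacetime = all_points - ring_set"

definition tangent :: "point \<Rightarrow> point set" where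
  "tangent p = {(\<tau>, \<rho>, w). snd (snd p) \<bullet> w = 0}"

definition sph :: "real \<Rightarrow> real \<Rightarrow> real^3" where
  "sph \<theta> \<phi> = vector [sin \<theta> * cos \<phi>, sin \<theta> * sin \<phi>, cos \<theta>]"

text \<open>Passing from Boyer-Lindquist time and azimuth to coordinates regular across \<open>\<Delta> = 0\<close>
  shifts them by functions of \<open>r\<close>.\<close>

definition bl_embed :: "(real \<Rightarrow> real) \<Rightarrow> (real \<Rightarrow> real) \<Rightarrow> real^4 \<Rightarrow> point" where
  "bl_embed F G x = (x$1 + F (x$2), x$2, sph (x$3) (x$4 + G (x$2)))"

text \<open>The one-form \<open>sin\<^sup>2 \<theta> d\<phi>\<close> is \<open>n\<^sub>1 dn\<^sub>2 - n\<^sub>2 dn\<^sub>1\<close> on the sphere.\<close>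

definition azimuth_form :: "real^3 \<Rightarrow> real^3 \<Rightarrow> real" where
  "azimuth_form n w = n$1 * w$2 - n$2 * w$1"

text \<open>The Doran form, with the angular part
  \<open>\<Sigma> d\<theta>\<^sup>2 + (r\<^sup>2 + a\<^sup>2) sin\<^sup>2 \<theta> d\<phi>\<^sup>2\<close> written as
  \<open>\<Sigma> (d\<theta>\<^sup>2 + sin\<^sup>2 \<theta> d\<phi>\<^sup>2) + a\<^sup>2 (sin\<^sup>2 \<theta> d\<phi>)\<^sup>2\<close>, which makes sense on the axis too.
  Lemma \<open>doran_metric_spherical\<close> below recovers the expression in \<open>\<theta>\<close> and \<open>\<phi>\<close>.\<close>

definition doran_metric :: "real \<Rightarrow> real \<Rightarrow> real \<Rightarrow> point \<Rightarrow> point \<Rightarrow> point \<Rightarrow> real" where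
  "doran_metric a l m = (\<lambda>(t, r, n) (\<tau>1, \<rho>1, w1) (\<tau>2, \<rho>2, w2).
     let \<Sigma> = r\<^sup>2 + a\<^sup>2 * (n$3)\<^sup>2;
         \<omega> = azimuth_form n;
         b = sqrt (2 * mass l m r * r * (r\<^sup>2 + a\<^sup>2)) / \<Sigma>
     in - \<tau>1 * \<tau>2 + \<Sigma> * (w1 \<bullet> w2) + a\<^sup>2 * \<omega> w1 * \<omega> w2
        + \<Sigma> / (r\<^sup>2 + a\<^sup>2) * (\<rho>1 + b * (\<tau>1 - a * \<omega> w1)) * (\<rho>2 + b * (\<tau>2 - a * \<omega> w2)))"

definition sph_tangent :: "real \<Rightarrow> real \<Rightarrow> real \<Rightarrow> real \<Rightarrow> real^3" where
  "sph_tangent \<theta> \<phi> d\<theta> d\<phi> =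
     vector [cos \<theta> * cos \<phi> * d\<theta> - sin \<theta> * sin \<phi> * d\<phi>,
             cos \<theta> * sin \<phi> * d\<theta> + sin \<theta> * cos \<phi> * d\<phi>, - sin \<theta> * d\<theta>]"

lemma doran_metric_spherical:
  fixes a r \<theta> :: real
  defines "\<Sigma> \<equiv> r\<^sup>2 + a\<^sup>2 * (cos \<theta>)\<^sup>2"
  shows "doran_metric a l m (t, r, sph \<theta> \<phi>)
           (dt, dr, sph_tangent \<theta> \<phi> d\<theta> d\<phi>) (dt, dr, sph_tangent \<theta> \<phi> d\<theta> d\<phi>) =
         - dt\<^sup>2 + \<Sigma> * d\<theta>\<^sup>2 + (r\<^sup>2 + a\<^sup>2) * (sin \<theta>)\<^sup>2 * d\<phi>\<^sup>2
         + \<Sigma> / (r\<^sup>2 + a\<^sup>2) *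
           (dr + sqrt (2 * mass l m r * r * (r\<^sup>2 + a\<^sup>2)) / \<Sigma> * (dt - a * (sin \<theta>)\<^sup>2 * d\<phi>))\<^sup>2"
proof -
  let ?w = "sph_tangent \<theta> \<phi> d\<theta> d\<phi>"
  have c: "(cos x)\<^sup>2 = 1 - (sin x)\<^sup>2" for x :: real
    by (simp add: cos_squared_eq)
  have w: "?w \<bullet> ?w = d\<theta>\<^sup>2 + (sin \<theta>)\<^sup>2 * d\<phi>\<^sup>2"
  proof -
    have "?w \<bullet> ?w = ((cos \<theta>)\<^sup>2 * ((cos \<phi>)\<^sup>2 + (sin \<phi>)\<^sup>2) + (sin \<theta>)\<^sup>2) * d\<theta>\<^sup>2
        + (sin \<theta>)\<^sup>2 * ((cos \<phi>)\<^sup>2 + (sin \<phi>)\<^sup>2) * d\<phi>\<^sup>2"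
      unfolding inner_vec_def sph_tangent_def sum_3
      by (simp add: algebra_simps power2_eq_square
          del: sin_cos_squared_add sin_cos_squared_add2 sin_cos_squared_add3)
    then show ?thesis by simp
  qed
  have o: "azimuth_form (sph \<theta> \<phi>) ?w = (sin \<theta>)\<^sup>2 * d\<phi>"
  proof -
    have "azimuth_form (sph \<theta> \<phi>) ?w = (sin \<theta>)\<^sup>2 * ((cos \<phi>)\<^sup>2 + (sin \<phi>)\<^sup>2) * d\<phi>"
      unfolding azimuth_form_def sph_def sph_tangent_def
      by (simp add: algebra_simps power2_eq_square
          del: sin_cos_squared_add sin_cos_squared_add2 sin_cos_squared_add3)
    then show ?thesis by simp
  qed
  have z: "sph \<theta> \<phi> $ 3 = cos \<theta>" by (simp add: sph_def)
  have ang: "\<Sigma> * (d\<theta>\<^sup>2 + (sin \<theta>)\<^sup>2 * d\<phi>\<^sup>2) + a\<^sup>2 * ((sin \<theta>)\<^sup>2 * d\<phi>) * ((sin \<theta>)\<^sup>2 * d\<phi>)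
      = \<Sigma> * d\<theta>\<^sup>2 + (r\<^sup>2 + a\<^sup>2) * (sin \<theta>)\<^sup>2 * d\<phi>\<^sup>2"
    unfolding \<Sigma>_def c by (simp add: algebra_simps power2_eq_square)
  show ?thesis
    unfolding doran_metric_def Let_def split_conv w o z \<Sigma>_def[symmetric]
    using ang by (simp add: power2_eq_square mult.assoc)
qed

end

theory Submission
  imports Defs
begin

text \<open>Write \<open>H(r) = 2 r M(r)\<close>. In a suitable null coframe with constant frame metric, all components of the
  Riemann tensor of the Boyer-Lindquist metric are linear in \<open>H\<close>, \<open>H'\<close> and \<open>H''\<close>, with coefficients of order
  \<open>\<Sigma>\<close> to the powers \<open>-2\<close>, \<open>-3/2\<close> and \<open>-1\<close>, where \<open>r\<^sup>2 \<le> \<Sigma>\<close>. As \<open>M\<close> is bounded by a multiple of \<open>|r|\<^sup>3\<close>,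
  and its derivatives accordingly, these components are bounded on the whole chart. Contractions
  with the constant frame metric preserve this, so every scalar polynomial is bounded. On the
  manifold, \<open>r M(r)\<close> is \<open>r\<^sup>4\<close> times a smooth function of constant sign, so the Doran form (for
  \<open>m > 0\<close>) is smooth. Its time coordinate has timelike gradient, and causal vectors of a sufficiently
  close metric still cannot be tangent to its level sets.\<close>

section \<open>Calculus of smooth functions\<close>

text \<open>Null coframes degenerate at \<Delta> = 0 and at the ring. This is harmless because
  contraction sees the coframe only through its constant frame metric: coordinate components may
  blow up while frame components stay bounded, and no limit at the ring is ever taken. The obstacle
  is size. Christoffel symbols of the coordinate metric are unwieldy, so the connection forms are
  written down outright and only verified. Cartan's equations then become polynomial identities in
  r, cos \<theta>, sin \<theta>, H and its derivatives, modulo the relations that define the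
  inverses. Two further points shape the global part. The set where \<Delta> is nonzero can be
  disconnected, so the shifts of time and azimuth are antiderivatives chosen separately on each
  component. The Doran form is real only where r M(r) is nonnegative, so both signs of m are treated
  as members of one family of metrics.\<close>

lemma Ck_on_SucI:
  assumes "\<And>x. x \<in> U \<Longrightarrow> (f has_derivative f' x) (at x)" "\<And>v. Ck_on k U (\<lambda>x. f' x v)"
  shows "Ck_on (Suc k) U f"
  unfolding Ck_on.simps by (rule exI[of _ f']) (use assms in simp)

text \<open>Product and quotient rules contain undifferentiated factors, which have to be taken at
  the lower order.\<close>

lemma Ck_on_SucD: "Ck_on (Suc k) U f \<Longrightarrow> Ck_on k U f"
proof (induction k arbitrary: f)
  case 0
  from 0 obtain f' where "\<forall>x\<in>U. (f has_derivative f' x) (at x)" "\<forall>v. Ck_on 0 U (\<lambda>x. f' x v)"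
    unfolding Ck_on.simps(2) by (elim exE conjE)
  note f' = this[rule_format]
  have "continuous_on U f"
    by (intro continuous_at_imp_continuous_on ballI, rule has_derivative_continuous, rule f'(1))
  then show ?case by simp
next
  case (Suc k)
  from Suc.prems obtain f' where "\<forall>x\<in>U. (f has_derivative f' x) (at x)" "\<forall>v. Ck_on (Suc k) U (\<lambda>x. f' x v)"
    unfolding Ck_on.simps(2) by (elim exE conjE)
  note f' = this[rule_format]
  show ?case by (rule Ck_on_SucI[OF f'(1) Suc.IH[OF f'(2)]])
qed

lemma Ck_on_const [simp]: "Ck_on k U (\<lambda>x. c)"
proof (induction k arbitrary: c)
  case (Suc k)
  show ?case by (rule Ck_on_SucI[where f' = "\<lambda>x v. 0"]) (auto simp: Suc)
qed simp

lemma Ck_on_bounded_linear: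
  assumes "bounded_linear L"
  shows "Ck_on k U L"
proof (cases k)
  case 0
  then show ?thesis using assms by (simp add: linear_continuous_on)
next
  case (Suc j)
  show ?thesis unfolding Suc
    by (rule Ck_on_SucI[where f' = "\<lambda>x. L"]) (auto intro: bounded_linear_imp_has_derivative assms)
qed

lemma Ck_on_linear_compose:
  assumes "bounded_linear L" "Ck_on k U f"
  shows "Ck_on k U (\<lambda>x. L (f x))"
  using assms(2)
proof (induction k arbitrary: f)
  case 0
  then show ?case
    using assms(1) by (simp add: bounded_linear.continuous_on)
next
  case (Suc k)
  from Suc.prems obtain f' where "\<forall>x\<in>U. (f has_derivative f' x) (at x)" "\<forall>v. Ck_on k U (\<lambda>x. f' x v)"
    unfolding Ck_on.simps(2) by (elim exE conjE)
  note f' = this[rule_format]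
  show ?case
    by (rule Ck_on_SucI[where f' = "\<lambda>x v. L (f' x v)"])
      (rule bounded_linear.has_derivative[OF assms(1) f'(1)] Suc.IH[OF f'(2)]; assumption?)+
qed

lemma Ck_on_add:
  assumes "Ck_on k U f" "Ck_on k U g"
  shows "Ck_on k U (\<lambda>x. f x + g x)"
  using assms
proof (induction k arbitrary: f g)
  case 0
  then show ?case by (simp add: continuous_on_add)
next
  case (Suc k)
  from Suc.prems(1) obtain f' where "\<forall>x\<in>U. (f has_derivative f' x) (at x)" "\<forall>v. Ck_on k U (\<lambda>x. f' x v)"
    unfolding Ck_on.simps(2) by (elim exE conjE)
  note f' = this[rule_format]
  from Suc.prems(2) obtain g' where "\<forall>x\<in>U. (g has_derivative g' x) (at x)" "\<forall>v. Ck_on k U (\<lambda>x. g' x v)"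
    unfolding Ck_on.simps(2) by (elim exE conjE)
  note g' = this[rule_format]
  show ?case
    by (rule Ck_on_SucI[where f' = "\<lambda>x v. f' x v + g' x v"])
      (auto intro: Suc.IH f' g' has_derivative_add)
qed

lemma Ck_on_mult:
  fixes f g :: "'a::real_normed_vector \<Rightarrow> real"
  assumes "Ck_on k U f" "Ck_on k U g"
  shows "Ck_on k U (\<lambda>x. f x * g x)"
  using assms
proof (induction k arbitrary: f g)
  case 0
  then show ?case by (simp add: continuous_on_mult)
next
  case (Suc k)
  from Suc.prems(1) obtain f' where "\<forall>x\<in>U. (f has_derivative f' x) (at x)" "\<forall>v. Ck_on k U (\<lambda>x. f' x v)"
    unfolding Ck_on.simps(2) by (elim exE conjE)
  note f' = this[rule_format]
  from Suc.prems(2) obtain g' where "\<forall>x\<in>U. (g has_derivative g' x) (at x)" "\<forall>v. Ck_on k U (\<lambda>x. g' x v)"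
    unfolding Ck_on.simps(2) by (elim exE conjE)
  note g' = this[rule_format]
  show ?case
    by (rule Ck_on_SucI[where f' = "\<lambda>x v. f x * g' x v + f' x v * g x"])
      (auto intro!: Ck_on_add Suc.IH f' g' has_derivative_mult Ck_on_SucD[OF Suc.prems(1)] Ck_on_SucD[OF Suc.prems(2)])
qed

lemma Ck_on_minus: "Ck_on k U f \<Longrightarrow> Ck_on k U (\<lambda>x. - f x)"
  by (rule Ck_on_linear_compose[OF bounded_linear_minus[OF bounded_linear_ident]])

lemma Ck_on_diff: "Ck_on k U f \<Longrightarrow> Ck_on k U g \<Longrightarrow> Ck_on k U (\<lambda>x. f x - g x)"
  using Ck_on_add[OF _ Ck_on_minus, of k U f g] by simp

lemma Ck_on_power:
  fixes f :: "'a::real_normed_vector \<Rightarrow> real"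
  shows "Ck_on k U f \<Longrightarrow> Ck_on k U (\<lambda>x. f x ^ n)"
  by (induction n) (simp_all add: Ck_on_mult)

text \<open>The outer derivative is only required along \<open>f\<close>, so that functions defined by an
  integral or a differential equation can be treated by induction on the order.\<close>

lemma Ck_on_compose:
  fixes f :: "'a::real_normed_vector \<Rightarrow> real" and \<phi> \<psi> :: "real \<Rightarrow> real"
  assumes "\<And>x. x \<in> U \<Longrightarrow> (\<phi> has_real_derivative \<psi> (f x)) (at (f x))"
    and "Ck_on (Suc k) U f" "Ck_on k U (\<lambda>x. \<psi> (f x))"
  shows "Ck_on (Suc k) U (\<lambda>x. \<phi> (f x))"
proof -
  from assms(2) obtain f' where "\<forall>x\<in>U. (f has_derivative f' x) (at x)" "\<forall>v. Ck_on k U (\<lambda>x. f' x v)"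
    unfolding Ck_on.simps(2) by (elim exE conjE)
  note f' = this[rule_format]
  show ?thesis
  proof (rule Ck_on_SucI[where f' = "\<lambda>x v. \<psi> (f x) * f' x v"])
    fix x assume "x \<in> U"
    then show "((\<lambda>x. \<phi> (f x)) has_derivative (\<lambda>v. \<psi> (f x) * f' x v)) (at x)"
      using has_derivative_compose[OF f'(1) assms(1)[unfolded has_field_derivative_def]] by blast
  qed (intro Ck_on_mult assms(3) f'(2))
qed

lemma continuous_on_compose_DERIV:
  fixes f :: "'a::real_normed_vector \<Rightarrow> real" and \<phi> \<psi> :: "real \<Rightarrow> real"
  assumes "\<And>x. x \<in> U \<Longrightarrow> (\<phi> has_real_derivative \<psi> (f x)) (at (f x))" "continuous_on U f"
  shows "continuous_on U (\<lambda>x. \<phi> (f x))"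
proof (rule continuous_on_compose2[of "f ` U" \<phi>])
  show "continuous_on (f ` U) \<phi>"
    using assms(1) by (auto intro!: continuous_at_imp_continuous_on intro: DERIV_isCont)
qed (use assms(2) in auto)

text \<open>The derivative of \<open>inverse\<close> is a polynomial in \<open>inverse\<close>, so
  the induction on the order feeds on itself. The square root below works in the same way.\<close>

lemma Ck_on_inverse:
  fixes f :: "'a::real_normed_vector \<Rightarrow> real"
  assumes "Ck_on k U f" "\<And>x. x \<in> U \<Longrightarrow> f x \<noteq> 0"
  shows "Ck_on k U (\<lambda>x. inverse (f x))"
  using assms(1)
proof (induction k)
  case 0
  then show ?case using assms(2) by (simp add: continuous_on_inverse)
next
  case (Suc k)
  show ?case
  proof (rule Ck_on_compose[where \<phi> = inverse and f = f and \<psi> = "\<lambda>y. - (inverse y * inverse y)"])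
    show "Ck_on k U (\<lambda>x. - (inverse (f x) * inverse (f x)))"
      using Suc Ck_on_SucD by (intro Ck_on_minus Ck_on_mult) auto
    fix x assume "x \<in> U"
    then show "(inverse has_real_derivative - (inverse (f x) * inverse (f x))) (at (f x))"
      using DERIV_inverse[OF assms(2)] by (simp add: power2_eq_square)
  qed (rule Suc.prems)
qed

lemma Ck_on_divide:
  fixes f g :: "'a::real_normed_vector \<Rightarrow> real"
  assumes "Ck_on k U f" "Ck_on k U g" "\<And>x. x \<in> U \<Longrightarrow> g x \<noteq> 0"
  shows "Ck_on k U (\<lambda>x. f x / g x)"
  unfolding divide_inverse by (intro Ck_on_mult Ck_on_inverse assms)

lemma Ck_on_sqrt:
  fixes f :: "'a::real_normed_vector \<Rightarrow> real"
  assumes "Ck_on k U f" "\<And>x. x \<in> U \<Longrightarrow> f x > 0"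
  shows "Ck_on k U (\<lambda>x. sqrt (f x))"
  using assms(1)
proof (induction k)
  case 0
  then show ?case by (simp add: continuous_on_real_sqrt)
next
  case (Suc k)
  show ?case
  proof (rule Ck_on_compose[where \<phi> = sqrt and f = f and \<psi> = "\<lambda>y. inverse (sqrt y) / 2"])
    show "Ck_on k U (\<lambda>x. inverse (sqrt (f x)) / 2)"
      using Suc Ck_on_SucD assms(2) by (intro Ck_on_divide Ck_on_inverse) (auto simp: less_imp_neq[THEN not_sym])
    fix x assume "x \<in> U"
    then show "(sqrt has_real_derivative inverse (sqrt (f x)) / 2) (at (f x))"
      using assms(2) by (intro DERIV_real_sqrt) 
  qed (rule Suc.prems)
qed

lemma Ck_on_sin_cos:
  fixes f :: "'a::real_normed_vector \<Rightarrow> real"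
  assumes "Ck_on k U f"
  shows "Ck_on k U (\<lambda>x. sin (f x))" "Ck_on k U (\<lambda>x. cos (f x))"
proof -
  \<comment> \<open>Sine and cosine are each other's derivatives up to sign, so one induction has to
    carry both.\<close>
  have "Ck_on k U (\<lambda>x. sin (f x)) \<and> Ck_on k U (\<lambda>x. cos (f x))"
    using assms
  proof (induction k)
    case 0
    then show ?case by (simp add: continuous_on_sin continuous_on_cos)
  next
    case (Suc k)
    then have "Ck_on k U (\<lambda>x. sin (f x))" "Ck_on k U (\<lambda>x. cos (f x))"
      using Ck_on_SucD by blast+
    then show ?case
      by (intro conjI Ck_on_compose[where \<phi> = sin and \<psi> = cos and f = f]
        Ck_on_compose[where \<phi> = cos and \<psi> = "\<lambda>y. - sin y" and f = f] Ck_on_minus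
        DERIV_sin DERIV_cos Suc.prems)
  qed
  then show "Ck_on k U (\<lambda>x. sin (f x))" "Ck_on k U (\<lambda>x. cos (f x))" by auto
qed

lemma Ck_on_arctan:
  fixes f :: "'a::real_normed_vector \<Rightarrow> real"
  assumes "Ck_on k U f"
  shows "Ck_on k U (\<lambda>x. arctan (f x))"
proof (cases k)
  case 0
  with assms show ?thesis by (simp add: continuous_on_arctan)
next
  case (Suc j)
  have nz: "1 + (f x)\<^sup>2 \<noteq> 0" for x by (metis add_pos_nonneg less_irrefl zero_le_power2 zero_less_one)
  have "Ck_on j U (\<lambda>x. inverse (1 + (f x)\<^sup>2))"
    using assms Suc Ck_on_SucD nz by (intro Ck_on_inverse Ck_on_add Ck_on_power) auto
  then show ?thesis
    using assms unfolding Suc by (intro Ck_on_compose[where \<phi> = arctan and f = f and \<psi> = "\<lambda>y. inverse (1 + y\<^sup>2)"] DERIV_arctan)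
qed

lemma Ck_on_Pair:
  assumes "Ck_on k U f" "Ck_on k U g"
  shows "Ck_on k U (\<lambda>x. (f x, g x))"
proof -
  have 1: "bounded_linear (\<lambda>y. (y, 0))" "bounded_linear (\<lambda>y. (0, y))"
    by (intro bounded_linear_Pair bounded_linear_ident bounded_linear_zero)+
  have "Ck_on k U (\<lambda>x. (f x, 0) + (0, g x))"
    by (intro Ck_on_add Ck_on_linear_compose[OF 1(1)] Ck_on_linear_compose[OF 1(2)] assms)
  then show ?thesis by simp
qed

lemma Ck_on_vector_3:
  assumes "Ck_on k U f" "Ck_on k U g" "Ck_on k U h"
  shows "Ck_on k U (\<lambda>x. vector [f x, g x, h x] :: real^3)"
proof -
  have 1: "bounded_linear (\<lambda>y::real. y *\<^sub>R (b :: real^3))" for b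
    by (rule bounded_linear_scaleR_left)
  have "(\<lambda>x. vector [f x, g x, h x] :: real^3)
      = (\<lambda>x. f x *\<^sub>R axis 1 1 + (g x *\<^sub>R axis 2 1 + h x *\<^sub>R axis 3 1))"
    by (auto simp: vec_eq_iff forall_3 axis_def)
  then show ?thesis
    by (auto intro!: Ck_on_add Ck_on_linear_compose[OF 1] assms)
qed

lemmas Ck_on_intros = Ck_on_const Ck_on_add Ck_on_diff Ck_on_minus Ck_on_mult Ck_on_power Ck_on_divide
  Ck_on_inverse Ck_on_sin_cos Ck_on_arctan Ck_on_Pair Ck_on_vector_3

lemma smooth_onI:
  assumes "open U" "S \<subseteq> U" "\<And>k. Ck_on k U F" "\<And>x. x \<in> S \<Longrightarrow> F x = f x"
  shows "smooth_on S f"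
  using assms unfolding smooth_on_def by blast

lemma smooth_on_continuous_on:
  assumes "smooth_on S f"
  shows "continuous_on S f"
proof -
  obtain U F where "S \<subseteq> U" "Ck_on 0 U F" "\<forall>x\<in>S. F x = f x"
    using assms unfolding smooth_on_def by blast
  then show ?thesis
    by (metis Ck_on.simps(1) continuous_on_cong continuous_on_subset)
qed

lemma smooth_metric_imp_continuous: "smooth_metric M T g \<Longrightarrow> continuous_metric M T g"
  unfolding smooth_metric_def continuous_metric_def by (auto intro: smooth_on_continuous_on)

section \<open>Smoothness of the mass function\<close>

text \<open>The functions \<open>moment_int p q r\<close> are closed under differentiation, and
  \<open>M(r) = const * r\<^sup>3 * moment_int 2 2 r\<close>. So \<open>sqrt (r M(r))\<close> is \<open>r\<^sup>2\<close> times a smooth function, although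
  \<open>r M(r)\<close> vanishes at \<open>0\<close>.\<close>

definition moment_int :: "real \<Rightarrow> nat \<Rightarrow> nat \<Rightarrow> real \<Rightarrow> real" where
  "moment_int l p q r = integral {0..1} (\<lambda>t. t ^ p * inverse (t\<^sup>2 * r\<^sup>2 + l\<^sup>2) ^ q)"

lemma moment_denom_pos: "l \<noteq> 0 \<Longrightarrow> 0 < t\<^sup>2 * r\<^sup>2 + (l::real)\<^sup>2"
  by (simp add: add_nonneg_pos)

lemma continuous_on_moment:
  assumes "l \<noteq> 0"
  shows "continuous_on X (\<lambda>t::real. t ^ p * inverse (t\<^sup>2 * r\<^sup>2 + l\<^sup>2) ^ q)"
  using moment_denom_pos[OF assms] by (intro continuous_intros) (auto simp: less_imp_neq[THEN not_sym])

lemma DERIV_moment_int: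
  assumes "l \<noteq> 0"
  shows "(moment_int l p q has_real_derivative - (2 * real q * r * moment_int l (p + 2) (q + 1) r)) (at r)"
proof -
  note nz = moment_denom_pos[OF assms, THEN less_imp_neq, THEN not_sym]
  let ?f = "\<lambda>r t. t ^ p * inverse (t\<^sup>2 * r\<^sup>2 + l\<^sup>2) ^ q"
  let ?g = "\<lambda>r t. - (2 * real q * r) * (t ^ (p + 2) * inverse (t\<^sup>2 * r\<^sup>2 + l\<^sup>2) ^ (q + 1))"
  have "((\<lambda>r. integral (cbox 0 1) (?f r)) has_field_derivative integral (cbox 0 1) (?g r)) (at r within UNIV)"
  proof (rule leibniz_rule_field_derivative)
    fix r t :: real
    have "((\<lambda>r. inverse (t\<^sup>2 * r\<^sup>2 + l\<^sup>2)) has_real_derivative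
        - (inverse (t\<^sup>2 * r\<^sup>2 + l\<^sup>2) * (2 * r * t\<^sup>2) * inverse (t\<^sup>2 * r\<^sup>2 + l\<^sup>2))) (at r)"
      using nz[of t r] by (auto intro!: derivative_eq_intros)
    from DERIV_cmult[OF DERIV_power[OF this, of q], of "t ^ p"]
    have "((\<lambda>r. t ^ p * inverse (t\<^sup>2 * r\<^sup>2 + l\<^sup>2) ^ q) has_real_derivative
        t ^ p * (real q * (- (inverse (t\<^sup>2 * r\<^sup>2 + l\<^sup>2) * (2 * r * t\<^sup>2) * inverse (t\<^sup>2 * r\<^sup>2 + l\<^sup>2))
          * inverse (t\<^sup>2 * r\<^sup>2 + l\<^sup>2) ^ (q - Suc 0)))) (at r)" .
    note D = this
    \<comment> \<open>For \<open>q = 0\<close> both sides vanish, so the truncated exponent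
      \<open>q - Suc 0\<close> does no harm.\<close>
    have e: "t ^ p * (real q * (- (i * (2 * r * t\<^sup>2) * i) * i ^ (q - Suc 0)))
      = - (2 * real q * r) * (t ^ (p + 2) * i ^ (q + 1))" for i
      by (cases q) (simp_all add: algebra_simps power_add power2_eq_square)
    show "((\<lambda>r. ?f r t) has_real_derivative ?g r t) (at r within UNIV)"
      by (rule D[unfolded e])
  next
    fix r :: real
    show "?f r integrable_on cbox 0 1"
      by (intro integrable_continuous continuous_on_moment assms)
  next
    show "continuous_on (UNIV \<times> cbox 0 1) (\<lambda>(r, t). ?g r t)"
      unfolding split_beta using nz by (intro continuous_intros) auto
  qed auto
  then show ?thesis
    unfolding moment_int_def[abs_def] by simp
qed

text \<open>Differentiation raises p and q, hence the induction over all exponents at once.\<close>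

lemma Ck_on_moment_int:
  fixes f :: "'a::real_normed_vector \<Rightarrow> real"
  assumes "l \<noteq> 0" "Ck_on k U f"
  shows "Ck_on k U (\<lambda>x. moment_int l p q (f x))"
  using assms(2)
proof (induction k arbitrary: p q)
  case 0
  then show ?case
    using continuous_on_compose_DERIV[where f = f, OF DERIV_moment_int[OF assms(1), of p q]] by simp
next
  case (Suc k)
  have "Ck_on k U f" by (rule Ck_on_SucD[OF Suc.prems])
  then have "Ck_on k U (\<lambda>x. - (2 * real q * f x * moment_int l (p + 2) (q + 1) (f x)))"
    by (intro Ck_on_intros Suc.IH)
  then show ?case
    by (rule Ck_on_compose[where f = f, OF DERIV_moment_int[OF assms(1)] Suc.prems])
qed

text \<open>On [0,1] the denominator is at most its value at t = 1, which leaves the integral of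
  t^2, that is 1/3, times a positive constant.\<close>

lemma moment_int_pos:
  assumes "l \<noteq> 0"
  shows "0 < moment_int l 2 2 r"
proof -
  have nz: "0 < r\<^sup>2 + l\<^sup>2" using moment_denom_pos[OF assms, of 1 r] by simp
  have I: "integral {0..1} (\<lambda>t::real. t\<^sup>2 * inverse (r\<^sup>2 + l\<^sup>2) ^ 2) =
      1 ^ 3 / 3 * inverse (r\<^sup>2 + l\<^sup>2) ^ 2 - 0 ^ 3 / 3 * inverse (r\<^sup>2 + l\<^sup>2) ^ 2"
    by (rule integral_unique, rule fundamental_theorem_of_calculus)
      (auto intro!: derivative_eq_intros simp flip: has_real_derivative_iff_has_vector_derivative)
  have "1 / 3 * inverse (r\<^sup>2 + l\<^sup>2) ^ 2 = integral {0..1} (\<lambda>t::real. t\<^sup>2 * inverse (r\<^sup>2 + l\<^sup>2) ^ 2)"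
    unfolding I by simp
  also have "\<dots> \<le> moment_int l 2 2 r"
    unfolding moment_int_def
  proof (rule integral_le)
    fix t :: real assume t: "t \<in> {0..1}"
    then have "t\<^sup>2 \<le> 1" by (simp add: power_le_one)
    then have "t\<^sup>2 * r\<^sup>2 \<le> r\<^sup>2" by (simp add: mult_left_le_one_le)
    then show "t\<^sup>2 * (inverse (r\<^sup>2 + l\<^sup>2))\<^sup>2 \<le> t\<^sup>2 * (inverse (t\<^sup>2 * r\<^sup>2 + l\<^sup>2))\<^sup>2"
      using nz moment_denom_pos[OF assms, of t r]
      by (intro mult_left_mono power_mono le_imp_inverse_le) auto
  qed (intro integrable_continuous_real continuous_on_moment assms continuous_intros)+
  finally have "1 / 3 * inverse (r\<^sup>2 + l\<^sup>2) ^ 2 \<le> moment_int l 2 2 r" .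
  moreover have "0 < 1 / 3 * inverse (r\<^sup>2 + l\<^sup>2) ^ 2"
    using assms by (simp add: zero_less_power)
  ultimately show ?thesis by (rule less_le_trans[rotated])
qed

section \<open>Stable causality from a time function\<close>

text \<open>Weak monotonicity comes from the fundamental theorem with finitely many exceptional
  points, the integrand being set to 0 there. Strictness comes from the positive derivative at a
  single remaining point.\<close>

lemma increasing_off_finite:
  fixes f :: "real \<Rightarrow> real"
  assumes "finite S" and cont: "continuous_on {0..1} f"
    and deriv: "\<And>x. x \<in> {0<..<1} - S \<Longrightarrow> (f has_vector_derivative d x) (at x)"
    and pos: "\<And>x. x \<in> {0<..<1} - S \<Longrightarrow> 0 < d x"
  shows "f 0 < f 1"
proof -
  have mono: "f x \<le> f y" if "0 \<le> x" "x \<le> y" "y \<le> 1" for x y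
  proof -
    have "((\<lambda>z. if z \<in> {0<..<1} - S then d z else 0) has_integral f y - f x) {x..y}"
    proof (rule fundamental_theorem_of_calculus_interior_strong[OF \<open>finite S\<close> \<open>x \<le> y\<close>])
      fix z assume "z \<in> {x<..<y} - S"
      then have "z \<in> {0<..<1} - S" using that by auto
      then show "(f has_vector_derivative (if z \<in> {0<..<1} - S then d z else 0)) (at z)"
        using deriv by simp
    qed (use that in \<open>auto intro: continuous_on_subset[OF cont]\<close>)
    moreover have "0 \<le> (if z \<in> {0<..<1} - S then d z else 0)" for z
      using pos[of z] by (auto intro: less_imp_le)
    ultimately have "0 \<le> f y - f x" by (rule has_integral_nonneg)
    then show ?thesis by simp
  qed
  have "infinite ({0<..<1::real} - S)"
    by (rule Diff_infinite_finite[OF \<open>finite S\<close>]) simp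
  then have "{0<..<1::real} - S \<noteq> {}" by (rule infinite_imp_nonempty)
  then obtain x where x: "x \<in> {0<..<1} - S" by blast
  have "(f has_real_derivative d x) (at x)"
    using deriv[OF x] by (simp add: has_real_derivative_iff_has_vector_derivative)
  from DERIV_pos_inc_right[OF this pos[OF x]]
  obtain \<delta> where \<delta>: "\<delta> > 0" "\<And>k. 0 < k \<Longrightarrow> k < \<delta> \<Longrightarrow> f x < f (x + k)"
    by blast
  define k where "k = min (\<delta> / 2) (1 - x)"
  have k: "0 < k" "k < \<delta>" "x + k \<le> 1" using x \<delta>(1) by (auto simp: k_def)
  have "f 0 \<le> f x" by (rule mono) (use x in auto)
  also have "\<dots> < f (x + k)" by (rule \<delta>(2)[OF k(1,2)])
  also have "\<dots> \<le> f 1" by (rule mono) (use x k in auto)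
  finally show ?thesis .
qed

text \<open>A linear functional \<open>T\<close> plays the role of a time function with timelike gradient: \<open>g\<close> is positive
  definite on its kernel, with the lower bound \<open>\<lambda>\<close>.\<close>

lemma no_ccc_if_kernel_spacelike:
  fixes T :: "'v::euclidean_space \<Rightarrow> real" and h :: "'v \<Rightarrow> 'v \<Rightarrow> 'v \<Rightarrow> real"
  assumes T: "bounded_linear T"
    and sub: "\<And>p. p \<in> M \<Longrightarrow> subspace (Tn p)"
    and curve: "\<And>\<gamma> s v. \<gamma> ` {0..1} \<subseteq> M \<Longrightarrow> 0 < s \<Longrightarrow> s < 1 \<Longrightarrow> (\<gamma> has_vector_derivative v) (at s) \<Longrightarrow> v \<in> Tn (\<gamma> s)"
    and bil: "\<And>p. p \<in> M \<Longrightarrow> bilinear (h p)" and sym: "\<And>p u v. p \<in> M \<Longrightarrow> h p u v = h p v u"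
    and ker: "\<And>p v. p \<in> M \<Longrightarrow> v \<in> Tn p \<Longrightarrow> T v = 0 \<Longrightarrow> h p v v \<le> 0 \<Longrightarrow> v = 0"
  shows "\<not> contains_ccc M Tn h"
proof
  assume "contains_ccc M Tn h"
  then obtain Y \<gamma> where or: "time_orientation M Tn h Y" and ccc: "closed_causal_curve M h Y \<gamma>"
    unfolding contains_ccc_def by (elim exE conjE)
  from or have Y: "continuous_on M Y" "\<And>p. p \<in> M \<Longrightarrow> Y p \<in> Tn p" "\<And>p. p \<in> M \<Longrightarrow> h p (Y p) (Y p) < 0"
    by (simp_all add: time_orientation_def)
  from ccc obtain S where \<gamma>: "continuous_on {0..1} \<gamma>" "\<gamma> ` {0..1} \<subseteq> M" "\<gamma> 0 = \<gamma> 1" and S: "finite S"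
    and C1: "\<gamma> C1_differentiable_on ({0..1} - S)"
    and fut: "\<forall>s\<in>{0..1} - S. future_causal h Y (\<gamma> s) (vector_derivative \<gamma> (at s))"
    unfolding closed_causal_curve_def by (elim exE conjE)
  have lin: "linear T" using T by (rule bounded_linear.linear)
  have T_timelike: "T (Y p) \<noteq> 0" if p: "p \<in> M" for p
  proof
    assume "T (Y p) = 0"
    then have "Y p = 0" by (rule ker[OF p Y(2)[OF p]]) (use Y(3)[OF p] in simp)
    then show False using Y(3)[OF p] bilinear_lzero[OF bil[OF p], of 0] by simp
  qed
  \<comment> \<open>If \<open>T\<close> had opposite signs on \<open>v\<close> and
    \<open>Y p\<close>, some \<open>v + c *\<^sub>R Y p\<close> with c > 0 would lie in the kernel
    of \<open>T\<close>. Its square is negative, since \<open>v\<close> and \<open>Y p\<close>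
    belong to the same half of the cone, against \<open>ker\<close>.\<close>
  have same_sign: "T v * T (Y p) > 0" if p: "p \<in> M" and v: "v \<in> Tn p" "future_causal h Y p v" for p v
  proof (rule ccontr)
    assume neg: "\<not> 0 < T v * T (Y p)"
    have v': "v \<noteq> 0" "h p v v \<le> 0" "h p (Y p) v < 0" using v(2) by (auto simp: future_causal_def)
    have TY: "T (Y p) \<noteq> 0" by (rule T_timelike[OF p])
    have Tv: "T v \<noteq> 0" using ker[OF p v(1)] v' by blast
    define c where "c = - T v / T (Y p)"
    have "T v * T (Y p) < 0" using neg mult_eq_0_iff[of "T v" "T (Y p)"] TY Tv by linarith
    then have c: "c > 0" by (auto simp: c_def divide_less_0_iff mult_less_0_iff zero_less_divide_iff)
    define z where "z = v + c *\<^sub>R Y p"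
    have "T z = T v + c * T (Y p)"
      by (simp add: z_def linear_add[OF lin] linear_cmul[OF lin])
    then have Tz: "T z = 0" using TY by (simp add: c_def)
    have zT: "z \<in> Tn p"
      unfolding z_def by (intro subspace_add subspace_scale sub p v Y)
    have "h p z z = h p v v + 2 * c * h p (Y p) v + c * c * h p (Y p) (Y p)"
      using sym[OF p, of v "Y p"] unfolding z_def
      by (simp add: bilinear_ladd[OF bil[OF p]] bilinear_radd[OF bil[OF p]] bilinear_lmul[OF bil[OF p]]
          bilinear_rmul[OF bil[OF p]] algebra_simps)
    moreover have "2 * c * h p (Y p) v < 0" "c * c * h p (Y p) (Y p) < 0"
      using c v'(3) Y(3)[OF p] by (simp_all add: mult_pos_neg)
    ultimately have "h p z z < 0" using v'(2) by linarith
    moreover from this have "z = 0" using ker[OF p zT Tz] by simp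
    ultimately show False using bilinear_lzero[OF bil[OF p]] by simp
  qed
  have M: "\<gamma> s \<in> M" if "s \<in> {0..1}" for s using \<gamma>(2) that by blast
  have TYnz: "T (Y (\<gamma> s)) \<noteq> 0" if "s \<in> {0..1}" for s
    by (rule T_timelike[OF M[OF that]])
  \<comment> \<open>The sign of \<open>T\<close> on \<open>Y\<close> is not prescribed, only
    constant along the curve by the intermediate value theorem. Multiplying by its initial value
    makes \<open>c * T\<close> increase strictly, so the curve cannot close.\<close>
  define c where "c = T (Y (\<gamma> 0))"
  have contTY: "continuous_on {0..1} (\<lambda>s. c * T (Y (\<gamma> s)))"
    by (intro continuous_intros bounded_linear.continuous_on[OF T] continuous_on_compose2[OF Y(1) \<gamma>(1,2)])
  have const_sign: "0 < c * T (Y (\<gamma> s))" if s: "s \<in> {0..1}" for s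
  proof (rule ccontr)
    assume "\<not> 0 < c * T (Y (\<gamma> s))"
    moreover have "0 \<le> c * T (Y (\<gamma> 0))" by (simp add: c_def)
    ultimately obtain x where "0 \<le> x" "x \<le> s" "c * T (Y (\<gamma> x)) = 0"
      using IVT2'[of "\<lambda>s. c * T (Y (\<gamma> s))" s 0 0] s continuous_on_subset[OF contTY, of "{0..s}"] by auto
    then show False using TYnz[of x] TYnz[of 0] s by (auto simp: c_def)
  qed
  have "c * T (\<gamma> 0) < c * T (\<gamma> 1)"
  proof (rule increasing_off_finite[OF S])
    show "continuous_on {0..1} (\<lambda>s. c * T (\<gamma> s))"
      by (intro continuous_intros bounded_linear.continuous_on[OF T] \<gamma>)
    fix s :: real assume s: "s \<in> {0<..<1} - S"
    then have s': "s \<in> {0..1} - S" "s \<in> {0..1}" "0 < s" "s < 1" by auto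
    let ?v = "vector_derivative \<gamma> (at s)"
    have d: "(\<gamma> has_vector_derivative ?v) (at s)"
      using C1 s'(1) by (simp add: C1_differentiable_on_eq vector_derivative_works)
    have "((\<lambda>s. T (\<gamma> s)) has_vector_derivative T ?v) (at s)"
      by (rule bounded_linear.has_vector_derivative[OF T d])
    then show "((\<lambda>s. c * T (\<gamma> s)) has_vector_derivative c * T ?v) (at s)"
      by (rule has_vector_derivative_mult_right)
    have "T ?v * T (Y (\<gamma> s)) > 0"
      by (rule same_sign[OF M[OF s'(2)] curve[OF \<gamma>(2) s'(3,4) d] bspec[OF fut s'(1)]])
    with const_sign[OF s'(2)] show "0 < c * T ?v"
      by (auto simp: zero_less_mult_iff)
  qed
  then show False using \<gamma>(3) by simp
qed

text \<open>Two inequalities control every perturbation: \<epsilon> < L keeps it positive definite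
  on the kernel of \<open>T\<close>, and \<epsilon> |X|^2 < 1 keeps \<open>X\<close>
  timelike.\<close>

theorem stably_causal_time_function:
  fixes T :: "'v::euclidean_space \<Rightarrow> real" and g :: "'v \<Rightarrow> 'v \<Rightarrow> 'v \<Rightarrow> real"
  assumes T: "bounded_linear T"
    and sub: "\<And>p. p \<in> M \<Longrightarrow> subspace (Tn p)"
    and curve: "\<And>\<gamma> s v. \<gamma> ` {0..1} \<subseteq> M \<Longrightarrow> 0 < s \<Longrightarrow> s < 1 \<Longrightarrow> (\<gamma> has_vector_derivative v) (at s) \<Longrightarrow> v \<in> Tn (\<gamma> s)"
    and X: "continuous_on M X" "\<And>p. p \<in> M \<Longrightarrow> X p \<in> Tn p" "\<And>p. p \<in> M \<Longrightarrow> g p (X p) (X p) = -1"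
    and L: "continuous_on M L" "\<And>p. p \<in> M \<Longrightarrow> 0 < L p"
    and ker: "\<And>p v. p \<in> M \<Longrightarrow> v \<in> Tn p \<Longrightarrow> T v = 0 \<Longrightarrow> L p * (norm v)\<^sup>2 \<le> g p v v"
  shows "stably_causal M Tn g"
  unfolding stably_causal_def
proof (intro conjI exI allI impI)
  have "time_orientation M Tn g X" using X by (simp add: time_orientation_def)
  then show "time_orientable M Tn g" unfolding time_orientable_def by blast
  \<comment> \<open>A continuous substitute for half the minimum of L and 1 / |X|^2.\<close>
  define \<epsilon> where "\<epsilon> p = inverse (2 * (inverse (L p) + (norm (X p))\<^sup>2))" for p
  have pos: "0 < inverse (L p) + (norm (X p))\<^sup>2" if "p \<in> M" for p
    using L(2)[OF that] by (simp add: add_pos_nonneg)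
  show "continuous_on M \<epsilon>"
    unfolding \<epsilon>_def using pos L by (intro continuous_intros X L) (force simp: less_imp_neq[THEN not_sym])+
  show "\<forall>p\<in>M. 0 < \<epsilon> p"
    unfolding \<epsilon>_def by (intro ballI positive_imp_inverse_positive mult_pos_pos pos) auto
  fix h assume h: "continuous_metric M Tn h \<and> (\<forall>p\<in>M. \<forall>u\<in>Tn p. \<forall>v\<in>Tn p. \<bar>h p u v - g p u v\<bar> \<le> \<epsilon> p * norm u * norm v)"
  have bil: "bilinear (h p)" and sym: "h p u v = h p v u" if "p \<in> M" for p u v
    using h that unfolding continuous_metric_def lorentz_field_def by auto
  have close: "\<bar>h p v v - g p v v\<bar> \<le> \<epsilon> p * (norm v)\<^sup>2" if "p \<in> M" "v \<in> Tn p" for p v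
    using h that by (auto simp: power2_eq_square mult.assoc)
  have \<epsilon>L: "\<epsilon> p < L p" and \<epsilon>X: "\<epsilon> p * (norm (X p))\<^sup>2 < 1" if p: "p \<in> M" for p
  proof -
    have i: "0 < inverse (L p)" "0 \<le> (norm (X p))\<^sup>2" using L(2)[OF p] by auto
    then have "inverse (L p) < 2 * (inverse (L p) + (norm (X p))\<^sup>2)" by argo
    then have "\<epsilon> p < inverse (inverse (L p))"
      unfolding \<epsilon>_def using L(2)[OF p] by (intro less_imp_inverse_less) auto
    then show "\<epsilon> p < L p" by simp
    have "(norm (X p))\<^sup>2 < 2 * (inverse (L p) + (norm (X p))\<^sup>2)" using i by argo
    then show "\<epsilon> p * (norm (X p))\<^sup>2 < 1"
      unfolding \<epsilon>_def using pos[OF p] by (simp add: divide_simps mult.commute)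
  qed
  have "h p (X p) (X p) < 0" if p: "p \<in> M" for p
    using close[OF p X(2)[OF p]] X(3)[OF p] \<epsilon>X[OF p] by linarith
  then have "time_orientation M Tn h X" using X by (simp add: time_orientation_def)
  then show "time_orientable M Tn h" unfolding time_orientable_def by blast
  show "\<not> contains_ccc M Tn h"
  proof (rule no_ccc_if_kernel_spacelike[OF T sub curve bil sym])
    fix p v assume p: "p \<in> M" and v: "v \<in> Tn p" "T v = 0" "h p v v \<le> 0"
    have "L p * (norm v)\<^sup>2 \<le> \<epsilon> p * (norm v)\<^sup>2"
      using ker[OF p v(1,2)] close[OF p v(1)] v(3) by linarith
    then show "v = 0" using \<epsilon>L[OF p] by (simp add: mult_le_cancel_right)
  qed
qed

section \<open>Cartan's structure equations in a chart\<close>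

lemma pd_eqI:
  assumes "(f has_derivative F) (at x)"
  shows "pd k f x = F (axis k 1)"
proof -
  have g: "((\<lambda>s. x + s *\<^sub>R axis k 1) has_derivative (\<lambda>s. s *\<^sub>R axis k 1)) (at (0::real))"
    by (auto intro!: derivative_eq_intros)
  have "((\<lambda>s. f (x + s *\<^sub>R axis k 1)) has_derivative (\<lambda>s. F (s *\<^sub>R axis k 1))) (at 0)"
    by (rule has_derivative_compose[OF g]) (use assms in simp)
  moreover have "F (s *\<^sub>R axis k 1) = F (axis k 1) * s" for s
    using assms has_derivative_linear linear_cmul by fastforce
  ultimately have "((\<lambda>s. f (x + s *\<^sub>R axis k 1)) has_real_derivative F (axis k 1)) (at 0)"
    by (simp add: has_field_derivative_def)
  then show ?thesis
    unfolding pd_def by (rule DERIV_imp_deriv)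
qed

lemma pd_add:
  assumes "f differentiable (at x)" "g differentiable (at x)"
  shows "pd k (\<lambda>y. f y + g y) x = pd k f x + pd k g x"
proof -
  obtain F G where "(f has_derivative F) (at x)" "(g has_derivative G) (at x)"
    using assms by (auto simp: differentiable_def)
  from this[THEN pd_eqI] pd_eqI[OF has_derivative_add[OF this]] show ?thesis
    by simp
qed

lemma pd_mult:
  assumes "f differentiable (at x)" "g differentiable (at x)"
  shows "pd k (\<lambda>y. f y * g y) x = pd k f x * g x + f x * pd k g x"
proof -
  obtain F G where "(f has_derivative F) (at x)" "(g has_derivative G) (at x)"
    using assms by (auto simp: differentiable_def)
  from this[THEN pd_eqI] pd_eqI[OF has_derivative_mult[OF this]] show ?thesis
    by (simp add: algebra_simps)
qed

lemma pd_const [simp]: "pd k (\<lambda>y. c) x = 0"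
  by (simp add: pd_def)

lemma pd_sum:
  assumes "finite I" "\<And>i. i \<in> I \<Longrightarrow> f i differentiable (at x)"
  shows "pd k (\<lambda>y. \<Sum>i\<in>I. f i y) x = (\<Sum>i\<in>I. pd k (f i) x)"
  using assms
proof (induction I rule: finite_induct)
  case (insert i I)
  then have "(\<lambda>y. \<Sum>i\<in>I. f i y) differentiable (at x)"
    by (intro differentiable_sum) auto
  with insert show ?case by (simp add: pd_add)
qed simp

lemma pd_cong:
  assumes "open U" "x \<in> U" "\<And>y. y \<in> U \<Longrightarrow> f y = g y"
  shows "pd k f x = pd k g x"
proof -
  have "((\<lambda>s. x + s *\<^sub>R axis k (1::real)) \<longlongrightarrow> x + 0 *\<^sub>R axis k 1) (at 0)"
    by (intro tendsto_intros)
  then have "((\<lambda>s. x + s *\<^sub>R axis k (1::real)) \<longlongrightarrow> x) (nhds 0)"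
    by (simp add: tendsto_nhds_iff)
  then have "\<forall>\<^sub>F s in nhds 0. x + s *\<^sub>R axis k (1::real) \<in> U"
    using assms(1,2) by (rule topological_tendstoD)
  then have "\<forall>\<^sub>F s in nhds 0. f (x + s *\<^sub>R axis k (1::real)) = g (x + s *\<^sub>R axis k 1)"
    by eventually_elim (rule assms)
  then show ?thesis unfolding pd_def by (intro deriv_cong_ev) auto
qed

section \<open>Partial derivatives of matrix-valued functions\<close>

definition mdiff :: "chart_metric \<Rightarrow> real^4 \<Rightarrow> bool" where
  "mdiff A x \<longleftrightarrow> (\<forall>i j. (\<lambda>y. A y $ i $ j) differentiable (at x))"

definition pdm :: "4 \<Rightarrow> chart_metric \<Rightarrow> real^4 \<Rightarrow> real^4^4" where
  "pdm k A x = (\<chi> i j. pd k (\<lambda>y. A y $ i $ j) x)"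

lemma mdiff_mult:
  assumes "mdiff A x" "mdiff B x"
  shows "mdiff (\<lambda>y. A y ** B y) x"
  using assms unfolding mdiff_def matrix_matrix_mult_def
  by (auto intro!: differentiable_sum differentiable_mult)

lemma mdiff_add: "mdiff A x \<Longrightarrow> mdiff B x \<Longrightarrow> mdiff (\<lambda>y. A y + B y) x"
  unfolding mdiff_def by auto

lemma mdiff_transpose: "mdiff A x \<Longrightarrow> mdiff (\<lambda>y. transpose (A y)) x"
  unfolding mdiff_def transpose_def by auto

lemma mdiff_const: "mdiff (\<lambda>y. C) x"
  unfolding mdiff_def by auto

lemma pdm_mult:
  assumes "mdiff A x" "mdiff B x"
  shows "pdm k (\<lambda>y. A y ** B y) x = pdm k A x ** B x + A x ** pdm k B x"
proof -
  have d: "(\<lambda>y. A y $ i $ j) differentiable (at x)" "(\<lambda>y. B y $ i $ j) differentiable (at x)" for i j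
    using assms unfolding mdiff_def by auto
  have "pd k (\<lambda>y. \<Sum>p\<in>UNIV. A y $ i $ p * B y $ p $ j) x
      = (\<Sum>p\<in>UNIV. pd k (\<lambda>y. A y $ i $ p) x * B x $ p $ j + A x $ i $ p * pd k (\<lambda>y. B y $ p $ j) x)" for i j
    by (subst pd_sum) (auto intro!: differentiable_mult d sum.cong pd_mult)
  then show ?thesis
    unfolding pdm_def matrix_matrix_mult_def by (simp add: vec_eq_iff sum.distrib)
qed

lemma pdm_add:
  assumes "mdiff A x" "mdiff B x"
  shows "pdm k (\<lambda>y. A y + B y) x = pdm k A x + pdm k B x"
  using assms unfolding mdiff_def pdm_def by (simp add: vec_eq_iff pd_add)

lemma pdm_transpose: "pdm k (\<lambda>y. transpose (A y)) x = transpose (pdm k A x)"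
  unfolding pdm_def transpose_def by (simp add: vec_eq_iff)

lemma pdm_const [simp]: "pdm k (\<lambda>y. C) x = 0"
  unfolding pdm_def by (simp add: vec_eq_iff)

lemma pdm_cong:
  assumes "open U" "x \<in> U" "\<And>y. y \<in> U \<Longrightarrow> A y = B y"
  shows "pdm k A x = pdm k B x"
  unfolding pdm_def vec_eq_iff vec_lambda_beta
  by (intro allI pd_cong[OF assms(1,2)]) (simp add: assms(3))

lemma matrix_add_rdistrib: "(A + B) ** C = A ** C + B ** (C :: 'a::ring_1^'n^'m)"
  by (simp add: vec_eq_iff matrix_matrix_mult_def sum.distrib distrib_right)

lemma matrix_diff_rdistrib: "(A - B) ** C = A ** C - B ** (C :: 'a::ring_1^'n^'m)"
  by (simp add: vec_eq_iff matrix_matrix_mult_def sum_subtractf left_diff_distrib)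

lemma matrix_diff_ldistrib: "A ** (B - C) = A ** B - A ** (C :: 'a::ring_1^'n^'m)"
  by (simp add: vec_eq_iff matrix_matrix_mult_def sum_subtractf right_diff_distrib)

lemmas matrix_ring_simps = matrix_add_ldistrib matrix_add_rdistrib matrix_mul_assoc
  matrix_diff_ldistrib matrix_diff_rdistrib

lemma matrix_inv_eqI:
  fixes A B :: "'a::field^'n^'n"
  assumes "A ** B = mat 1"
  shows "matrix_inv A = B"
proof -
  have BA: "B ** A = mat 1"
    using assms by (rule iffD1[OF matrix_left_right_inverse])
  have "A ** matrix_inv A = mat 1 \<and> matrix_inv A ** A = mat 1"
    unfolding matrix_inv_def by (rule someI[of _ B]) (simp add: assms BA)
  then have "B ** (A ** matrix_inv A) = B" by simp
  then show ?thesis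
    unfolding matrix_mul_assoc BA by simp
qed

text \<open>A coframe \<open>\<Theta>\<close> (rows are one-forms) with constant frame metric \<open>\<eta>\<close>, dual frame \<open>E\<close>, and
  connection matrices \<open>om k\<close> (the \<open>dx\<^sup>k\<close>-components of the connection forms) that solve
  the first structure equation.\<close>

locale cartan_coframe =
  fixes U :: "(real^4) set" and g \<Theta> E :: chart_metric and \<eta> \<eta>i :: "real^4^4"
    and om d\<Theta> :: "4 \<Rightarrow> chart_metric"
  assumes open_U: "open U"
    and diff_\<Theta>: "x \<in> U \<Longrightarrow> mdiff \<Theta> x"
    and pdm_\<Theta>: "x \<in> U \<Longrightarrow> pdm k \<Theta> x = d\<Theta> k x"
    and diff_d\<Theta>: "x \<in> U \<Longrightarrow> mdiff (d\<Theta> k) x"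
    and sym_d\<Theta>: "x \<in> U \<Longrightarrow> pdm k (d\<Theta> l) x = pdm l (d\<Theta> k) x"
    and diff_om: "x \<in> U \<Longrightarrow> mdiff (om k) x"
    and diff_E: "x \<in> U \<Longrightarrow> mdiff E x"
    and dual: "x \<in> U \<Longrightarrow> \<Theta> x ** E x = mat 1"
    and metric: "x \<in> U \<Longrightarrow> g x = transpose (\<Theta> x) ** \<eta> ** \<Theta> x"
    and \<eta>_sym: "transpose \<eta> = \<eta>"
    and \<eta>_inv: "\<eta> ** \<eta>i = mat 1"
    and skew: "x \<in> U \<Longrightarrow> transpose (\<eta> ** om k x) = - (\<eta> ** om k x)"
    and torsion: "x \<in> U \<Longrightarrow> (d\<Theta> k x + om k x ** \<Theta> x) $ b $ l = (d\<Theta> l x + om l x ** \<Theta> x) $ b $ k"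
begin

text \<open>The derivative of the coframe, corrected in its frame index. \<open>torsion\<close> says
  that it is symmetric in the derivative index and the form index.\<close>

definition P where "P k x = d\<Theta> k x + om k x ** \<Theta> x"

text \<open>The Christoffel symbols as matrices: entry i, k of \<open>N j x\<close> carries upper
  index i and lower indices j, k, by \<open>christoffel_eq\<close>.\<close>

definition N where "N k x = E x ** P k x"

text \<open>The curvature two-forms d om + om \<and> om, in their components along
  \<open>dx\<^sup>k\<close> and \<open>dx\<^sup>l\<close>.\<close>

definition Om where
  "Om k l x = pdm k (om l) x - pdm l (om k) x + om k x ** om l x - om l x ** om k x"

lemma dual': "x \<in> U \<Longrightarrow> E x ** \<Theta> x = mat 1"
  by (rule iffD1[OF matrix_left_right_inverse]) (rule dual)

lemma metric_inverse:
  assumes "x \<in> U"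
  shows "matrix_inv (g x) = E x ** \<eta>i ** transpose (E x)"
proof (rule matrix_inv_eqI)
  have "g x ** (E x ** \<eta>i ** transpose (E x))
      = transpose (\<Theta> x) ** \<eta> ** (\<Theta> x ** E x) ** \<eta>i ** transpose (E x)"
    by (simp add: metric[OF assms] matrix_mul_assoc)
  also have "\<dots> = transpose (\<Theta> x) ** (\<eta> ** \<eta>i) ** transpose (E x)"
    unfolding dual[OF assms] matrix_mul_rid matrix_mul_assoc ..
  also have "\<dots> = transpose (E x ** \<Theta> x)"
    by (simp add: \<eta>_inv matrix_transpose_mul)
  also have "\<dots> = mat 1" using assms by (simp add: dual')
  finally show "g x ** (E x ** \<eta>i ** transpose (E x)) = mat 1" .
qed

text \<open>The connection terms that complete \<open>d\<Theta> k\<close> to \<open>P k\<close>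
  cancel in the symmetrised expression, because \<open>\<eta> ** om k x\<close> is skew.\<close>

lemma pdm_metric:
  assumes x: "x \<in> U"
  shows "pdm k g x = transpose (transpose (\<Theta> x) ** \<eta> ** P k x) + transpose (\<Theta> x) ** \<eta> ** P k x"
proof -
  have d: "mdiff \<Theta> x" "mdiff (\<lambda>y. transpose (\<Theta> y)) x" "mdiff (\<lambda>y. transpose (\<Theta> y) ** \<eta>) x"
    using x by (auto intro!: diff_\<Theta> mdiff_transpose mdiff_mult mdiff_const)
  have "pdm k g x = pdm k (\<lambda>y. transpose (\<Theta> y) ** \<eta> ** \<Theta> y) x"
    by (rule pdm_cong[OF open_U x]) (rule metric)
  also have "\<dots> = transpose (d\<Theta> k x) ** \<eta> ** \<Theta> x + transpose (\<Theta> x) ** \<eta> ** d\<Theta> k x"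
    using d x by (simp add: pdm_mult mdiff_const pdm_transpose pdm_\<Theta>)
  finally have 1: "pdm k g x = transpose (d\<Theta> k x) ** \<eta> ** \<Theta> x + transpose (\<Theta> x) ** \<eta> ** d\<Theta> k x" .
  have "transpose (\<Theta> x) ** (transpose (\<eta> ** om k x) + \<eta> ** om k x) ** \<Theta> x = 0"
    using x by (simp add: skew)
  then have 2: "transpose (\<Theta> x) ** transpose (om k x) ** \<eta> ** \<Theta> x
      + transpose (\<Theta> x) ** \<eta> ** om k x ** \<Theta> x = 0"
    by (simp add: matrix_ring_simps matrix_transpose_mul \<eta>_sym)
  have 3: "transpose (A + B) = transpose A + transpose B" for A B :: "real^4^4"
    by (simp add: transpose_def vec_eq_iff)
  from 2 have 4: "transpose (\<Theta> x) ** transpose (om k x) ** \<eta> ** \<Theta> x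
      = - (transpose (\<Theta> x) ** \<eta> ** om k x ** \<Theta> x)"
    by (rule eq_neg_iff_add_eq_0[THEN iffD2])
  show ?thesis
    unfolding 1 P_def by (simp add: matrix_ring_simps matrix_transpose_mul \<eta>_sym 3 4)
qed

text \<open>Koszul's argument: by \<open>torsion\<close>, \<open>Q\<close> is symmetric in
  derivative and form index, so the alternating sum of the three first derivatives of the metric
  leaves twice a single term.\<close>

lemma christoffel_eq:
  assumes x: "x \<in> U"
  shows "christoffel g i j k x = N j x $ i $ k"
proof -
  define Q where "Q j = transpose (\<Theta> x) ** \<eta> ** P j x" for j
  have Qs: "Q k $ i $ l = Q l $ i $ k" for i k l
    unfolding Q_def matrix_matrix_mult_def[of _ "P _ x"]
    using torsion[OF x] by (simp add: P_def)
  have pdg: "pd k (\<lambda>y. g y $ i $ j) x = Q k $ j $ i + Q k $ i $ j" for i j k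
  proof -
    have "pdm k g x $ i $ j = (transpose (Q k) + Q k) $ i $ j"
      using pdm_metric[OF x] by (simp add: Q_def)
    then show ?thesis by (simp add: pdm_def transpose_def)
  qed
  have "pd j (\<lambda>y. g y $ p $ k) x + pd k (\<lambda>y. g y $ p $ j) x - pd p (\<lambda>y. g y $ j $ k) x
      = 2 * Q j $ p $ k" for p
    unfolding pdg using Qs[of j k p] Qs[of k j p] Qs[of j p k] by simp
  then have "christoffel g i j k x = (\<Sum>p\<in>UNIV. matrix_inv (g x) $ i $ p * Q j $ p $ k)"
    unfolding christoffel_def by (simp add: sum_distrib_left mult.left_commute)
  also have "\<dots> = (matrix_inv (g x) ** Q j) $ i $ k"
    by (simp add: matrix_matrix_mult_def)
  also have "matrix_inv (g x) ** Q j = E x ** \<eta>i ** transpose (\<Theta> x ** E x) ** \<eta> ** P j x"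
    by (simp add: Q_def metric_inverse[OF x] matrix_mul_assoc matrix_transpose_mul)
  also have "\<dots> = E x ** (\<eta>i ** \<eta>) ** P j x"
    using x by (simp add: dual matrix_mul_assoc)
  also have "\<eta>i ** \<eta> = mat 1"
    using \<eta>_inv by (rule iffD1[OF matrix_left_right_inverse])
  finally show ?thesis by (simp add: N_def)
qed

lemma mdiff_P: "x \<in> U \<Longrightarrow> mdiff (P k) x"
  unfolding P_def by (intro mdiff_add mdiff_mult diff_\<Theta> diff_d\<Theta> diff_om)

lemma mdiff_N: "x \<in> U \<Longrightarrow> mdiff (N k) x"
  unfolding N_def by (intro mdiff_mult diff_E mdiff_P)

lemma \<Theta>_N: "x \<in> U \<Longrightarrow> \<Theta> x ** N k x = P k x"
  by (simp add: N_def dual matrix_mul_assoc)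

lemma riemann_up_eq:
  assumes x: "x \<in> U"
  shows "riemann_up g i j k l x =
    (pdm k (N l) x - pdm l (N k) x + N k x ** N l x - N l x ** N k x) $ i $ j"
proof -
  have "pd k (christoffel g i l j) x = pdm k (N l) x $ i $ j" for k l
    unfolding pdm_def using pd_cong[OF open_U x christoffel_eq] by simp
  then show ?thesis
    unfolding riemann_up_def
    using x by (simp add: christoffel_eq matrix_matrix_mult_def sum_subtractf)
qed

text \<open>Differentiate \<open>\<Theta> ** N l = d\<Theta> l + om l ** \<Theta>\<close> in
  direction k and antisymmetrise in k and l. The second derivatives of the coframe cancel by
  \<open>sym_d\<Theta>\<close>, and eliminating \<open>d\<Theta>\<close> leaves the commutator
  terms.\<close>

lemma second_structure:
  assumes x: "x \<in> U"
  shows "\<Theta> x ** (pdm k (N l) x - pdm l (N k) x + N k x ** N l x - N l x ** N k x) = Om k l x ** \<Theta> x"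
proof -
  have deriv: "d\<Theta> k x ** N l x + \<Theta> x ** pdm k (N l) x
      = pdm k (d\<Theta> l) x + pdm k (om l) x ** \<Theta> x + om l x ** d\<Theta> k x" for k l
  proof -
    have "pdm k (\<lambda>y. \<Theta> y ** N l y) x = pdm k (\<lambda>y. d\<Theta> l y + om l y ** \<Theta> y) x"
      by (rule pdm_cong[OF open_U x]) (simp add: \<Theta>_N P_def)
    then show ?thesis
      using x by (simp add: pdm_mult pdm_add mdiff_mult diff_\<Theta> mdiff_N diff_d\<Theta> diff_om pdm_\<Theta>)
  qed
  have d: "d\<Theta> k x = \<Theta> x ** N k x - om k x ** \<Theta> x" for k
    using \<Theta>_N[OF x, of k] by (simp add: P_def)
  have e: "\<Theta> x ** pdm k (N l) x = pdm k (d\<Theta> l) x + pdm k (om l) x ** \<Theta> x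
      + om l x ** (\<Theta> x ** N k x - om k x ** \<Theta> x) - (\<Theta> x ** N k x - om k x ** \<Theta> x) ** N l x" for k l
    using deriv[of k l] unfolding d by (metis add_diff_cancel_left')
  show ?thesis
    unfolding Om_def matrix_add_ldistrib matrix_diff_ldistrib matrix_add_rdistrib matrix_diff_rdistrib
      e matrix_mul_assoc sym_d\<Theta>[OF x, of k l] by (simp only: diff_conv_add_uminus minus_add_distrib minus_minus ac_simps)  simp
qed

theorem riemann_eq:
  assumes x: "x \<in> U"
  shows "riemann g i j k l x = (transpose (\<Theta> x) ** (\<eta> ** Om k l x) ** \<Theta> x) $ i $ j"
proof -
  let ?R = "pdm k (N l) x - pdm l (N k) x + N k x ** N l x - N l x ** N k x"
  have "riemann g i j k l x = (g x ** ?R) $ i $ j"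
    unfolding riemann_def riemann_up_eq[OF x] by (simp add: matrix_matrix_mult_def)
  also have "g x ** ?R = transpose (\<Theta> x) ** \<eta> ** (\<Theta> x ** ?R)"
    by (simp add: metric[OF x] matrix_mul_assoc)
  finally show ?thesis
    by (simp add: second_structure[OF x] matrix_mul_assoc)
qed

end

section \<open>Boundedness of scalar polynomials\<close>

definition bounded_on :: "'a set \<Rightarrow> ('a \<Rightarrow> real) \<Rightarrow> bool" where
  "bounded_on U f \<longleftrightarrow> (\<exists>C. \<forall>x\<in>U. \<bar>f x\<bar> \<le> C)"

lemma bounded_onI: "(\<And>x. x \<in> U \<Longrightarrow> \<bar>f x\<bar> \<le> C) \<Longrightarrow> bounded_on U f"
  unfolding bounded_on_def by blast

lemma bounded_on_const: "bounded_on U (\<lambda>x. c)"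
  by (rule bounded_onI[of _ _ "\<bar>c\<bar>"]) simp

lemma bounded_on_add: 
  assumes "bounded_on U f" "bounded_on U g" shows "bounded_on U (\<lambda>x. f x + g x)"
proof -
  obtain C D where "\<forall>x\<in>U. \<bar>f x\<bar> \<le> C" "\<forall>x\<in>U. \<bar>g x\<bar> \<le> D"
    using assms unfolding bounded_on_def by blast
  then show ?thesis by (intro bounded_onI[of _ _ "C + D"]) (fastforce intro: order_trans[OF abs_triangle_ineq])
qed

lemma bounded_on_mult: 
  assumes "bounded_on U f" "bounded_on U g" shows "bounded_on U (\<lambda>x. f x * g x)"
proof -
  obtain C D where "\<forall>x\<in>U. \<bar>f x\<bar> \<le> C" "\<forall>x\<in>U. \<bar>g x\<bar> \<le> D"
    using assms unfolding bounded_on_def by blast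
  then show ?thesis
    by (intro bounded_onI[of _ _ "C * D"]) (auto simp: abs_mult intro!: mult_mono order_trans[OF abs_ge_zero])
qed

lemma bounded_on_sum: 
  assumes "finite I" "\<And>i. i \<in> I \<Longrightarrow> bounded_on U (f i)" shows "bounded_on U (\<lambda>x. \<Sum>i\<in>I. f i x)"
  using assms by (induction I rule: finite_induct) (auto intro: bounded_on_add bounded_on_const)

definition lists4 :: "nat \<Rightarrow> 4 list set" where "lists4 k = {as. length as = k}"

lemma lists4_iff: "as \<in> lists4 k \<longleftrightarrow> length as = k"
  by (simp add: lists4_def)

lemma lists4_0: "lists4 0 = {[]}"
  by (simp add: lists4_def)

lemma sum_lists4_Suc: "(\<Sum>as\<in>lists4 (Suc k). f as) = (\<Sum>a\<in>UNIV. \<Sum>as\<in>lists4 k. f (a # as))"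
proof -
  have "(\<Sum>as\<in>lists4 (Suc k). f as) = (\<Sum>p\<in>UNIV \<times> lists4 k. f (fst p # snd p))"
    by (rule sum.reindex_bij_witness[of _ "\<lambda>p. fst p # snd p" "\<lambda>as. (hd as, tl as)"])
      (auto simp: lists4_def length_Suc_conv)
  then show ?thesis by (simp add: sum.cartesian_product split_def)
qed

lemma sum_lists4_append:
  "(\<Sum>as\<in>lists4 (k + n). f as) = (\<Sum>as\<in>lists4 k. \<Sum>bs\<in>lists4 n. f (as @ bs))"
  by (induction k arbitrary: f) (simp_all add: lists4_0 sum_lists4_Suc)

lemma prod_lessThan_add:
  fixes k n :: nat and f :: "nat \<Rightarrow> real"
  shows "(\<Prod>i<k+n. f i) = (\<Prod>i<k. f i) * (\<Prod>i<n. f (k + i))"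
  by (induction n) (simp_all add: mult.assoc)

text \<open>The coordinate component \<open>js\<close> of the tensor product of the coframe
  one-forms numbered by \<open>as\<close>.\<close>

definition frame_prod :: "real^4^4 \<Rightarrow> nat \<Rightarrow> 4 list \<Rightarrow> 4 list \<Rightarrow> real" where
  "frame_prod T k as js = (\<Prod>i<k. T $ (as ! i) $ (js ! i))"

lemma frame_prod_0: "frame_prod T 0 as js = 1"
  by (simp add: frame_prod_def)

lemma frame_prod_Suc:
  "frame_prod T (Suc k) (b # as) (j # js) = T $ b $ j * frame_prod T k as js"
  by (simp only: frame_prod_def prod.lessThan_Suc_shift) simp

lemma frame_prod_append:
  assumes "length as = k" "length js = k + n"
  shows "frame_prod T (k + n) (as @ bs) js = frame_prod T k as (take k js) * frame_prod T n bs (drop k js)"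
  using assms by (simp add: frame_prod_def prod_lessThan_add nth_append)

text \<open>Boundedness is demanded of the components in the coframe, a property that survives
  contraction even where the coframe degenerates.\<close>

definition bounded_frame :: "(real^4) set \<Rightarrow> chart_metric \<Rightarrow> nat \<Rightarrow> chart_tensor \<Rightarrow> bool" where
  "bounded_frame U \<Theta> k A \<longleftrightarrow> (\<exists>B.
     (\<forall>x\<in>U. \<forall>js\<in>lists4 k. A x js = (\<Sum>as\<in>lists4 k. B as x * frame_prod (\<Theta> x) k as js)) \<and>
     (\<forall>as\<in>lists4 k. bounded_on U (B as)))"

lemma bounded_frameI:
  assumes "\<And>x js. x \<in> U \<Longrightarrow> js \<in> lists4 k \<Longrightarrow>
      A x js = (\<Sum>as\<in>lists4 k. B as x * frame_prod (\<Theta> x) k as js)"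
    and "\<And>as. as \<in> lists4 k \<Longrightarrow> bounded_on U (B as)"
  shows "bounded_frame U \<Theta> k A"
  using assms unfolding bounded_frame_def by blast

lemma bounded_frameE:
  assumes "bounded_frame U \<Theta> k A"
  obtains B where "\<And>x js. x \<in> U \<Longrightarrow> js \<in> lists4 k \<Longrightarrow>
      A x js = (\<Sum>as\<in>lists4 k. B as x * frame_prod (\<Theta> x) k as js)"
    and "\<And>as. as \<in> lists4 k \<Longrightarrow> bounded_on U (B as)"
  using assms unfolding bounded_frame_def by blast

lemma bounded_frame_add:
  assumes "bounded_frame U \<Theta> k A" "bounded_frame U \<Theta> k A'"
  shows "bounded_frame U \<Theta> k (\<lambda>x js. A x js + A' x js)"
proof -
  obtain B where B: "\<And>x js. x \<in> U \<Longrightarrow> js \<in> lists4 k \<Longrightarrow>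
      A x js = (\<Sum>as\<in>lists4 k. B as x * frame_prod (\<Theta> x) k as js)"
    "\<And>as. as \<in> lists4 k \<Longrightarrow> bounded_on U (B as)" using bounded_frameE[OF assms(1)] by metis
  obtain B' where B': "\<And>x js. x \<in> U \<Longrightarrow> js \<in> lists4 k \<Longrightarrow>
      A' x js = (\<Sum>as\<in>lists4 k. B' as x * frame_prod (\<Theta> x) k as js)"
    "\<And>as. as \<in> lists4 k \<Longrightarrow> bounded_on U (B' as)" using bounded_frameE[OF assms(2)] by metis
  show ?thesis
    by (rule bounded_frameI[where B = "\<lambda>as x. B as x + B' as x"])
      (simp_all add: B B' distrib_right sum.distrib bounded_on_add)
qed

lemma bounded_frame_prod:
  assumes "bounded_frame U \<Theta> k A" "bounded_frame U \<Theta> n A'"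
  shows "bounded_frame U \<Theta> (k + n) (\<lambda>x js. A x (take k js) * A' x (drop k js))"
proof -
  obtain B where B: "\<And>x js. x \<in> U \<Longrightarrow> js \<in> lists4 k \<Longrightarrow>
      A x js = (\<Sum>as\<in>lists4 k. B as x * frame_prod (\<Theta> x) k as js)"
    "\<And>as. as \<in> lists4 k \<Longrightarrow> bounded_on U (B as)" using bounded_frameE[OF assms(1)] by metis
  obtain B' where B': "\<And>x js. x \<in> U \<Longrightarrow> js \<in> lists4 n \<Longrightarrow>
      A' x js = (\<Sum>as\<in>lists4 n. B' as x * frame_prod (\<Theta> x) n as js)"
    "\<And>as. as \<in> lists4 n \<Longrightarrow> bounded_on U (B' as)" using bounded_frameE[OF assms(2)] by metis
  show ?thesis
  proof (rule bounded_frameI[where B = "\<lambda>as x. B (take k as) x * B' (drop k as) x"])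
    fix x js assume x: "x \<in> U" and js: "js \<in> lists4 (k + n)"
    then have "take k js \<in> lists4 k" "drop k js \<in> lists4 n" by (auto simp: lists4_def)
    then have "A x (take k js) * A' x (drop k js) =
       (\<Sum>as\<in>lists4 k. B as x * frame_prod (\<Theta> x) k as (take k js)) *
       (\<Sum>bs\<in>lists4 n. B' bs x * frame_prod (\<Theta> x) n bs (drop k js))"
      using x by (simp add: B B')
    also have "\<dots> = (\<Sum>as\<in>lists4 k. \<Sum>bs\<in>lists4 n.
       (B as x * frame_prod (\<Theta> x) k as (take k js)) * (B' bs x * frame_prod (\<Theta> x) n bs (drop k js)))"
      by (rule sum_product)
    also have "\<dots> = (\<Sum>as\<in>lists4 k. \<Sum>bs\<in>lists4 n.
       B (take k (as @ bs)) x * B' (drop k (as @ bs)) x * frame_prod (\<Theta> x) (k + n) (as @ bs) js)"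
    proof (intro sum.cong refl)
      fix as bs assume "as \<in> lists4 k" "bs \<in> lists4 n"
      then have "length as = k" "length js = k + n" using js by (auto simp: lists4_def)
      then show "(B as x * frame_prod (\<Theta> x) k as (take k js)) * (B' bs x * frame_prod (\<Theta> x) n bs (drop k js))
        = B (take k (as @ bs)) x * B' (drop k (as @ bs)) x * frame_prod (\<Theta> x) (k + n) (as @ bs) js"
        by (simp add: frame_prod_append)
    qed
    finally show "A x (take k js) * A' x (drop k js) = (\<Sum>as\<in>lists4 (k + n).
        B (take k as) x * B' (drop k as) x * frame_prod (\<Theta> x) (k + n) as js)"
      by (simp only: sum_lists4_append)
  qed (auto simp: lists4_def intro!: bounded_on_mult B B')
qed

text \<open>\<open>frame_prod\<close> is unchanged when both index lists are permuted alike, so the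
  frame components undergo the same permutation as the coordinate components.\<close>

lemma bounded_frame_permute:
  assumes "bounded_frame U \<Theta> k A" and \<sigma>: "\<sigma> permutes {..<k}"
  shows "bounded_frame U \<Theta> k (\<lambda>x js. A x (map (\<lambda>i. js ! \<sigma> i) [0..<k]))"
proof -
  obtain B where B: "\<And>x js. x \<in> U \<Longrightarrow> js \<in> lists4 k \<Longrightarrow>
      A x js = (\<Sum>as\<in>lists4 k. B as x * frame_prod (\<Theta> x) k as js)"
    "\<And>as. as \<in> lists4 k \<Longrightarrow> bounded_on U (B as)" using bounded_frameE[OF assms(1)] by metis
  define pm where "pm \<tau> js = map (\<lambda>i. js ! \<tau> i) [0..<k]" for \<tau> and js :: "4 list"
  let ?\<tau> = "inv \<sigma>"
  have lt: "\<sigma> i < k" "?\<tau> i < k" if "i < k" for i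
    using that permutes_in_image[OF \<sigma>, of i] permutes_in_image[OF permutes_inv[OF \<sigma>], of i] by auto
  have pm: "pm \<tau> js \<in> lists4 k" for \<tau> js by (simp add: pm_def lists4_def)
  have inv: "pm \<sigma> (pm ?\<tau> js) = js" "pm ?\<tau> (pm \<sigma> js) = js" if "js \<in> lists4 k" for js
    using that by (auto simp: pm_def lists4_def list_eq_iff_nth_eq lt permutes_inverses[OF \<sigma>])
  show ?thesis
  proof (rule bounded_frameI[where B = "\<lambda>as. B (pm \<sigma> as)"])
    fix x js assume x: "x \<in> U" and js: "js \<in> lists4 k"
    have fp: "frame_prod (\<Theta> x) k (pm \<sigma> as) (pm \<sigma> js) = frame_prod (\<Theta> x) k as js" for as
    proof -
      have "frame_prod (\<Theta> x) k (pm \<sigma> as) (pm \<sigma> js) = (\<Prod>i<k. \<Theta> x $ (as ! \<sigma> i) $ (js ! \<sigma> i))"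
        by (simp add: frame_prod_def pm_def)
      also have "\<dots> = frame_prod (\<Theta> x) k as js"
        unfolding frame_prod_def
        by (rule prod.permute[OF \<sigma>, of "\<lambda>i. \<Theta> x $ (as ! i) $ (js ! i)", unfolded comp_def, symmetric])
      finally show ?thesis .
    qed
    have "A x (pm \<sigma> js) = (\<Sum>as\<in>lists4 k. B as x * frame_prod (\<Theta> x) k as (pm \<sigma> js))"
      by (rule B(1)[OF x pm])
    also have "\<dots> = (\<Sum>as\<in>lists4 k. B (pm \<sigma> as) x * frame_prod (\<Theta> x) k (pm \<sigma> as) (pm \<sigma> js))"
      by (rule sum.reindex_bij_witness[of _ "pm \<sigma>" "pm ?\<tau>"]) (simp_all add: inv pm)
    also have "\<dots> = (\<Sum>as\<in>lists4 k. B (pm \<sigma> as) x * frame_prod (\<Theta> x) k as js)"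
      by (simp add: fp)
    finally show "A x (map (\<lambda>i. js ! \<sigma> i) [0..<k]) =
        (\<Sum>as\<in>lists4 k. B (pm \<sigma> as) x * frame_prod (\<Theta> x) k as js)"
      by (simp add: pm_def)
  qed (rule B(2)[OF pm])
qed

lemma sum_swap_2_1:
  "(\<Sum>i\<in>I. \<Sum>j\<in>J. \<Sum>a\<in>A. G i j a) = (\<Sum>a\<in>A. \<Sum>i\<in>I. \<Sum>j\<in>J. G i j a)"
proof -
  have "(\<Sum>i\<in>I. \<Sum>j\<in>J. \<Sum>a\<in>A. G i j a) = (\<Sum>i\<in>I. \<Sum>a\<in>A. \<Sum>j\<in>J. G i j a)"
    by (intro sum.cong refl sum.swap)
  also have "\<dots> = (\<Sum>a\<in>A. \<Sum>i\<in>I. \<Sum>j\<in>J. G i j a)"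
    by (rule sum.swap)
  finally show ?thesis .
qed

lemma sum_swap_2_3:
  "(\<Sum>i\<in>I. \<Sum>j\<in>J. \<Sum>a\<in>A. \<Sum>b\<in>B. \<Sum>c\<in>C. G i j a b c)
    = (\<Sum>a\<in>A. \<Sum>b\<in>B. \<Sum>c\<in>C. \<Sum>i\<in>I. \<Sum>j\<in>J. G i j a b c)"
  by (rule trans[OF sum_swap_2_1], rule sum.cong[OF refl], rule trans[OF sum_swap_2_1],
      rule sum.cong[OF refl], rule sum_swap_2_1)

text \<open>Contracting two coframe one-forms with the inverse metric yields a constant, so each new
  component is a fixed linear combination of old ones.\<close>

lemma bounded_frame_contract:
  assumes "bounded_frame U \<Theta> (k + 2) A"
    and G: "\<And>x. x \<in> U \<Longrightarrow> \<Theta> x ** G x ** transpose (\<Theta> x) = \<eta>i"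
  shows "bounded_frame U \<Theta> k (\<lambda>x js. \<Sum>i\<in>UNIV. \<Sum>j\<in>UNIV. G x $ i $ j * A x (i # j # js))"
proof -
  obtain B where B: "\<And>x js. x \<in> U \<Longrightarrow> js \<in> lists4 (k + 2) \<Longrightarrow>
      A x js = (\<Sum>as\<in>lists4 (k + 2). B as x * frame_prod (\<Theta> x) (k + 2) as js)"
    "\<And>as. as \<in> lists4 (k + 2) \<Longrightarrow> bounded_on U (B as)" using bounded_frameE[OF assms(1)] by metis
  have k2: "k + 2 = Suc (Suc k)" by simp
  show ?thesis
  proof (rule bounded_frameI[where B = "\<lambda>as x. \<Sum>a\<in>UNIV. \<Sum>b\<in>UNIV. \<eta>i $ a $ b * B (a # b # as) x"])
    fix x js assume x: "x \<in> U" and js: "js \<in> lists4 k"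
    have GT: "(\<Sum>i\<in>UNIV. \<Sum>j\<in>UNIV. \<Theta> x $ a $ i * \<Theta> x $ b $ j * G x $ i $ j) = \<eta>i $ a $ b" for a b
      unfolding G[OF x, symmetric] matrix_matrix_mult_def transpose_def
      by (subst sum.swap) (simp add: sum_distrib_left sum_distrib_right mult_ac)
    have "(\<Sum>i\<in>UNIV. \<Sum>j\<in>UNIV. G x $ i $ j * A x (i # j # js)) =
      (\<Sum>i\<in>UNIV. \<Sum>j\<in>UNIV. \<Sum>a\<in>UNIV. \<Sum>b\<in>UNIV. \<Sum>as\<in>lists4 k.
        \<Theta> x $ a $ i * \<Theta> x $ b $ j * G x $ i $ j * (B (a # b # as) x * frame_prod (\<Theta> x) k as js))"
      using js unfolding k2 
      by (subst B(1)[OF x])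
        (simp_all add: lists4_iff sum_lists4_Suc frame_prod_Suc sum_distrib_left mult_ac)
    also have "\<dots> = (\<Sum>a\<in>UNIV. \<Sum>b\<in>UNIV. \<Sum>as\<in>lists4 k. \<Sum>i\<in>UNIV. \<Sum>j\<in>UNIV.
        \<Theta> x $ a $ i * \<Theta> x $ b $ j * G x $ i $ j * (B (a # b # as) x * frame_prod (\<Theta> x) k as js))"
      by (rule sum_swap_2_3)
    also have "\<dots> = (\<Sum>a\<in>UNIV. \<Sum>b\<in>UNIV. \<Sum>as\<in>lists4 k. \<eta>i $ a $ b * (B (a # b # as) x * frame_prod (\<Theta> x) k as js))"
      by (simp only: sum_distrib_right[symmetric] GT)
    also have "\<dots> = (\<Sum>as\<in>lists4 k. \<Sum>a\<in>UNIV. \<Sum>b\<in>UNIV. \<eta>i $ a $ b * (B (a # b # as) x * frame_prod (\<Theta> x) k as js))"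
      by (rule sum_swap_2_1)
    finally show "(\<Sum>i\<in>UNIV. \<Sum>j\<in>UNIV. G x $ i $ j * A x (i # j # js)) = (\<Sum>as\<in>lists4 k.
        (\<Sum>a\<in>UNIV. \<Sum>b\<in>UNIV. \<eta>i $ a $ b * B (a # b # as) x) * frame_prod (\<Theta> x) k as js)"
      by (simp add: sum_distrib_right mult.assoc)
  next
    fix as assume "as \<in> lists4 k"
    then have "bounded_on U (B (a # b # as))" for a b
      by (intro B) (simp add: lists4_def)
    then show "bounded_on U (\<lambda>x. \<Sum>a\<in>UNIV. \<Sum>b\<in>UNIV. \<eta>i $ a $ b * B (a # b # as) x)"
      by (intro bounded_on_sum bounded_on_mult bounded_on_const) auto
  qed
qed

lemma prod_4: "prod f (UNIV :: 4 set) = f 1 * f 2 * f 3 * (f 4 :: real)"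
  unfolding UNIV_4 by (simp add: mult_ac)

lemma lessThan_4: "{..<4::nat} = {0, 1, 2, 3}"
  by auto

text \<open>Multiplying the matrix of unit rows by the transposed coframe turns its rows into
  columns of \<Theta>. Expanding the determinant multilinearly in these rows gives det \<Theta>
  times the permutation symbol as a combination of frame products. The sign of det \<Theta>, which
  turns det into its absolute value, is bounded.\<close>

lemma bounded_frame_volume:
  shows "bounded_frame U \<Theta> 4 (\<lambda>x js. \<bar>det (\<Theta> x)\<bar> * c *
    det (vector [axis (js!0) 1, axis (js!1) 1, axis (js!2) 1, axis (js!3) 1] :: real^4^4))"
proof (rule bounded_frameI[where B = "\<lambda>as x. sgn (det (\<Theta> x)) * c *
    det (vector [axis (as!0) 1, axis (as!1) 1, axis (as!2) 1, axis (as!3) 1] :: real^4^4)"])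
  fix x js assume "js \<in> lists4 4"
  let ?P = "\<lambda>as::4 list. vector [axis (as!0) 1, axis (as!1) 1, axis (as!2) 1, axis (as!3) 1] :: real^4^4"
  let ?j = "\<lambda>i::4. vector js $ i :: 4"
  have cases4: "\<exists>a b c d. as = [a, b, c, d]" if "as \<in> lists4 4" for as
    using that by (auto simp: lists4_iff numeral_eq_Suc length_Suc_conv)
  have v: "vector as = (vector [as!0, as!1, as!2, as!3] :: 4^4)" if "as \<in> lists4 4" for as
    using cases4[OF that] by auto
  have lv: "[vector as $ (1::4), vector as $ (2::4), vector as $ (3::4), vector as $ (4::4)] = as"
    if "as \<in> lists4 4" for as
    using cases4[OF that] by auto
  have P: "?P as = (\<chi> i. axis (vector as $ i) 1)" if "as \<in> lists4 4" for as
    unfolding v[OF that] by (simp add: vec_eq_iff forall_4)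
  have 1: "(\<Sum>k\<in>UNIV. axis j 1 $ k * f k) = f j" for j :: 4 and f :: "4 \<Rightarrow> real"
    by (simp add: axis_def mult_delta_left)
  have 2: "(\<Sum>b\<in>UNIV. f b *s axis b 1) = (\<chi> l. f l)" for f :: "4 \<Rightarrow> real"
    by (simp add: vec_eq_iff axis_def mult_delta_right)
  have "?P js ** transpose (\<Theta> x) = (\<chi> i. \<Sum>b\<in>UNIV. \<Theta> x $ b $ (?j i) *s axis b 1)"
    unfolding P[OF \<open>js \<in> lists4 4\<close>]
    by (simp add: matrix_matrix_mult_def transpose_def 1 2)
  then have "det (?P js) * det (\<Theta> x) = det (\<chi> i. \<Sum>b\<in>UNIV. \<Theta> x $ b $ (?j i) *s axis b 1 :: real^4^4)"
    unfolding det_mul[of "?P js" "transpose (\<Theta> x)", unfolded det_transpose, symmetric] by (rule arg_cong)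
  also have "\<dots> = (\<Sum>f\<in>{f. \<forall>i. f i \<in> UNIV}. det (\<chi> i. \<Theta> x $ (f i) $ (?j i) *s axis (f i) 1 :: real^4^4))"
    by (rule det_linear_rows_sum) simp
  also have "\<dots> = (\<Sum>f\<in>UNIV. (\<Prod>i\<in>UNIV. \<Theta> x $ (f i) $ (?j i)) * det (\<chi> i. axis (f i) 1 :: real^4^4))"
    by (simp add: det_rows_mul)
  also have "\<dots> = (\<Sum>as\<in>lists4 4. (\<Prod>i\<in>UNIV. \<Theta> x $ (vector as $ i) $ (?j i)) * det (\<chi> i. axis (vector as $ i) 1 :: real^4^4))"
  proof (rule sum.reindex_bij_witness[of _ "\<lambda>as i. vector as $ i" "\<lambda>f. [f 1, f 2, f 3, f 4]"])
    fix f :: "4 \<Rightarrow> 4"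
    have vf: "vector [f 1, f 2, f 3, f 4] $ i = f i" for i
      using forall_4[of "\<lambda>i. vector [f 1, f 2, f 3, f 4] $ i = f i"] by simp
    show "(\<lambda>i. vector [f 1, f 2, f 3, f 4] $ i) = f"
      by (simp add: vf)
    show "[f 1, f 2, f 3, f 4] \<in> lists4 4"
      by (simp add: lists4_iff)
    show "(\<Prod>i\<in>UNIV. \<Theta> x $ (vector [f 1, f 2, f 3, f 4] $ i) $ (?j i)) *
        det (\<chi> i. axis (vector [f 1, f 2, f 3, f 4] $ i) 1 :: real^4^4) =
        (\<Prod>i\<in>UNIV. \<Theta> x $ (f i) $ (?j i)) * det (\<chi> i. axis (f i) 1 :: real^4^4)"
      by (simp add: vf)
  qed (simp_all add: lv)
  also have "\<dots> = (\<Sum>as\<in>lists4 4. det (?P as) * frame_prod (\<Theta> x) 4 as js)"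
  proof (intro sum.cong refl)
    fix as assume "as \<in> lists4 4"
    show "(\<Prod>i\<in>UNIV. \<Theta> x $ (vector as $ i) $ (?j i)) * det (\<chi> i. axis (vector as $ i) 1 :: real^4^4)
      = det (?P as) * frame_prod (\<Theta> x) 4 as js"
      unfolding P[OF \<open>as \<in> lists4 4\<close>, symmetric]
      unfolding v[OF \<open>as \<in> lists4 4\<close>] v[OF \<open>js \<in> lists4 4\<close>]
      unfolding prod_4 frame_prod_def lessThan_4 by (simp add: mult_ac)
  qed
  finally have "det (?P js) * det (\<Theta> x) = (\<Sum>as\<in>lists4 4. det (?P as) * frame_prod (\<Theta> x) 4 as js)" .
  then have "sgn (det (\<Theta> x)) * c * (det (?P js) * det (\<Theta> x)) =
      (\<Sum>as\<in>lists4 4. sgn (det (\<Theta> x)) * c * det (?P as) * frame_prod (\<Theta> x) 4 as js)"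
    by (simp add: sum_distrib_left mult.assoc)
  moreover have "\<bar>det (\<Theta> x)\<bar> = det (\<Theta> x) * sgn (det (\<Theta> x))" by (rule abs_sgn)
  ultimately show "\<bar>det (\<Theta> x)\<bar> * c * det (?P js) =
      (\<Sum>as\<in>lists4 4. sgn (det (\<Theta> x)) * c * det (?P as) * frame_prod (\<Theta> x) 4 as js)"
    by (simp only: mult_ac)
next
  fix as
  have "bounded_on U (\<lambda>x. sgn (det (\<Theta> x)))" by (rule bounded_onI[of _ _ 1]) (simp add: sgn_if)
  then show "bounded_on U (\<lambda>x. sgn (det (\<Theta> x)) * c *
    det (vector [axis (as!0) 1, axis (as!1) 1, axis (as!2) 1, axis (as!3) 1] :: real^4^4))"
    by (intro bounded_on_mult bounded_on_const)
qed

context cartan_coframe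
begin

text \<open>Induction over the construction of the tensor. In the coframe the metric is constant,
  the Levi-Civita tensor is constant up to sign, and the Riemann tensor has the components
  \<open>R\<close>.\<close>

theorem curvature_tensor_bounded_frame:
  assumes R: "\<And>x k l a b. x \<in> U \<Longrightarrow> (\<eta> ** Om k l x) $ a $ b =
      (\<Sum>c\<in>UNIV. \<Sum>d\<in>UNIV. R a b c d x * \<Theta> x $ c $ k * \<Theta> x $ d $ l)"
    and bR: "\<And>a b c d. bounded_on U (R a b c d)"
    and "curvature_tensor g n A"
  shows "bounded_frame U \<Theta> n A"
  using assms(3)
proof induction
  case ct_metric
  show ?case
  proof (rule bounded_frameI[where B = "\<lambda>as x. \<eta> $ (as!0) $ (as!1)"])
    fix x js assume x: "x \<in> U" and "js \<in> lists4 2"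
    then obtain i j where js: "js = [i, j]" by (auto simp: lists4_def numeral_eq_Suc length_Suc_conv)
    have "g x $ i $ j = (\<Sum>b\<in>UNIV. \<Sum>a\<in>UNIV. \<Theta> x $ a $ i * \<eta> $ a $ b * \<Theta> x $ b $ j)"
      by (simp add: metric[OF x] matrix_matrix_mult_def transpose_def sum_distrib_right)
    also have "\<dots> = (\<Sum>a\<in>UNIV. \<Sum>b\<in>UNIV. \<Theta> x $ a $ i * \<eta> $ a $ b * \<Theta> x $ b $ j)"
      by (rule sum.swap)
    finally show "g x $ (js!0) $ (js!1) = (\<Sum>as\<in>lists4 2. \<eta> $ (as!0) $ (as!1) * frame_prod (\<Theta> x) 2 as js)"
      by (simp add: js numeral_2_eq_2 sum_lists4_Suc lists4_0 frame_prod_Suc frame_prod_0 mult_ac)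
  qed (rule bounded_on_const)
next
  case ct_levi_civita
  have "bounded_frame U \<Theta> 4 (\<lambda>x js. \<bar>det (\<Theta> x)\<bar> * sqrt \<bar>det \<eta>\<bar> *
    det (vector [axis (js!0) 1, axis (js!1) 1, axis (js!2) 1, axis (js!3) 1] :: real^4^4))"
    by (rule bounded_frame_volume)
  moreover have "sqrt \<bar>det (g x)\<bar> = \<bar>det (\<Theta> x)\<bar> * sqrt \<bar>det \<eta>\<bar>" if "x \<in> U" for x
  proof -
    have "det (g x) = (det (\<Theta> x))\<^sup>2 * det \<eta>"
      by (simp add: metric[OF that] det_mul power2_eq_square)
    then show ?thesis by (simp add: abs_mult real_sqrt_mult)
  qed
  ultimately show ?case
    unfolding bounded_frame_def levi_civita_def by simp
next
  case ct_riemann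
  show ?case
  proof (rule bounded_frameI[where B = "\<lambda>as. R (as!0) (as!1) (as!2) (as!3)"])
    fix x js assume x: "x \<in> U" and "js \<in> lists4 4"
    then obtain i j k l where js: "js = [i, j, k, l]"
      by (auto simp: lists4_def numeral_eq_Suc length_Suc_conv)
    have "riemann g i j k l x = (\<Sum>b\<in>UNIV. \<Sum>a\<in>UNIV. \<Theta> x $ a $ i * (\<eta> ** Om k l x) $ a $ b * \<Theta> x $ b $ j)"
      unfolding riemann_eq[OF x] matrix_matrix_mult_def[of _ "\<Theta> x"] matrix_matrix_mult_def[of "transpose _"]
      by (simp add: transpose_def sum_distrib_right)
    also have "\<dots> = (\<Sum>a\<in>UNIV. \<Sum>b\<in>UNIV. \<Theta> x $ a $ i * (\<eta> ** Om k l x) $ a $ b * \<Theta> x $ b $ j)"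
      by (rule sum.swap)
    finally show "riemann g (js!0) (js!1) (js!2) (js!3) x =
        (\<Sum>as\<in>lists4 4. R (as!0) (as!1) (as!2) (as!3) x * frame_prod (\<Theta> x) 4 as js)"
      by (simp add: R[OF x] js eval_nat_numeral sum_lists4_Suc lists4_0 frame_prod_Suc frame_prod_0
          sum_distrib_left sum_distrib_right mult_ac)
  qed (rule bR)
next
  case (ct_const c)
  show ?case
    by (rule bounded_frameI[where B = "\<lambda>as x. c"]) (simp_all add: lists4_0 frame_prod_0 bounded_on_const)
next
  case (ct_add k A B)
  then show ?case by (simp add: bounded_frame_add)
next
  case (ct_prod k A n B)
  then show ?case by (simp add: bounded_frame_prod)
next
  case (ct_permute k A \<sigma>)
  then show ?case by (simp add: bounded_frame_permute)
next
  case (ct_contract k A)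
  have "\<Theta> x ** matrix_inv (g x) ** transpose (\<Theta> x) = \<eta>i" if "x \<in> U" for x
  proof -
    have "\<Theta> x ** matrix_inv (g x) ** transpose (\<Theta> x)
        = \<Theta> x ** E x ** \<eta>i ** transpose (\<Theta> x ** E x)"
      by (simp add: metric_inverse[OF that] matrix_mul_assoc matrix_transpose_mul)
    then show ?thesis by (simp add: dual[OF that])
  qed
  with ct_contract show ?case by (intro bounded_frame_contract) auto
qed

text \<open>At rank 0 the frame product is empty, so the one frame component is the scalar
  itself.\<close>

corollary scalar_polynomial_bounded:
  assumes "\<And>x k l a b. x \<in> U \<Longrightarrow> (\<eta> ** Om k l x) $ a $ b =
      (\<Sum>c\<in>UNIV. \<Sum>d\<in>UNIV. R a b c d x * \<Theta> x $ c $ k * \<Theta> x $ d $ l)"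
    and "\<And>a b c d. bounded_on U (R a b c d)"
    and "scalar_polynomial g I"
  shows "bounded (I ` U)"
proof -
  obtain A where A: "curvature_tensor g 0 A" "I = (\<lambda>x. A x [])"
    using assms(3) unfolding scalar_polynomial_def by blast
  have "bounded_frame U \<Theta> 0 A"
    by (rule curvature_tensor_bounded_frame[OF assms(1,2) A(1)])
  then have "\<exists>f. (\<forall>x\<in>U. A x [] = f x) \<and> bounded_on U f"
    unfolding bounded_frame_def by (auto simp: lists4_0 frame_prod_0)
  then obtain f where f: "\<And>x. x \<in> U \<Longrightarrow> A x [] = f x" "bounded_on U f"
    by blast
  then have "bounded_on U I"
    unfolding A(2) bounded_on_def by simp
  then show ?thesis
    unfolding bounded_on_def bounded_iff by auto
qed

end

section \<open>A Carter coframe of the rotating metric\<close>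

text \<open>Formal expressions in \<open>r\<close>, \<open>cos \<theta>\<close>, \<open>sin \<theta>\<close>, a function \<open>H(r)\<close> (later \<open>2 r M(r)\<close>) with its first two
  derivatives, \<open>1 / \<Sigma>\<close>, \<open>1 / \<Delta>\<close> and \<open>1 / sin \<theta>\<close>. They are closed under both partial derivatives, so that
  the identities of Cartan's calculus become polynomial identities.\<close>

datatype expr = Cst real | Rad | Cos | Sin | H0 | H1 | H2 | ISig | IDel | ISin
  | Add expr expr | Sub expr expr | Mul expr expr

instantiation expr :: "{zero, one, plus, minus, uminus, times}"
begin
definition "0 = Cst 0"
definition "1 = Cst 1"
definition "x + y = Add x y"
definition "x - y = Sub x y"
definition "- x = Sub (Cst 0) x"
definition "x * y = Mul x y"
instance ..
end

primrec d_theta :: "real \<Rightarrow> expr \<Rightarrow> expr" where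
  "d_theta a (Cst c) = 0"
| "d_theta a Rad = 0"
| "d_theta a Cos = - Sin"
| "d_theta a Sin = Cos"
| "d_theta a H0 = 0"
| "d_theta a H1 = 0"
| "d_theta a H2 = 0"
| "d_theta a ISig = Cst (2 * a * a) * Cos * Sin * ISig * ISig"
| "d_theta a IDel = 0"
| "d_theta a ISin = - (Cos * ISin * ISin)"
| "d_theta a (Add e f) = d_theta a e + d_theta a f"
| "d_theta a (Sub e f) = d_theta a e - d_theta a f"
| "d_theta a (Mul e f) = d_theta a e * f + e * d_theta a f"

text \<open>The derivative of \<open>H2\<close> is a junk value; see \<open>low_order\<close>.\<close>

primrec d_rad :: "expr \<Rightarrow> expr" where
  "d_rad (Cst c) = 0"
| "d_rad Rad = 1"
| "d_rad Cos = 0"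
| "d_rad Sin = 0"
| "d_rad H0 = H1"
| "d_rad H1 = H2"
| "d_rad H2 = 0"
| "d_rad ISig = - (Cst 2 * Rad * ISig * ISig)"
| "d_rad IDel = - ((Cst 2 * Rad - H1) * IDel * IDel)"
| "d_rad ISin = 0"
| "d_rad (Add e f) = d_rad e + d_rad f"
| "d_rad (Sub e f) = d_rad e - d_rad f"
| "d_rad (Mul e f) = d_rad e * f + e * d_rad f"

primrec low_order :: "expr \<Rightarrow> bool" where
  "low_order (Cst c) = True"
| "low_order Rad = True"
| "low_order Cos = True"
| "low_order Sin = True"
| "low_order H0 = True"
| "low_order H1 = True"
| "low_order H2 = False"
| "low_order ISig = True"
| "low_order IDel = True"
| "low_order ISin = True"
| "low_order (Add e f) = (low_order e \<and> low_order f)"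
| "low_order (Sub e f) = (low_order e \<and> low_order f)"
| "low_order (Mul e f) = (low_order e \<and> low_order f)"

lemma low_order_simps [simp]:
  "low_order 0" "low_order 1" "low_order (e + f) = (low_order e \<and> low_order f)"
  "low_order (e - f) = (low_order e \<and> low_order f)" "low_order (- e) = low_order e"
  "low_order (e * f) = (low_order e \<and> low_order f)"
  by (simp_all add: zero_expr_def one_expr_def plus_expr_def minus_expr_def uminus_expr_def times_expr_def)

text \<open>Mass enters the geometry only through h = 2 r M(r), so the structure equations are
  established for an arbitrary twice differentiable h.\<close>

locale rotating =
  fixes a :: real and h h1 h2 :: "real \<Rightarrow> real"
  assumes h: "(h has_real_derivative h1 r) (at r)" and h1: "(h1 has_real_derivative h2 r) (at r)"
begin

definition Sig :: "real^4 \<Rightarrow> real" where "Sig x = (x$2)\<^sup>2 + a\<^sup>2 * (cos (x$3))\<^sup>2"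

definition Del :: "real \<Rightarrow> real" where "Del r = r\<^sup>2 + a\<^sup>2 - h r"

definition dom :: "(real^4) set" where "dom = {x. Del (x$2) \<noteq> 0 \<and> sin (x$3) \<noteq> 0 \<and> Sig x \<noteq> 0}"

primrec ev :: "real^4 \<Rightarrow> expr \<Rightarrow> real" where
  "ev x (Cst c) = c"
| "ev x Rad = x$2"
| "ev x Cos = cos (x$3)"
| "ev x Sin = sin (x$3)"
| "ev x H0 = h (x$2)"
| "ev x H1 = h1 (x$2)"
| "ev x H2 = h2 (x$2)"
| "ev x ISig = inverse (Sig x)"
| "ev x IDel = inverse (Del (x$2))"
| "ev x ISin = inverse (sin (x$3))"
| "ev x (Add e f) = ev x e + ev x f"
| "ev x (Sub e f) = ev x e - ev x f"
| "ev x (Mul e f) = ev x e * ev x f"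

lemma ev_simps [simp]:
  "ev x 0 = 0" "ev x 1 = 1" "ev x (e + f) = ev x e + ev x f" "ev x (e - f) = ev x e - ev x f"
  "ev x (- e) = - ev x e" "ev x (e * f) = ev x e * ev x f"
  by (simp_all add: zero_expr_def one_expr_def plus_expr_def minus_expr_def uminus_expr_def times_expr_def)

end

lemma d_simps [simp]:
  "d_rad 0 = 0" "d_rad 1 = 0" "d_rad (e + f) = d_rad e + d_rad f" "d_rad (e - f) = d_rad e - d_rad f"
  "d_rad (- e) = 0 - d_rad e" "d_rad (e * f) = d_rad e * f + e * d_rad f"
  "d_theta a 0 = 0" "d_theta a 1 = 0" "d_theta a (e + f) = d_theta a e + d_theta a f"
  "d_theta a (e - f) = d_theta a e - d_theta a f"
  "d_theta a (- e) = 0 - d_theta a e" "d_theta a (e * f) = d_theta a e * f + e * d_theta a f"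
  by (simp_all add: zero_expr_def one_expr_def plus_expr_def minus_expr_def uminus_expr_def times_expr_def)

context rotating
begin

text \<open>Checked on the generators and propagated by the sum and product rules. It supplies the
  symmetry of second derivatives that the Cartan locale asks for.\<close>

lemma ev_d_commute: "ev x (d_rad (d_theta a e)) = ev x (d_theta a (d_rad e))"
  by (induction e) (simp_all add: algebra_simps)

lemma has_derivative_ev:
  assumes x: "x \<in> dom" and "low_order e"
  shows "((\<lambda>y. ev y e) has_derivative (\<lambda>v. ev x (d_rad e) * v$2 + ev x (d_theta a e) * v$3)) (at x)"
proof -
  have nz: "Del (x$2) \<noteq> 0" "sin (x$3) \<noteq> 0" "Sig x \<noteq> 0"
    using x by (auto simp: dom_def)
  have coord: "((\<lambda>y::real^4. y $ i) has_derivative (\<lambda>v. v $ i)) (at x)" for i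
    by (rule bounded_linear.has_derivative[OF bounded_linear_vec_nth has_derivative_ident])
  have comp: "((\<lambda>y::real^4. f (y $ i)) has_derivative (\<lambda>v. d * v $ i)) (at x)"
    if "(f has_real_derivative d) (at (x$i))" for f d i
    using has_derivative_compose[OF coord that[unfolded has_field_derivative_def]] by simp
  have dDel: "(Del has_real_derivative 2 * r - h1 r) (at r)" for r
    unfolding Del_def [abs_def] by (auto intro!: derivative_eq_intros h)
  show ?thesis
    using \<open>low_order e\<close>
  proof (induction e)
    case ISig
    have "(Sig has_derivative (\<lambda>v. 2 * x$2 * v$2 - 2 * a\<^sup>2 * cos (x$3) * sin (x$3) * v$3)) (at x)"
      unfolding Sig_def [abs_def]
      by (auto intro!: derivative_eq_intros coord comp[of cos] DERIV_cos simp: fun_eq_iff)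
    from Deriv.has_derivative_inverse[OF nz(3) this] show ?case
      by (simp add: algebra_simps power2_eq_square)
  next
    case IDel
    show ?case
      using comp[OF DERIV_inverse'[OF dDel nz(1)]] by (simp add: algebra_simps)
  next
    case ISin
    show ?case
      using comp[OF DERIV_inverse'[OF DERIV_sin nz(2)]] by (simp add: algebra_simps)
  next
    case (Mul e f)
    then show ?case
      by (auto intro!: derivative_eq_intros simp: algebra_simps)
  next
    case Cos show ?case using comp[OF DERIV_cos] by simp
  next
    case Sin show ?case using comp[OF DERIV_sin] by simp
  next
    case H0 show ?case using comp[OF h] by simp
  next
    case H1 show ?case using comp[OF h1] by simp
  next
    case Rad show ?case using coord by simp
  next
    case (Add e f)
    then show ?case
      by (auto intro!: derivative_eq_intros simp: algebra_simps)
  next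
    case (Sub e f)
    then show ?case
      by (auto intro!: derivative_eq_intros simp: algebra_simps)
  qed simp_all
qed

definition evm :: "expr^4^4 \<Rightarrow> chart_metric" where "evm A x = (\<chi> i j. ev x (A $ i $ j))"

definition d_mat :: "4 \<Rightarrow> expr^4^4 \<Rightarrow> expr^4^4" where
  "d_mat k A = vector [0, \<chi> i j. d_rad (A $ i $ j), \<chi> i j. d_theta a (A $ i $ j), 0] $ k"

lemma evm_0 [simp]: "evm 0 x = 0"
  by (simp add: evm_def vec_eq_iff)

lemma pd_ev:
  assumes "x \<in> dom" and "low_order e"
  shows "pd k (\<lambda>y. ev y e) x = (vector [0, ev x (d_rad e), ev x (d_theta a e), 0] :: real^4) $ k"
  unfolding pd_eqI[OF has_derivative_ev[OF assms]]
  using forall_4[of "\<lambda>k. ev x (d_rad e) * axis k 1 $ 2 + ev x (d_theta a e) * axis k 1 $ 3 =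
    (vector [0, ev x (d_rad e), ev x (d_theta a e), 0] :: real^4) $ k"]
  by (simp add: axis_def)

definition low_mat :: "expr^4^4 \<Rightarrow> bool" where
  "low_mat A \<longleftrightarrow> (\<forall>i j. low_order (A $ i $ j))"

lemma mdiff_evm:
  assumes "x \<in> dom" "low_mat A"
  shows "mdiff (evm A) x"
proof -
  have "(\<lambda>y. ev y (A $ i $ j)) differentiable (at x)" for i j
    by (rule differentiableI[OF has_derivative_ev]) (use assms in \<open>simp_all add: low_mat_def\<close>)
  then show ?thesis by (simp add: mdiff_def evm_def)
qed

lemma pdm_evm:
  assumes x: "x \<in> dom" and "low_mat A"
  shows "pdm k (evm A) x = evm (d_mat k A) x"
proof -
  have e: "pd k (\<lambda>y. ev y (A $ i $ j)) x
    = (vector [0, ev x (d_rad (A $ i $ j)), ev x (d_theta a (A $ i $ j)), 0] :: real^4) $ k" for i j k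
    using assms by (intro pd_ev) (auto simp: low_mat_def)
  have "\<forall>k. pdm k (evm A) x = evm (d_mat k A) x"
    unfolding forall_4 by (simp add: pdm_def evm_def d_mat_def e vec_eq_iff)
  then show ?thesis by simp
qed

end

section \<open>The Carter null coframe, its dual frame and its connection\<close>

context rotating
begin

abbreviation "A \<equiv> Cst a"
abbreviation "half \<equiv> Cst (1/2)"

text \<open>\<open>sg\<close>, \<open>dl\<close> and \<open>ra\<close> are \<Sigma>, \<Delta> and
  r^2 + a^2. As polynomials in the generators they require no symbols of their own, unlike the
  inverses of the first two.\<close>

definition sg where "sg = Rad * Rad + A * A * Cos * Cos"
definition dl where "dl = Rad * Rad + A * A - H0"
definition ra where "ra = Rad * Rad + A * A"

text \<open>With \<open>K = dt - a sin\<^sup>2 \<theta> d\<phi>\<close>, \<open>L = (r\<^sup>2 + a\<^sup>2) d\<phi> - a dt\<close> and \<open>\<zeta> = r + i a cos \<theta>\<close>, the rows are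
  \<open>K + \<Sigma> / \<Delta> dr\<close>, \<open>\<Delta> / \<Sigma> K - dr\<close>, and the real and imaginary parts of \<open>\<zeta> (d\<theta> + i sin \<theta> / \<Sigma> L)\<close>. This choice
  avoids the square roots of \<open>\<Sigma>\<close> and \<open>\<Delta>\<close> and does not depend on the sign of \<open>\<Delta>\<close>.\<close>

definition coframe :: "expr^4^4" where
  "coframe = vector
    [vector [1, sg * IDel, 0, - (A * Sin * Sin)],
     vector [dl * ISig, - 1, 0, - (A * Sin * Sin * dl * ISig)],
     vector [A * A * Cos * Sin * ISig, 0, Rad, - (A * Cos * Sin * ra * ISig)],
     vector [- (A * Rad * Sin * ISig), 0, A * Cos, Rad * Sin * ra * ISig]]"

text \<open>The columns are the dual vectors. The factor 1 / sin \<theta> enters here and in neither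
  the coframe nor the connection.\<close>

definition frame :: "expr^4^4" where
  "frame = vector
    [vector [half * ra * ISig, half * ra * IDel, - (A * A * Cos * Sin * ISig), A * Rad * Sin * ISig],
     vector [half * dl * ISig, - half, 0, 0],
     vector [0, 0, Rad * ISig, A * Cos * ISig],
     vector [half * A * ISig, half * A * IDel, - (A * Cos * ISig * ISin), Rad * ISig * ISin]]"

text \<open>This encodes the metric as minus the product of the two null one-forms plus the squares
  of the other two.\<close>

definition frame_metric :: "real^4^4" where
  "frame_metric = vector
    [vector [0, -1/2, 0, 0], vector [-1/2, 0, 0, 0], vector [0, 0, 1, 0], vector [0, 0, 0, 1]]"

definition frame_metric_inv :: "real^4^4" where
  "frame_metric_inv = vector
    [vector [0, -2, 0, 0], vector [-2, 0, 0, 0], vector [0, 0, 1, 0], vector [0, 0, 0, 1]]"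

text \<open>The general element of the Lorentz algebra in this null frame: e is the boost, w the
  rotation, and p, q, p', q' are the null rotations. Lowering an index with
  \<open>frame_metric\<close> makes it skew.\<close>

definition conn_matrix :: "expr \<Rightarrow> expr \<Rightarrow> expr \<Rightarrow> expr \<Rightarrow> expr \<Rightarrow> expr \<Rightarrow> expr^4^4" where
  "conn_matrix e p q p' q' w = vector
    [vector [e, 0, p, q],
     vector [0, - e, p', q'],
     vector [half * p', half * p, 0, w],
     vector [half * q', half * q, - w, 0]]"

text \<open>\<open>pp\<close> is -1/2 times the r-derivative of H / \<Sigma>. With \<zeta> = r + i a
  cos \<theta>, \<open>rr\<close> and \<open>rc\<close> are the real part and minus the imaginary
  part of 1 / \<zeta>^2.\<close>

definition pp where "pp = Rad * H0 * ISig * ISig - half * H1 * ISig"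
definition qq where "qq = A * Cos * H0 * ISig * ISig"
definition rc where "rc = Cst 2 * A * Rad * Cos * ISig * ISig"
definition rr where "rr = (Rad * Rad - A * A * Cos * Cos) * ISig * ISig"

text \<open>Stated without derivation: skewness and vanishing torsion, which determine the
  connection, are verified in \<open>cartan\<close> and \<open>frame_torsion\<close>.\<close>

definition conn :: "4 \<Rightarrow> expr^4^4" where
  "conn k = (vector
    [conn_matrix pp 0 0 0 0 qq,
     conn_matrix (half * (Cst 2 * Rad - H1) * IDel - Rad * ISig) 0 (- (A * Sin * IDel))
       (A * Sin * rc) (- (A * Sin * rr)) (- (A * Cos * ISig)),
     conn_matrix (A * A * Cos * Sin * ISig) (- 1) 0 (dl * rr) (dl * rc) (- (A * Rad * Sin * ISig)),
     conn_matrix (- (A * Sin * Sin * (pp + Rad * ISig))) 0 (- Sin)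
       (- (Sin * dl * rc)) (Sin * dl * rr) (- (Cos * ra * ISig) - A * Sin * Sin * qq)] :: expr^4^4^4) $ k"

definition metric :: chart_metric where
  "metric x = transpose (evm coframe x) ** frame_metric ** evm coframe x"

lemma low_mats: "low_mat coframe" "low_mat frame" "low_mat (d_mat k coframe)" "low_mat (conn k)"
proof -
  show "low_mat coframe" "low_mat frame"
    by (simp_all add: low_mat_def forall_4 coframe_def frame_def sg_def dl_def ra_def)
  have "\<forall>k. low_mat (d_mat k coframe)"
    by (simp add: low_mat_def forall_4 coframe_def d_mat_def sg_def dl_def ra_def)
  then show "low_mat (d_mat k coframe)" by simp
  have "\<forall>k. low_mat (conn k)"
    by (simp add: low_mat_def forall_4 conn_def conn_matrix_def sg_def dl_def ra_def rc_def rr_def pp_def qq_def)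
  then show "low_mat (conn k)" by simp
qed

text \<open>Naming the atoms turns each identity between evaluated expressions into a polynomial
  identity modulo four relations, a form that Groebner bases decide.\<close>

lemma generators:
  assumes "x \<in> dom"
  obtains r c s u v w d0 d1 d2 where "ev x Rad = r" "ev x Cos = c" "ev x Sin = s" "ev x ISig = u" "ev x IDel = v"
    "ev x ISin = w" "ev x H0 = d0" "ev x H1 = d1" "ev x H2 = d2"
    "u * (r * r + a * a * c * c) = 1" "v * (r * r + a * a - d0) = 1" "s * s = 1 - c * c" "w * s = 1"
proof
  show "inverse (Sig x) * (x$2 * x$2 + a * a * cos (x$3) * cos (x$3)) = 1"
    using assms left_inverse[of "Sig x"] by (simp add: dom_def Sig_def power2_eq_square mult.assoc)
  show "inverse (Del (x$2)) * (x$2 * x$2 + a * a - h (x$2)) = 1"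
    using assms left_inverse[of "Del (x$2)"] by (simp add: dom_def Del_def power2_eq_square mult.assoc)
  show "sin (x$3) * sin (x$3) = 1 - cos (x$3) * cos (x$3)"
    using sin_cos_squared_add[of "x$3"] by (simp add: power2_eq_square algebra_simps)
  show "inverse (sin (x$3)) * sin (x$3) = 1"
    using assms by (simp add: dom_def)
qed simp_all

lemmas expand = evm_def coframe_def frame_def conn_def conn_matrix_def d_mat_def frame_metric_def
  frame_metric_inv_def sg_def dl_def ra_def rc_def rr_def pp_def qq_def
  matrix_matrix_mult_def sum_4 vector_4 vec_lambda_beta vector_add_component vector_minus_component
  ev_simps ev.simps(1) d_rad.simps d_theta.simps d_simps 
  mult_zero_left mult_zero_right mult_1_left mult_1_right add_0_left add_0_right diff_zero minus_zero
  zero_index forall_4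

lemma mat_1_4: "(mat 1 :: real^4^4) = vector
    [vector [1, 0, 0, 0], vector [0, 1, 0, 0], vector [0, 0, 1, 0], vector [0, 0, 0, 1]]"
  by (simp add: vec_eq_iff forall_4 mat_def)

lemma frame_dual:
  assumes "x \<in> dom"
  shows "evm coframe x ** evm frame x = mat 1"
proof -
  obtain r c s u v w d0 d1 d2 where e: "ev x Rad = r" "ev x Cos = c" "ev x Sin = s" "ev x ISig = u" "ev x IDel = v"
    "ev x ISin = w" "ev x H0 = d0" "ev x H1 = d1" "ev x H2 = d2"
    and rel: "u * (r * r + a * a * c * c) = 1" "v * (r * r + a * a - d0) = 1" "s * s = 1 - c * c" "w * s = 1"
    by (rule generators[OF assms])
  show ?thesis
    unfolding expand vec_eq_iff mat_1_4 e
    \<comment> \<open>Trivial entries go first, then identities that hold freely, and last those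
      that hold only modulo \<open>rel\<close>.\<close>
    by (intro conjI; (rule refl | algebra | (use rel in algebra)))
qed

lemma frame_torsion:
  assumes "x \<in> dom"
  shows "(evm (d_mat k coframe) x + evm (conn k) x ** evm coframe x) $ b $ l
    = (evm (d_mat l coframe) x + evm (conn l) x ** evm coframe x) $ b $ k"
proof -
  obtain r c s u v w d0 d1 d2 where e: "ev x Rad = r" "ev x Cos = c" "ev x Sin = s" "ev x ISig = u" "ev x IDel = v"
    "ev x ISin = w" "ev x H0 = d0" "ev x H1 = d1" "ev x H2 = d2"
    and rel: "u * (r * r + a * a * c * c) = 1" "v * (r * r + a * a - d0) = 1" "s * s = 1 - c * c" "w * s = 1"
    by (rule generators[OF assms])
  have "\<forall>k l b. (evm (d_mat k coframe) x + evm (conn k) x ** evm coframe x) $ b $ l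
    = (evm (d_mat l coframe) x + evm (conn l) x ** evm coframe x) $ b $ k"
    unfolding expand e
    by (intro conjI; (rule refl | algebra | (use rel in algebra)))
  then show ?thesis by blast
qed

section \<open>Frame components of the Riemann tensor\<close>

definition riem_a where "riem_a = Cst (1/4) * H0 * ISig * ISig - Cst (1/8) * H2 * ISig
  + half * Rad * H1 * ISig * ISig - Rad * Rad * H0 * ISig * ISig * ISig"
definition riem_c where "riem_c = Rad * Rad * H0 * ISig * ISig * ISig - half * H0 * ISig * ISig
  - Cst (1/4) * Rad * H1 * ISig * ISig"
definition riem_d where "riem_d = Cst (1/4) * A * Cos * H1 * ISig * ISig
  - A * Rad * Cos * H0 * ISig * ISig * ISig"
definition riem_k where "riem_k = Cst 4 * Rad * Rad * H0 * ISig * ISig * ISig - Cst 3 * H0 * ISig * ISig"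

definition biv :: "expr \<Rightarrow> expr \<Rightarrow> expr \<Rightarrow> expr \<Rightarrow> expr \<Rightarrow> expr \<Rightarrow> expr^4^4" where
  "biv e12 e13 e14 e23 e24 e34 = vector
    [vector [0, e12, e13, e14], vector [- e12, 0, e23, e24],
     vector [- e13, - e23, 0, e34], vector [- e14, - e24, - e34, 0]]"

text \<open>Every nonzero component has as many indices 1 as 2, so a boost of the null pair leaves
  it fixed; accordingly \<Delta> and its inverse do not occur. \<open>riem_a\<close> is -1/8 of the
  second r-derivative of H / \<Sigma>, and \<open>riem_d\<close> is a cos \<theta> / 4 times the
  r-derivative of H / \<Sigma>^2.\<close>

definition riem :: "expr^4^4^4^4" where
  "riem = vector
    [vector [0, biv riem_a 0 0 0 0 (riem_d + riem_d), biv 0 0 0 riem_c riem_d 0, biv 0 0 0 (- riem_d) riem_c 0],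
     vector [- biv riem_a 0 0 0 0 (riem_d + riem_d), 0, biv 0 riem_c (- riem_d) 0 0 0, biv 0 riem_d riem_c 0 0 0],
     vector [- biv 0 0 0 riem_c riem_d 0, - biv 0 riem_c (- riem_d) 0 0 0, 0, biv (riem_d + riem_d) 0 0 0 0 riem_k],
     vector [- biv 0 0 0 (- riem_d) riem_c 0, - biv 0 riem_d riem_c 0 0 0, - biv (riem_d + riem_d) 0 0 0 0 riem_k, 0]]"

text \<open>The curvature two-forms are expanded in products of coframe one-forms, as
  \<open>curvature_tensor_bounded_frame\<close> expects, instead of coordinate
  differentials.\<close>

lemma frame_curvature:
  assumes "x \<in> dom"
  shows "(frame_metric ** (evm (d_mat k (conn l)) x - evm (d_mat l (conn k)) x
      + evm (conn k) x ** evm (conn l) x - evm (conn l) x ** evm (conn k) x)) $ b $ j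
    = (\<Sum>c\<in>UNIV. \<Sum>d\<in>UNIV. ev x (riem $ b $ j $ c $ d) * evm coframe x $ c $ k * evm coframe x $ d $ l)"
proof -
  obtain r c s u v w d0 d1 d2 where e: "ev x Rad = r" "ev x Cos = c" "ev x Sin = s" "ev x ISig = u" "ev x IDel = v"
    "ev x ISin = w" "ev x H0 = d0" "ev x H1 = d1" "ev x H2 = d2"
    and rel: "u * (r * r + a * a * c * c) = 1" "v * (r * r + a * a - d0) = 1" "s * s = 1 - c * c" "w * s = 1"
    by (rule generators[OF assms])
  have "\<forall>k l b j. (frame_metric ** (evm (d_mat k (conn l)) x - evm (d_mat l (conn k)) x
      + evm (conn k) x ** evm (conn l) x - evm (conn l) x ** evm (conn k) x)) $ b $ j
    = (\<Sum>c\<in>UNIV. \<Sum>d\<in>UNIV. ev x (riem $ b $ j $ c $ d) * evm coframe x $ c $ k * evm coframe x $ d $ l)"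
    unfolding expand e riem_def riem_a_def riem_c_def riem_d_def riem_k_def biv_def vector_uminus_component
    by (intro conjI; (rule refl | algebra | (use rel in algebra)))
  then show ?thesis by blast
qed

end

section \<open>Bounds for the frame curvature\<close>

lemma bounded_on_minus: "bounded_on U f \<Longrightarrow> bounded_on U (\<lambda>x. - f x)"
  by (simp add: bounded_on_def)

lemma bounded_on_diff: "bounded_on U f \<Longrightarrow> bounded_on U g \<Longrightarrow> bounded_on U (\<lambda>x. f x - g x)"
  using bounded_on_add[OF _ bounded_on_minus, of U f g] by simp

lemma bounded_on_dominated: 
  assumes "bounded_on U g" "\<And>x. x \<in> U \<Longrightarrow> \<bar>f x\<bar> \<le> C * \<bar>g x\<bar>"
  shows "bounded_on U f"
proof -
  obtain D where D: "\<forall>x\<in>U. \<bar>g x\<bar> \<le> D" using assms(1) unfolding bounded_on_def by blast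
  show ?thesis
  proof (rule bounded_onI[of _ _ "\<bar>C\<bar> * D"])
    fix x assume x: "x \<in> U"
    have "\<bar>f x\<bar> \<le> \<bar>C\<bar> * \<bar>g x\<bar>"
      using assms(2)[OF x] by (meson abs_ge_self abs_ge_zero mult_right_mono order_trans)
    also have "\<dots> \<le> \<bar>C\<bar> * D" using D x by (intro mult_left_mono) auto
    finally show "\<bar>f x\<bar> \<le> \<bar>C\<bar> * D" .
  qed
qed

context rotating
begin

lemma cartan:
  assumes "open U" "U \<subseteq> dom" "\<And>x. x \<in> U \<Longrightarrow> g x = metric x"
  shows "cartan_coframe U g (evm coframe) (evm frame) frame_metric frame_metric_inv
    (\<lambda>k. evm (conn k)) (\<lambda>k. evm (d_mat k coframe))"
proof
  have U: "x \<in> dom" if "x \<in> U" for x using that assms(2) by blast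
  show "open U" by fact
  fix x k l b assume x: "x \<in> U"
  show "mdiff (evm coframe) x" "mdiff (evm (d_mat k coframe)) x" "mdiff (evm (conn k)) x" "mdiff (evm frame) x"
    by (rule mdiff_evm[OF U[OF x]], rule low_mats)+
  show "pdm k (evm coframe) x = evm (d_mat k coframe) x"
    by (rule pdm_evm[OF U[OF x]], rule low_mats)
  have "\<forall>k l. evm (d_mat k (d_mat l coframe)) x = evm (d_mat l (d_mat k coframe)) x"
    unfolding forall_4 by (simp add: evm_def d_mat_def vec_eq_iff ev_d_commute)
  then show "pdm k (evm (d_mat l coframe)) x = pdm l (evm (d_mat k coframe)) x"
    using pdm_evm[OF U[OF x] low_mats(3)] by metis
  show "evm coframe x ** evm frame x = mat 1"
    by (rule frame_dual[OF U[OF x]])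
  show "g x = transpose (evm coframe x) ** frame_metric ** evm coframe x"
    using assms(3)[OF x] by (simp add: metric_def)
  have "\<forall>k. transpose (frame_metric ** evm (conn k) x) = - (frame_metric ** evm (conn k) x)"
    unfolding vec_eq_iff expand transpose_def vector_uminus_component
    by (simp add: diff_divide_distrib)
  then show "transpose (frame_metric ** evm (conn k) x) = - (frame_metric ** evm (conn k) x)"
    by blast
  show "(evm (d_mat k coframe) x + evm (conn k) x ** evm coframe x) $ b $ l
    = (evm (d_mat l coframe) x + evm (conn l) x ** evm coframe x) $ b $ k"
    by (rule frame_torsion[OF U[OF x]])
next
  show "transpose frame_metric = frame_metric"
    by (simp add: vec_eq_iff forall_4 transpose_def frame_metric_def)
  show "frame_metric ** frame_metric_inv = mat 1"
    unfolding mat_1_4 by (simp add: vec_eq_iff forall_4 matrix_matrix_mult_def sum_4 frame_metric_def frame_metric_inv_def)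
qed

text \<open>After inserting the growth of h and its derivatives, every term is dominated by products
  of r^2 / \<Sigma> and a r cos \<theta> / \<Sigma>. Both are at most 1 in absolute value, the
  second by the inequality of the means. The fourth-order zero of h at r = 0 is exactly what
  compensates 1 / \<Sigma>^2 at the ring.\<close>

lemma bounded_on_riem:
  assumes U: "U \<subseteq> dom"
    and h: "\<And>r. \<bar>h r\<bar> \<le> C * r ^ 4" and h1: "\<And>r. \<bar>h1 r\<bar> \<le> C * \<bar>r\<bar> ^ 3" and h2: "\<And>r. \<bar>h2 r\<bar> \<le> C * r\<^sup>2"
  shows "bounded_on U (\<lambda>x. ev x (riem $ b $ j $ c $ d))"
proof -
  define u where "u x = inverse (Sig x)" for x
  have u: "Sig x * u x = 1" "u x > 0" "x$2 * x$2 \<le> Sig x" "\<bar>a * cos (x$3) * x$2\<bar> \<le> Sig x" if "x \<in> U" for x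
  proof -
    have "Sig x \<noteq> 0" "Sig x \<ge> 0" using that U by (auto simp: dom_def Sig_def)
    then show "Sig x * u x = 1" "u x > 0" by (auto simp: u_def)
    show "x$2 * x$2 \<le> Sig x" by (simp add: Sig_def power2_eq_square)
    have "\<bar>a * cos (x$3) * x$2\<bar> \<le> (\<bar>a * cos (x$3)\<bar>\<^sup>2 + \<bar>x$2\<bar>\<^sup>2) / 2"
      unfolding abs_mult[of "a * cos (x$3)"] using sum_squares_bound[of "\<bar>a * cos (x$3)\<bar>" "\<bar>x$2\<bar>"] by simp
    also have "\<dots> \<le> Sig x" by (simp add: Sig_def power_mult_distrib)
    finally show "\<bar>a * cos (x$3) * x$2\<bar> \<le> Sig x" .
  qed
  have cube: "\<bar>y\<bar> ^ 3 = \<bar>y\<bar> * (y * y)" for y :: real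
    by (simp add: power3_eq_cube)
  have sq: "\<bar>y\<bar> * (\<bar>y\<bar> * z) = y * (y * z)" for y z :: real
    by (simp flip: mult.assoc)
  have b1: "bounded_on U (\<lambda>x. x$2 * x$2 * u x)"
  proof (rule bounded_onI[of _ _ 1])
    fix x assume x: "x \<in> U"
    have "x$2 * x$2 * u x \<le> Sig x * u x" using u[OF x] by (intro mult_right_mono) auto
    then show "\<bar>x$2 * x$2 * u x\<bar> \<le> 1" using u[OF x] by simp
  qed
  have b2: "bounded_on U (\<lambda>x. a * cos (x$3) * x$2 * u x)"
  proof (rule bounded_onI[of _ _ 1])
    fix x assume x: "x \<in> U"
    have "\<bar>a * cos (x$3) * x$2\<bar> * u x \<le> Sig x * u x" using u[OF x] by (intro mult_right_mono) auto
    then show "\<bar>a * cos (x$3) * x$2 * u x\<bar> \<le> 1" using u[OF x] by (simp add: abs_mult)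
  qed
  have b3: "bounded_on U (\<lambda>x. h (x$2) * u x * u x)"
  proof (rule bounded_on_dominated[OF bounded_on_mult[OF b1 b1]])
    fix x assume x: "x \<in> U"
    have "\<bar>h (x$2)\<bar> * (u x * u x) \<le> C * (x$2)^4 * (u x * u x)"
      by (rule mult_right_mono[OF h]) simp
    then show "\<bar>h (x$2) * u x * u x\<bar> \<le> C * \<bar>(x$2 * x$2 * u x) * (x$2 * x$2 * u x)\<bar>"
      using u[OF x] by (simp add: abs_mult power4_eq_xxxx mult_ac)
  qed
  have b4: "bounded_on U (\<lambda>x. h2 (x$2) * u x)"
  proof (rule bounded_on_dominated[OF b1])
    fix x assume x: "x \<in> U"
    have "\<bar>h2 (x$2)\<bar> * u x \<le> C * (x$2)^2 * u x"
      by (rule mult_right_mono[OF h2]) (use u[OF x] in simp)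
    then show "\<bar>h2 (x$2) * u x\<bar> \<le> C * \<bar>x$2 * x$2 * u x\<bar>"
      using u[OF x] by (simp add: abs_mult power2_eq_square mult_ac)
  qed
  have b5: "bounded_on U (\<lambda>x. x$2 * h1 (x$2) * u x * u x)"
  proof (rule bounded_on_dominated[OF bounded_on_mult[OF b1 b1]])
    fix x assume x: "x \<in> U"
    have "\<bar>h1 (x$2)\<bar> * (\<bar>x$2\<bar> * (u x * u x)) \<le> C * \<bar>x$2\<bar>^3 * (\<bar>x$2\<bar> * (u x * u x))"
      by (rule mult_right_mono[OF h1]) simp
    then show "\<bar>x$2 * h1 (x$2) * u x * u x\<bar> \<le> C * \<bar>(x$2 * x$2 * u x) * (x$2 * x$2 * u x)\<bar>"
      using u[OF x] by (simp add: abs_mult cube sq mult_ac)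
  qed
  have b6: "bounded_on U (\<lambda>x. a * cos (x$3) * h1 (x$2) * u x * u x)"
  proof (rule bounded_on_dominated[OF bounded_on_mult[OF b1 b2]])
    fix x assume x: "x \<in> U"
    have "\<bar>h1 (x$2)\<bar> * (\<bar>a * cos (x$3)\<bar> * (u x * u x)) \<le> C * \<bar>x$2\<bar>^3 * (\<bar>a * cos (x$3)\<bar> * (u x * u x))"
      by (rule mult_right_mono[OF h1]) simp
    then show "\<bar>a * cos (x$3) * h1 (x$2) * u x * u x\<bar> \<le> C * \<bar>(x$2 * x$2 * u x) * (a * cos (x$3) * x$2 * u x)\<bar>"
      using u[OF x] by (simp add: abs_mult cube sq mult_ac)
  qed
  have a: "bounded_on U (\<lambda>x. ev x riem_a)"
  proof -
    have "bounded_on U (\<lambda>x. 1/4 * (h (x$2) * u x * u x) - 1/8 * (h2 (x$2) * u x)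
      + 1/2 * (x$2 * h1 (x$2) * u x * u x) - (x$2 * x$2 * u x) * (h (x$2) * u x * u x))"
      by (intro bounded_on_add bounded_on_diff bounded_on_mult[OF bounded_on_const] bounded_on_mult[OF b1] b3 b4 b5)
    then show ?thesis by (simp add: riem_a_def u_def mult_ac)
  qed
  have c: "bounded_on U (\<lambda>x. ev x riem_c)"
  proof -
    have "bounded_on U (\<lambda>x. (x$2 * x$2 * u x) * (h (x$2) * u x * u x) - 1/2 * (h (x$2) * u x * u x) 
      - 1/4 * (x$2 * h1 (x$2) * u x * u x))"
      by (intro bounded_on_add bounded_on_diff bounded_on_mult[OF bounded_on_const] bounded_on_mult[OF b1] b3 b4 b5)
    then show ?thesis by (simp add: riem_c_def u_def mult_ac)
  qed
  have d: "bounded_on U (\<lambda>x. ev x riem_d)"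
  proof -
    have "bounded_on U (\<lambda>x. 1/4 * (a * cos (x$3) * h1 (x$2) * u x * u x)
      - (a * cos (x$3) * x$2 * u x) * (h (x$2) * u x * u x))"
      by (intro bounded_on_add bounded_on_diff bounded_on_mult[OF bounded_on_const] bounded_on_mult[OF b2] b3 b6)
    then show ?thesis by (simp add: riem_d_def u_def mult_ac)
  qed
  have k: "bounded_on U (\<lambda>x. ev x riem_k)"
  proof -
    have "bounded_on U (\<lambda>x. 4 * ((x$2 * x$2 * u x) * (h (x$2) * u x * u x)) - 3 * (h (x$2) * u x * u x))"
      by (intro bounded_on_add bounded_on_diff bounded_on_mult[OF bounded_on_const] bounded_on_mult[OF b1] b3 b6)
    then show ?thesis by (simp add: riem_k_def u_def mult_ac)
  qed
  have dd: "bounded_on U (\<lambda>x. ev x (riem_d + riem_d))" "bounded_on U (\<lambda>x. ev x (- riem_d))" "bounded_on U (\<lambda>x. ev x 0)"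
    using bounded_on_add[OF d d] bounded_on_minus[OF d] by (simp_all add: bounded_on_const)
  have biv: "bounded_on U (\<lambda>x. ev x (biv e12 e13 e14 e23 e24 e34 $ c $ d))"
      "bounded_on U (\<lambda>x. ev x ((- biv e12 e13 e14 e23 e24 e34) $ c $ d))"
    if "bounded_on U (\<lambda>x. ev x e12)" "bounded_on U (\<lambda>x. ev x e13)" "bounded_on U (\<lambda>x. ev x e14)"
      "bounded_on U (\<lambda>x. ev x e23)" "bounded_on U (\<lambda>x. ev x e24)" "bounded_on U (\<lambda>x. ev x e34)"
    for e12 e13 e14 e23 e24 e34 c d
  proof -
    have *: "\<forall>c d. bounded_on U (\<lambda>x. ev x (biv e12 e13 e14 e23 e24 e34 $ c $ d))"
      unfolding forall_4 biv_def vector_4 zero_index ev_simps using that that[THEN bounded_on_minus]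
      by (simp add: bounded_on_const)
    then show "bounded_on U (\<lambda>x. ev x (biv e12 e13 e14 e23 e24 e34 $ c $ d))" by blast
    show "bounded_on U (\<lambda>x. ev x ((- biv e12 e13 e14 e23 e24 e34) $ c $ d))"
      unfolding vector_uminus_component ev_simps by (rule bounded_on_minus) (use * in blast)
  qed
  have "\<forall>b j. bounded_on U (\<lambda>x. ev x (riem $ b $ j $ c $ d))"
    unfolding forall_4 riem_def vector_4 by (intro conjI biv a c d k dd; simp only: zero_index dd)
  then show ?thesis by blast
qed

theorem scalar_polynomial_bounded:
  assumes "open U" "U \<subseteq> dom" "\<And>x. x \<in> U \<Longrightarrow> g x = metric x"
    and "\<And>r. \<bar>h r\<bar> \<le> C * r ^ 4" "\<And>r. \<bar>h1 r\<bar> \<le> C * \<bar>r\<bar> ^ 3" "\<And>r. \<bar>h2 r\<bar> \<le> C * r\<^sup>2"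
    and "scalar_polynomial g I"
  shows "bounded (I ` U)"
proof -
  interpret cartan_coframe U g "evm coframe" "evm frame" frame_metric frame_metric_inv
    "\<lambda>k. evm (conn k)" "\<lambda>k. evm (d_mat k coframe)"
    by (rule cartan[OF assms(1-3)])
  show ?thesis
  proof (rule scalar_polynomial_bounded[OF _ bounded_on_riem[OF assms(2,4-6)] assms(7)])
    fix x k l b j assume "x \<in> U"
    then have x: "x \<in> dom" using assms(2) by blast
    show "(frame_metric ** Om k l x) $ b $ j
      = (\<Sum>c\<in>UNIV. \<Sum>d\<in>UNIV. ev x (riem $ b $ j $ c $ d) * evm coframe x $ c $ k * evm coframe x $ d $ l)"
      unfolding Om_def pdm_evm[OF x low_mats(4)] by (rule frame_curvature[OF x])
  qed
qed

end

section \<open>The mass function\<close>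

definition mass' :: "real \<Rightarrow> real \<Rightarrow> real \<Rightarrow> real" where
  "mass' l m r = 4 * m * l / pi * (r\<^sup>2 / (r\<^sup>2 + l\<^sup>2)\<^sup>2)"

definition mass'' :: "real \<Rightarrow> real \<Rightarrow> real \<Rightarrow> real" where
  "mass'' l m r = 8 * m * l / pi * (r * (l\<^sup>2 - r\<^sup>2) / (r\<^sup>2 + l\<^sup>2) ^ 3)"

lemma sum_sq_pos: "l > 0 \<Longrightarrow> 0 < r\<^sup>2 + (l::real)\<^sup>2"
  by (simp add: add_nonneg_pos)

lemma DERIV_mass:
  assumes "l > 0"
  shows "(mass l m has_real_derivative mass' l m r) (at r)"
proof -
  have nz: "r\<^sup>2 + l\<^sup>2 \<noteq> 0" "l \<noteq> 0" using sum_sq_pos[OF assms, of r] assms by auto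
  have 1: "1 / l / (1 + (r / l)\<^sup>2) = l / (r\<^sup>2 + l\<^sup>2)"
    using nz by (simp add: field_simps power2_eq_square)
  have "l / (r\<^sup>2 + l\<^sup>2) - (l * (r\<^sup>2 + l\<^sup>2) - l * r * (2 * r)) / (r\<^sup>2 + l\<^sup>2)\<^sup>2
      = 2 * l * (r\<^sup>2 / (r\<^sup>2 + l\<^sup>2)\<^sup>2)"
    using nz by (simp add: divide_simps power2_eq_square)
  then have 2: "2 * m / pi * (1 / l / (1 + (r / l)\<^sup>2) - (l * (r\<^sup>2 + l\<^sup>2) - l * r * (2 * r)) / (r\<^sup>2 + l\<^sup>2)\<^sup>2) = mass' l m r"
    unfolding 1 by (simp add: mass'_def)
  have 3: "((\<lambda>r. arctan (r / l)) has_real_derivative 1 / l / (1 + (r / l)\<^sup>2)) (at r)"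
    by (auto intro!: derivative_eq_intros simp: divide_simps)
  have 4: "((\<lambda>r. l * r / (r\<^sup>2 + l\<^sup>2)) has_real_derivative
      (l * (r\<^sup>2 + l\<^sup>2) - l * r * (2 * r)) / (r\<^sup>2 + l\<^sup>2)\<^sup>2) (at r)"
    using nz by (auto intro!: derivative_eq_intros simp: power2_eq_square)
  show ?thesis
    unfolding mass_def[abs_def] 2[symmetric] by (intro DERIV_cmult DERIV_diff 3 4)
qed

lemma DERIV_mass':
  assumes "l > 0"
  shows "(mass' l m has_real_derivative mass'' l m r) (at r)"
proof -
  have nz: "r\<^sup>2 + l\<^sup>2 \<noteq> 0" using sum_sq_pos[OF assms, of r] by auto
  have "((\<lambda>r. r\<^sup>2 / (r\<^sup>2 + l\<^sup>2)\<^sup>2) has_real_derivative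
     (2 * r * (r\<^sup>2 + l\<^sup>2)\<^sup>2 - r\<^sup>2 * (2 * (r\<^sup>2 + l\<^sup>2) * (2 * r))) / ((r\<^sup>2 + l\<^sup>2)\<^sup>2 * (r\<^sup>2 + l\<^sup>2)\<^sup>2)) (at r)"
    using nz by (auto intro!: derivative_eq_intros)
  moreover have "(2 * r * (r\<^sup>2 + l\<^sup>2)\<^sup>2 - r\<^sup>2 * (2 * (r\<^sup>2 + l\<^sup>2) * (2 * r))) / ((r\<^sup>2 + l\<^sup>2)\<^sup>2 * (r\<^sup>2 + l\<^sup>2)\<^sup>2)
    = 2 * (r * (l\<^sup>2 - r\<^sup>2) / (r\<^sup>2 + l\<^sup>2) ^ 3)"
  proof -
    define w where "w = r\<^sup>2 + l\<^sup>2"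
    have e: "l\<^sup>2 - r\<^sup>2 = w - 2 * r\<^sup>2" by (simp add: w_def)
    have n: "2 * r * w\<^sup>2 - r\<^sup>2 * (2 * w * (2 * r)) = w * (2 * (r * (w - 2 * r\<^sup>2)))"
      by (simp add: power2_eq_square algebra_simps)
    have d: "w\<^sup>2 * w\<^sup>2 = w * w ^ 3"
      by (simp add: power2_eq_square power3_eq_cube)
    show ?thesis
      using nz unfolding w_def[symmetric] e n d by simp
  qed
  ultimately show ?thesis
    unfolding mass'_def[abs_def] mass''_def
    by (auto dest: DERIV_cmult[where c = "4 * m * l / pi"] simp: mult_ac)
qed

text \<open>The constant that the estimate of M'' produces when its denominator is bounded below by
  l^4. It also serves for M' and M.\<close>

definition mass_const :: "real \<Rightarrow> real \<Rightarrow> real" where "mass_const l m = 8 * \<bar>m\<bar> / (pi * l ^ 3)"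

lemma mass_const_nonneg: "l > 0 \<Longrightarrow> 0 \<le> mass_const l m"
  by (simp add: mass_const_def)

lemma mass'_bound:
  assumes "l > 0"
  shows "\<bar>mass' l m r\<bar> \<le> mass_const l m * r\<^sup>2"
proof -
  have "(l\<^sup>2)\<^sup>2 \<le> (r\<^sup>2 + l\<^sup>2)\<^sup>2" by (intro power_mono) auto
  then have "r\<^sup>2 / (r\<^sup>2 + l\<^sup>2)\<^sup>2 \<le> r\<^sup>2 / (l\<^sup>2)\<^sup>2"
    using assms sum_sq_pos[OF assms, of r] by (intro divide_left_mono) auto
  then have "4 * \<bar>m\<bar> * l / pi * (r\<^sup>2 / (r\<^sup>2 + l\<^sup>2)\<^sup>2) \<le> 4 * \<bar>m\<bar> * l / pi * (r\<^sup>2 / (l\<^sup>2)\<^sup>2)"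
    using assms by (intro mult_left_mono) auto
  also have "\<dots> = mass_const l m * r\<^sup>2 / 2"
    using assms by (simp add: mass_const_def field_simps power2_eq_square power3_eq_cube)
  also have "\<dots> \<le> mass_const l m * r\<^sup>2"
    using mass_const_nonneg[OF assms, of m] by simp
  finally show ?thesis
    using assms by (simp add: mass'_def abs_mult)
qed

lemma mass''_bound:
  assumes "l > 0"
  shows "\<bar>mass'' l m r\<bar> \<le> mass_const l m * \<bar>r\<bar>"
proof -
  have p: "r\<^sup>2 + l\<^sup>2 > 0" by (rule sum_sq_pos[OF assms])
  have "\<bar>l\<^sup>2 - r\<^sup>2\<bar> \<le> r\<^sup>2 + l\<^sup>2" by (simp add: abs_le_iff)
  then have "\<bar>r * (l\<^sup>2 - r\<^sup>2) / (r\<^sup>2 + l\<^sup>2) ^ 3\<bar> \<le> \<bar>r\<bar> * (r\<^sup>2 + l\<^sup>2) / (r\<^sup>2 + l\<^sup>2) ^ 3"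
    using p by (auto simp: abs_mult intro!: divide_right_mono mult_left_mono)
  also have "\<dots> = \<bar>r\<bar> / (r\<^sup>2 + l\<^sup>2)\<^sup>2"
    using p by (simp add: power2_eq_square power3_eq_cube)
  also have "\<dots> \<le> \<bar>r\<bar> / (l\<^sup>2)\<^sup>2"
    using assms p by (intro divide_left_mono power_mono) auto
  finally have "8 * \<bar>m\<bar> * l / pi * \<bar>r * (l\<^sup>2 - r\<^sup>2) / (r\<^sup>2 + l\<^sup>2) ^ 3\<bar> \<le> 8 * \<bar>m\<bar> * l / pi * (\<bar>r\<bar> / (l\<^sup>2)\<^sup>2)"
    using assms by (intro mult_left_mono) auto
  also have "\<dots> = mass_const l m * \<bar>r\<bar>"
    using assms by (simp add: mass_const_def field_simps power2_eq_square power3_eq_cube)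
  finally show ?thesis
    using assms by (simp add: mass''_def abs_mult)
qed

text \<open>Mean value inequality from M(0) = 0, with the quadratic bound of M' taken over the
  interval from -|r| to |r|.\<close>

lemma mass_bound:
  assumes "l > 0"
  shows "\<bar>mass l m r\<bar> \<le> mass_const l m * \<bar>r\<bar> ^ 3"
proof -
  have "norm (mass l m r - mass l m 0) \<le> mass_const l m * r\<^sup>2 * norm (r - 0)"
  proof (rule field_differentiable_bound[where S = "{- \<bar>r\<bar>..\<bar>r\<bar>}" and f' = "mass' l m"])
    fix z assume "z \<in> {- \<bar>r\<bar>..\<bar>r\<bar>}"
    then have "z\<^sup>2 \<le> r\<^sup>2" by (simp add: abs_le_square_iff[symmetric] abs_le_iff)
    then have "mass_const l m * z\<^sup>2 \<le> mass_const l m * r\<^sup>2"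
      using mass_const_nonneg[OF assms] by (rule mult_left_mono)
    then show "norm (mass' l m z) \<le> mass_const l m * r\<^sup>2"
      using mass'_bound[OF assms, of m z] by simp
  qed (auto intro: DERIV_subset[OF DERIV_mass[OF assms]])
  then show ?thesis
    by (simp add: mass_def power2_eq_square power3_eq_cube mult.assoc flip: abs_mult)
qed

section \<open>Boundedness for the rotating Dymnikova metric\<close>

definition two_r_mass where "two_r_mass l m r = 2 * r * mass l m r"
definition two_r_mass_d1 where "two_r_mass_d1 l m r = 2 * mass l m r + 2 * r * mass' l m r"
definition two_r_mass_d2 where "two_r_mass_d2 l m r = 4 * mass' l m r + 2 * r * mass'' l m r"

lemma rotating_dymnikova:
  assumes "l > 0"
  shows "rotating (two_r_mass l m) (two_r_mass_d1 l m) (two_r_mass_d2 l m)"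
proof
  fix r
  show "(two_r_mass l m has_real_derivative two_r_mass_d1 l m r) (at r)"
    unfolding two_r_mass_def[abs_def] two_r_mass_d1_def
    by (auto intro!: derivative_eq_intros DERIV_mass[OF assms])
  show "(two_r_mass_d1 l m has_real_derivative two_r_mass_d2 l m r) (at r)"
    unfolding two_r_mass_d1_def[abs_def] two_r_mass_d2_def
    by (auto intro!: derivative_eq_intros DERIV_mass[OF assms] DERIV_mass'[OF assms])
qed

text \<open>The common factor 6 = 4 + 2 comes from the second derivative 4 M' + 2 r M''. The
  estimates of the other two give 2 and 4.\<close>

lemma two_r_mass_bounds:
  assumes "l > 0"
  shows "\<bar>two_r_mass l m r\<bar> \<le> (6 * mass_const l m) * r ^ 4"
    "\<bar>two_r_mass_d1 l m r\<bar> \<le> (6 * mass_const l m) * \<bar>r\<bar> ^ 3"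
    "\<bar>two_r_mass_d2 l m r\<bar> \<le> (6 * mass_const l m) * r\<^sup>2"
proof -
  let ?K = "mass_const l m"
  have K: "?K \<ge> 0" by (rule mass_const_nonneg[OF assms])
  have 0: "\<bar>r\<bar> * \<bar>mass l m r\<bar> \<le> \<bar>r\<bar> * (?K * \<bar>r\<bar> ^ 3)"
    by (intro mult_left_mono mass_bound assms) simp
  have 1: "\<bar>r\<bar> * \<bar>mass' l m r\<bar> \<le> \<bar>r\<bar> * (?K * r\<^sup>2)"
    by (intro mult_left_mono mass'_bound assms) simp
  have 2: "\<bar>r\<bar> * \<bar>mass'' l m r\<bar> \<le> \<bar>r\<bar> * (?K * \<bar>r\<bar>)"
    by (intro mult_left_mono mass''_bound assms) simp
  have e: "\<bar>r\<bar> * (?K * \<bar>r\<bar> ^ 3) = ?K * r ^ 4" "\<bar>r\<bar> * (?K * r\<^sup>2) = ?K * \<bar>r\<bar> ^ 3" "\<bar>r\<bar> * (?K * \<bar>r\<bar>) = ?K * r\<^sup>2"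
    by (simp_all add: power4_eq_xxxx power3_eq_cube power2_eq_square mult_ac flip: abs_mult)
  have "\<bar>two_r_mass l m r\<bar> \<le> 2 * (\<bar>r\<bar> * \<bar>mass l m r\<bar>)" by (simp add: two_r_mass_def abs_mult)
  also have "\<dots> \<le> (6 * ?K) * r ^ 4" using 0 mult_nonneg_nonneg[OF K, of "r ^ 4"] unfolding e by simp
  finally show "\<bar>two_r_mass l m r\<bar> \<le> (6 * ?K) * r ^ 4" .
  have "\<bar>two_r_mass_d1 l m r\<bar> \<le> 2 * \<bar>mass l m r\<bar> + 2 * (\<bar>r\<bar> * \<bar>mass' l m r\<bar>)"
    unfolding two_r_mass_d1_def by (rule order_trans[OF abs_triangle_ineq]) (simp add: abs_mult)
  also have "\<dots> \<le> 4 * (?K * \<bar>r\<bar> ^ 3)" using 1 mass_bound[OF assms, of m r] unfolding e by simp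
  also have "\<dots> \<le> (6 * ?K) * \<bar>r\<bar> ^ 3" using K by (simp add: mult_right_mono)
  finally show "\<bar>two_r_mass_d1 l m r\<bar> \<le> (6 * ?K) * \<bar>r\<bar> ^ 3" .
  have "\<bar>two_r_mass_d2 l m r\<bar> \<le> 4 * \<bar>mass' l m r\<bar> + 2 * (\<bar>r\<bar> * \<bar>mass'' l m r\<bar>)"
    unfolding two_r_mass_d2_def by (rule order_trans[OF abs_triangle_ineq]) (simp add: abs_mult)
  also have "\<dots> \<le> (6 * ?K) * r\<^sup>2" using 2 mass'_bound[OF assms, of m r] unfolding e by simp
  finally show "\<bar>two_r_mass_d2 l m r\<bar> \<le> (6 * ?K) * r\<^sup>2" .
qed

lemma Delta_eq: "Delta a l m r = rotating.Del a (two_r_mass l m) r" if "l > 0"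
  unfolding rotating.Del_def[OF rotating_dymnikova[OF that]] by (simp add: Delta_def two_r_mass_def)

lemma Sigma_pos:
  assumes "a \<noteq> 0" "0 < \<theta>" "\<theta> < pi" "\<not> (r = 0 \<and> \<theta> = pi/2)"
  shows "0 < r\<^sup>2 + a\<^sup>2 * (cos \<theta>)\<^sup>2"
proof (cases "r = 0")
  case True
  have "cos \<theta> \<noteq> 0"
  proof
    assume "cos \<theta> = 0"
    then have "\<theta> = pi/2"
      using assms(2,3) cos_inj_pi[of \<theta> "pi/2"] by simp
    with True assms(4) show False by simp
  qed
  then show ?thesis using True assms(1) by simp
qed (simp add: add_pos_nonneg)

lemma open_bl_domain:
  assumes "l > 0"
  shows "open (bl_domain a l m)"
proof -
  have cont: "continuous_on UNIV (Delta a l m)"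
    unfolding Delta_def[abs_def]
    by (intro continuous_intros continuous_at_imp_continuous_on ballI DERIV_isCont[OF DERIV_mass[OF assms]])
  have e: "bl_domain a l m = {x. Delta a l m (x$2) \<noteq> 0} \<inter> {x. 0 < x$3} \<inter> {x. x$3 < pi} \<inter> ({x. x$2 \<noteq> 0} \<union> {x. x$3 \<noteq> pi/2})"
    by (auto simp: bl_domain_def)
  have "continuous_on UNIV (\<lambda>x::real^4. Delta a l m (x$2))"
    by (rule continuous_on_compose2[OF cont]) (auto intro: continuous_intros)
  then show ?thesis
    unfolding e by (intro open_Int open_Un open_Collect_neq open_Collect_less continuous_intros) auto
qed

lemma bl_domain_subset:
  assumes "l > 0" "a \<noteq> 0"
  shows "bl_domain a l m \<subseteq> rotating.dom a (two_r_mass l m)"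
proof
  fix x assume x: "x \<in> bl_domain a l m"
  interpret rotating a "two_r_mass l m" "two_r_mass_d1 l m" "two_r_mass_d2 l m" by (rule rotating_dymnikova[OF assms(1)])
  have "sin (x$3) > 0" using x by (intro sin_gt_zero) (auto simp: bl_domain_def)
  moreover have "Sig x > 0"
    unfolding Sig_def using x assms by (intro Sigma_pos) (auto simp: bl_domain_def)
  ultimately show "x \<in> dom"
    using x by (simp add: dom_def bl_domain_def Delta_eq[OF assms(1)])
qed

text \<open>Replacing division by \<Sigma> and \<Delta> with multiplication by u and v makes each
  matrix entry a polynomial identity modulo \<open>rel\<close>.\<close>

lemma bl_metric_eq:
  assumes "l > 0" "a \<noteq> 0" "x \<in> bl_domain a l m"
  shows "bl_metric a l m x = rotating.metric a (two_r_mass l m) (two_r_mass_d1 l m) (two_r_mass_d2 l m) x"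
proof -
  interpret rotating a "two_r_mass l m" "two_r_mass_d1 l m" "two_r_mass_d2 l m" by (rule rotating_dymnikova[OF assms(1)])
  have x: "x \<in> dom" using bl_domain_subset assms by blast
  obtain r c s u v w d0 d1 d2 where e: "ev x Rad = r" "ev x Cos = c" "ev x Sin = s" "ev x ISig = u" "ev x IDel = v"
    "ev x ISin = w" "ev x H0 = d0" "ev x H1 = d1" "ev x H2 = d2"
    and rel: "u * (r * r + a * a * c * c) = 1" "v * (r * r + a * a - d0) = 1" "s * s = 1 - c * c" "w * s = 1"
    by (rule generators[OF x])
  have r: "x$2 = r" "cos (x$3) = c" "sin (x$3) = s" "2 * mass l m r * r = d0"
    "Delta a l m r = r * r + a * a - d0" 
    using e by (auto simp: two_r_mass_def Delta_def power2_eq_square)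
  have u: "y / (r * r + a * a * (c * c)) = y * u" for y
    using inverse_unique[of "r * r + a * a * (c * c)" u] rel(1) by (simp add: divide_inverse mult_ac)
  have v: "y / (r * r + a * a - d0) = y * v" for y
    using inverse_unique[of "r * r + a * a - d0" v] rel(2) by (simp add: divide_inverse mult_ac)
  have m4: "2 * a * mass l m r * r * (s * s) = a * d0 * (s * s)"
    "2 * (a * a) * mass l m r * r * (s * s) = a * a * d0 * (s * s)"
    unfolding r(4)[symmetric] by simp_all
  show ?thesis
    unfolding bl_metric_def Let_def r metric_def vec_eq_iff
    unfolding expand e transpose_def power2_eq_square[of r] power2_eq_square[of c] power2_eq_square[of s] power2_eq_square[of a] m4 r u v
    by (intro conjI; (rule refl | algebra | (use rel in algebra)))
qed

theorem bl_scalar_polynomial_bounded: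
  assumes "l > 0" "a \<noteq> 0" "scalar_polynomial (bl_metric a l m) I"
  shows "bounded (I ` bl_domain a l m)"
proof -
  interpret rotating a "two_r_mass l m" "two_r_mass_d1 l m" "two_r_mass_d2 l m" by (rule rotating_dymnikova[OF assms(1)])
  show ?thesis
    by (rule scalar_polynomial_bounded[OF open_bl_domain bl_domain_subset bl_metric_eq two_r_mass_bounds assms(3)])
      (use assms in auto)
qed

section \<open>Lorentzian forms from orthonormal frames\<close>

text \<open>Pairing a vanishing combination with \<open>e j\<close> isolates its j-th coefficient up
  to sign, so the four vectors are independent and span by dimension.\<close>

lemma lorentzianI:
  fixes B :: "'v::euclidean_space \<Rightarrow> 'v \<Rightarrow> real" and e :: "4 \<Rightarrow> 'v"
  assumes "bilinear B" "subspace V" "dim V = 4" "range e \<subseteq> V"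
    and on: "\<And>i j. B (e i) (e j) = (if i \<noteq> j then 0 else if i = 1 then -1 else 1)"
  shows "lorentzian V B"
proof -
  have inj: "inj e"
  proof (rule injI)
    fix i j assume "e i = e j"
    then have "B (e i) (e j) = B (e i) (e i)" by simp
    then show "i = j" unfolding on by (auto split: if_splits)
  qed
  have "independent (range e)"
  proof (rule independent_if_scalars_zero)
    fix f x assume s: "(\<Sum>x\<in>range e. f x *\<^sub>R x) = 0" and "x \<in> range e"
    then obtain j where j: "x = e j" by auto
    have "0 = B (\<Sum>i\<in>UNIV. f (e i) *\<^sub>R e i) (e j)"
      using s assms(1) by (simp add: sum.reindex[OF inj] bilinear_lzero)
    also have "\<dots> = (\<Sum>i\<in>UNIV. f (e i) * B (e i) (e j))"
      using assms(1) by (subst linear_sum[of "\<lambda>v. B v (e j)"]) (simp_all add: bilinear_def bilinear_lmul)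
    also have "\<dots> = (\<Sum>i\<in>UNIV. if i = j then f (e j) * (if j = 1 then -1 else 1) else 0)"
      by (rule sum.cong) (simp_all add: on)
    also have "\<dots> = f (e j) * (if j = 1 then -1 else 1)"
      by simp
    finally show "f x = 0" by (simp add: j split: if_splits)
  qed simp
  moreover have "card (range e) = 4"
    using inj by (simp add: card_image)
  ultimately have "V \<subseteq> span (range e)"
    using assms(3,4) by (intro card_ge_dim_independent) auto
  then have "span (range e) = V"
    using assms(2,4) by (simp add: antisym span_minimal)
  then show ?thesis unfolding lorentzian_def using on by blast
qed

lemma bilinear_form_of: "bilinear (form_of g x)"
proof -
  have "form_of g x u v = (\<Sum>i\<in>UNIV. \<Sum>j\<in>UNIV. g x $ i $ j * u $ i * v $ j)" for u v
    by (simp add: form_of_def inner_vec_def matrix_vector_mult_def sum_distrib_left mult_ac)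
  then show ?thesis
    unfolding bilinear_def
    by (auto intro!: linearI simp: sum.distrib algebra_simps sum_distrib_left)
qed

lemma form_of_bl_metric:
  assumes "\<Sigma> = (x$2)\<^sup>2 + a\<^sup>2 * (cos (x$3))\<^sup>2" "H = 2 * mass l m (x$2) * x$2" "s = sin (x$3)"
  shows "form_of (bl_metric a l m) x u v =
     - (1 - H / \<Sigma>) * u$1 * v$1 - a * H * s\<^sup>2 / \<Sigma> * (u$1 * v$4 + u$4 * v$1)
     + \<Sigma> / Delta a l m (x$2) * u$2 * v$2 + \<Sigma> * u$3 * v$3
     + ((x$2)\<^sup>2 + a\<^sup>2 + a\<^sup>2 * H * s\<^sup>2 / \<Sigma>) * s\<^sup>2 * u$4 * v$4"
  unfolding form_of_def bl_metric_def Let_def assms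
  by (simp add: inner_vec_def matrix_vector_mult_def sum_4 algebra_simps add_divide_distrib)

lemma bl_metric_smooth:
  assumes "l > 0" "a \<noteq> 0"
  shows "smooth_metric (bl_domain a l m) (\<lambda>_. UNIV) (form_of (bl_metric a l m))"
  unfolding smooth_metric_def lorentz_field_def
proof (intro conjI ballI allI)
  fix x assume x: "x \<in> bl_domain a l m"
  show "bilinear (form_of (bl_metric a l m) x)" by (rule bilinear_form_of)
  show "form_of (bl_metric a l m) x u v = form_of (bl_metric a l m) x v u" for u v
    unfolding form_of_bl_metric[OF refl refl refl] by (simp add: algebra_simps)
  define \<Sigma> where "\<Sigma> = (x$2)\<^sup>2 + a\<^sup>2 * (cos (x$3))\<^sup>2"
  define s where "s = sin (x$3)"
  define H where "H = 2 * mass l m (x$2) * x$2"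
  define D where "D = Delta a l m (x$2)"
  define r where "r = x$2"
  have D: "D = r\<^sup>2 + a\<^sup>2 - H" by (simp add: D_def Delta_def H_def r_def)
  have s: "s > 0" unfolding s_def using x by (intro sin_gt_zero) (auto simp: bl_domain_def)
  have S: "\<Sigma> > 0" unfolding \<Sigma>_def using x assms by (intro Sigma_pos) (auto simp: bl_domain_def)
  have S2: "\<Sigma> = r\<^sup>2 + a\<^sup>2 - a\<^sup>2 * s\<^sup>2" by (simp add: \<Sigma>_def r_def s_def cos_squared_eq algebra_simps)
  have D0: "D \<noteq> 0" using x by (simp add: bl_domain_def D_def)
  have F: "form_of (bl_metric a l m) x u v =
     - (1 - H / \<Sigma>) * u$1 * v$1 - a * H * s\<^sup>2 / \<Sigma> * (u$1 * v$4 + u$4 * v$1)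
     + \<Sigma> / D * u$2 * v$2 + \<Sigma> * u$3 * v$3
     + (r\<^sup>2 + a\<^sup>2 + a\<^sup>2 * H * s\<^sup>2 / \<Sigma>) * s\<^sup>2 * u$4 * v$4" for u v
    unfolding D_def r_def by (rule form_of_bl_metric[OF \<Sigma>_def H_def s_def])
  let ?d = "if D > 0 then 1 else -1 :: real"
  define N where "N = 1 / sqrt (\<Sigma> * \<bar>D\<bar>)"
  define P where "P = 1 / sqrt \<Sigma>"
  define Q where "Q = sqrt (\<bar>D\<bar> / \<Sigma>)"
  have N: "N * N * \<Sigma> * D = ?d" using S D0 by (simp add: N_def field_simps)
  have P: "P * P * \<Sigma> = 1" using S by (simp add: P_def field_simps)
  have Q: "Q * Q * (\<Sigma> / D) = ?d" using S D0 by (simp add: Q_def field_simps)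
  \<comment> \<open>Carter's frame: \<open>et\<close> and \<open>e4\<close> are normalised multiples
    of (r^2 + a^2) \<partial>t + a \<partial>\<phi> and a sin^2 \<theta> \<partial>t +
    \<partial>\<phi>.\<close>
  define et where "et = (vector [(r\<^sup>2 + a\<^sup>2) * N, 0, 0, a * N] :: real^4)"
  define er where "er = (vector [0, Q, 0, 0] :: real^4)"
  define e3 where "e3 = (vector [0, 0, P, 0] :: real^4)"
  define e4 where "e4 = (vector [a * s * P, 0, 0, P / s] :: real^4)"
  \<comment> \<open>\<open>lorentzian\<close> wants the timelike vector first. Where \<Delta> < 0
    this is the radial one, so the first two change places.\<close>
  define e where "e i = (vector [if D > 0 then et else er, if D > 0 then er else et,
     e3, e4] :: real^4^4) $ i" for i
  have 1: "form_of (bl_metric a l m) x et et = - ?d"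
  proof -
    have "form_of (bl_metric a l m) x et et = - (N * N * \<Sigma> * D)"
      unfolding F et_def vector_4 using S unfolding D S2 by (simp add: divide_simps) algebra
    then show ?thesis by (simp add: N)
  qed
  have 2: "form_of (bl_metric a l m) x er er = ?d"
    unfolding F er_def vector_4 using Q by (simp add: mult_ac)
  have 3: "form_of (bl_metric a l m) x e3 e3 = 1"
    unfolding F e3_def vector_4 using P by (simp add: mult_ac)
  have 4: "form_of (bl_metric a l m) x e4 e4 = 1"
  proof -
    have "form_of (bl_metric a l m) x e4 e4 = P * P * \<Sigma>"
      unfolding F e4_def vector_4 using S s by (simp add: divide_simps) (simp add: S2 algebra_simps power2_eq_square)
    then show ?thesis by (simp add: P)
  qed
  have 5: "form_of (bl_metric a l m) x et e4 = 0" "form_of (bl_metric a l m) x e4 et = 0"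
    "form_of (bl_metric a l m) x et er = 0" "form_of (bl_metric a l m) x er et = 0"
    "form_of (bl_metric a l m) x et e3 = 0" "form_of (bl_metric a l m) x e3 et = 0"
    "form_of (bl_metric a l m) x er e3 = 0" "form_of (bl_metric a l m) x e3 er = 0"
    "form_of (bl_metric a l m) x er e4 = 0" "form_of (bl_metric a l m) x e4 er = 0"
    "form_of (bl_metric a l m) x e3 e4 = 0" "form_of (bl_metric a l m) x e4 e3 = 0"
    unfolding F et_def er_def e3_def e4_def vector_4 using S s
    by (simp_all add: divide_simps) (simp_all add: algebra_simps power2_eq_square)
  show "lorentzian UNIV (form_of (bl_metric a l m) x)"
  proof (rule lorentzianI[where e = e])
    show "bilinear (form_of (bl_metric a l m) x)" by (rule bilinear_form_of)
    fix i j
    have "\<forall>i j. form_of (bl_metric a l m) x (e i) (e j) = (if i \<noteq> j then 0 else if i = 1 then -1 else 1)"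
      unfolding forall_4 e_def vector_4 using D0 by (simp add: 1 2 3 4 5)
    then show "form_of (bl_metric a l m) x (e i) (e j) = (if i \<noteq> j then 0 else if i = 1 then -1 else 1)"
      by blast
  qed auto
next
  fix u v
  have D0: "Delta a l m (x$2) \<noteq> 0" "(x$2)\<^sup>2 + a\<^sup>2 * (cos (x$3))\<^sup>2 \<noteq> 0" if "x \<in> bl_domain a l m" for x
    using that Sigma_pos[OF assms(2), of "x$3" "x$2"] by (auto simp: bl_domain_def)
  have l: "(x$2)\<^sup>2 + l\<^sup>2 \<noteq> 0" for x :: "real^4"
    using assms(1) by simp
  have c: "Ck_on k U (\<lambda>x::real^4. x $ i)" for k U i
    by (rule Ck_on_bounded_linear[OF bounded_linear_vec_nth])
  have M: "Ck_on k U (\<lambda>x::real^4. mass l m (x$2))" for k U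
    unfolding mass_def using assms(1) l by (intro Ck_on_intros c) auto
  show "smooth_on (bl_domain a l m) (\<lambda>x. form_of (bl_metric a l m) x u v)"
  proof (rule smooth_onI[OF open_bl_domain[OF assms(1)] subset_refl])
    show "Ck_on k (bl_domain a l m) (\<lambda>x. form_of (bl_metric a l m) x u v)" for k
      unfolding form_of_bl_metric[OF refl refl refl]
      by (intro Ck_on_intros c M D0; (simp add: Delta_def; intro Ck_on_intros c M)?)
  qed simp
qed

section \<open>Smoothness of functions of one coordinate\<close>

lemma Ck_on_linear_precompose:
  assumes L: "bounded_linear L" and "Ck_on k UNIV f"
  shows "Ck_on k U (\<lambda>x. f (L x))"
  using assms(2)
proof (induction k arbitrary: f)
  case 0
  then show ?case
    using continuous_on_compose2[of UNIV f U L] linear_continuous_on[OF L] by simp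
next
  case (Suc k)
  from Suc.prems obtain f' where "\<forall>x\<in>UNIV. (f has_derivative f' x) (at x)" "\<forall>v. Ck_on k UNIV (\<lambda>x. f' x v)"
    unfolding Ck_on.simps(2) by (elim exE conjE)
  note f' = this[rule_format]
  show ?case
  proof (rule Ck_on_SucI[where f' = "\<lambda>x v. f' (L x) (L v)"])
    show "((\<lambda>x. f (L x)) has_derivative (\<lambda>v. f' (L x) (L v))) (at x)" for x
      by (rule has_derivative_compose[OF bounded_linear_imp_has_derivative[OF L] f'(1)]) simp
    show "Ck_on k U (\<lambda>x. f' (L x) (L v))" for v
      by (rule Suc.IH[OF f'(2)])
  qed
qed

section \<open>A family of metrics on the spacetime manifold\<close>

text \<open>With \<open>\<Sigma> / q dr\<^sup>2 + 2 \<beta> dr (dt - a \<omega>)\<close> as the terms in \<open>dr\<close>, the relation \<open>q (1 - \<beta>\<^sup>2) = \<Delta>\<close> makes the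
  metric isometric to the Boyer-Lindquist form. The Doran form is \<open>q = r\<^sup>2 + a\<^sup>2\<close>. For \<open>m < 0\<close> it is not real, but
  then \<open>\<Delta> > 0\<close> and \<open>q = \<Delta>\<close>, \<open>\<beta> = 0\<close> is possible.\<close>

locale shifted_metric =
  fixes a :: real and H q \<beta> :: "real \<Rightarrow> real"
  assumes a: "a \<noteq> 0" and q_pos: "0 < q r" and q_rel: "q r * (1 - (\<beta> r)\<^sup>2) = r\<^sup>2 + a\<^sup>2 - H r"
    and smooth_H: "Ck_on k UNIV H" and smooth_q: "Ck_on k UNIV q" and smooth_\<beta>: "Ck_on k UNIV \<beta>"
begin

definition Sgm :: "point \<Rightarrow> real" where
  "Sgm p = (fst (snd p))\<^sup>2 + a\<^sup>2 * (snd (snd p) $ 3)\<^sup>2"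

definition om :: "point \<Rightarrow> point \<Rightarrow> real" where
  "om p u = azimuth_form (snd (snd p)) (snd (snd u))"

text \<open>The one-form dt - a sin^2 \<theta> d\<phi>, called K in the description of the
  coframe.\<close>

definition kf :: "point \<Rightarrow> point \<Rightarrow> real" where
  "kf p u = fst u - a * om p u"

definition gm :: "point \<Rightarrow> point \<Rightarrow> point \<Rightarrow> real" where
  "gm p u v = - (fst u * fst v) + Sgm p * (snd (snd u) \<bullet> snd (snd v)) + a\<^sup>2 * om p u * om p v
     + H (fst (snd p)) / Sgm p * kf p u * kf p v
     + Sgm p / q (fst (snd p)) * fst (snd u) * fst (snd v)
     + \<beta> (fst (snd p)) * (fst (snd u) * kf p v + fst (snd v) * kf p u)"

lemma Sgm_pos: "p \<in> spacetime \<Longrightarrow> 0 < Sgm p"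
  using a by (cases p) (auto simp: Sgm_def spacetime_def all_points_def ring_set_def sum_power2_gt_zero_iff
    power_mult_distrib[symmetric] simp del: power_mult_distrib)

lemma om_linear: "om p (u + v) = om p u + om p v" "om p (c *\<^sub>R u) = c * om p u"
  by (simp_all add: om_def azimuth_form_def algebra_simps)

lemma kf_linear: "kf p (u + v) = kf p u + kf p v" "kf p (c *\<^sub>R u) = c * kf p u"
  by (simp_all add: kf_def om_linear algebra_simps)

lemma gm_sym: "gm p u v = gm p v u"
  by (simp add: gm_def inner_commute algebra_simps)

lemma gm_bilinear: "bilinear (gm p)"
proof -
  have "linear (gm p u)" for u
    by (rule linearI) (simp_all add: gm_def om_linear kf_linear algebra_simps add_divide_distrib)
  moreover have "linear (\<lambda>u. gm p u v)" for v
    using calculation[of v] unfolding gm_sym[of p v] .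
  ultimately show ?thesis by (simp add: bilinear_def)
qed

text \<open>Off the axis these are the unit vectors along increasing \<phi> and decreasing \<theta>.
  On the axis the azimuth form vanishes, and a horizontal orthonormal pair serves.\<close>

lemma azimuth_frame:
  fixes n :: "real^3"
  assumes "norm n = 1"
  obtains f1 f2 where "f1 \<bullet> f1 = 1" "f2 \<bullet> f2 = 1" "f1 \<bullet> f2 = 0" "n \<bullet> f1 = 0" "n \<bullet> f2 = 0"
    "(azimuth_form n f1)\<^sup>2 = 1 - (n$3)\<^sup>2" "azimuth_form n f2 = 0"
proof -
  have n: "n$1 * n$1 + n$2 * n$2 + n$3 * n$3 = 1"
    using assms norm_eq_1[of n] by (simp add: inner_vec_def sum_3)
  show ?thesis
  proof (cases "n$1 * n$1 + n$2 * n$2 = 0")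
    case True
    then have z: "n$1 = 0" "n$2 = 0" by (simp_all add: sum_squares_eq_zero_iff)
    with n have "n$3 * n$3 = 1" by simp
    with z show ?thesis
      by (intro that[of "vector [1, 0, 0]" "vector [0, 1, 0]"])
        (simp_all add: inner_vec_def sum_3 azimuth_form_def power2_eq_square)
  next
    case False
    define k where "k = n$1 * n$1 + n$2 * n$2"
    define c where "c = inverse (sqrt k)"
    have "k \<ge> 0" by (simp add: k_def)
    moreover have "k \<noteq> 0" unfolding k_def by (rule False)
    ultimately have k: "k > 0" by linarith
    then have c: "c * c * k = 1"
      by (simp add: c_def field_simps)
    have k': "k = 1 - n$3 * n$3" using n by (simp add: k_def)
    show ?thesis
    proof (rule that[of "vector [- c * n$2, c * n$1, 0]" "vector [- c * n$1 * n$3, - c * n$2 * n$3, c * k]"])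
      have "c * c * (n$1 * n$1 + n$2 * n$2) = 1" using c by (simp add: k_def)
      then show "vector [- c * n$2, c * n$1, 0] \<bullet> (vector [- c * n$2, c * n$1, 0] :: real^3) = 1"
        by (simp add: inner_vec_def sum_3 algebra_simps)
      have "c * c * k * (n$3 * n$3) + c * c * k * k = 1"
        unfolding c using k' by simp
      then show "vector [- c * n$1 * n$3, - c * n$2 * n$3, c * k] \<bullet>
          (vector [- c * n$1 * n$3, - c * n$2 * n$3, c * k] :: real^3) = 1"
        by (simp add: inner_vec_def sum_3 k_def algebra_simps)
      show "vector [- c * n$2, c * n$1, 0] \<bullet> (vector [- c * n$1 * n$3, - c * n$2 * n$3, c * k] :: real^3) = 0"
        by (simp add: inner_vec_def sum_3 algebra_simps)
      show "n \<bullet> vector [- c * n$2, c * n$1, 0] = 0"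
        by (simp add: inner_vec_def sum_3 algebra_simps)
      show "n \<bullet> vector [- c * n$1 * n$3, - c * n$2 * n$3, c * k] = 0"
        by (simp add: inner_vec_def sum_3 k_def algebra_simps)
      have "azimuth_form n (vector [- c * n$2, c * n$1, 0]) = c * k"
        by (simp add: azimuth_form_def k_def algebra_simps)
      moreover have "(c * k)\<^sup>2 = c * c * k * k" by (simp add: power2_eq_square)
      ultimately show "(azimuth_form n (vector [- c * n$2, c * n$1, 0]))\<^sup>2 = 1 - (n$3)\<^sup>2"
        using c k' by (simp add: power2_eq_square)
      show "azimuth_form n (vector [- c * n$1 * n$3, - c * n$2 * n$3, c * k]) = 0"
        by (simp add: azimuth_form_def algebra_simps)
    qed
  qed
qed

lemma gm_lorentzian:
  assumes p: "p \<in> spacetime"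
  shows "lorentzian (tangent p) (gm p)"
proof -
  obtain t r n where p_eq: "p = (t, r, n)" by (cases p)
  have n: "norm n = 1" using p by (simp add: p_eq spacetime_def all_points_def)
  obtain f1 f2 where f: "f1 \<bullet> f1 = 1" "f2 \<bullet> f2 = 1" "f1 \<bullet> f2 = 0" "n \<bullet> f1 = 0" "n \<bullet> f2 = 0"
    "(azimuth_form n f1)\<^sup>2 = 1 - (n$3)\<^sup>2" "azimuth_form n f2 = 0"
    by (rule azimuth_frame[OF n])
  define S where "S = Sgm p"
  define s where "s = azimuth_form n f1"
  have S: "S > 0" using Sgm_pos[OF p] by (simp add: S_def)
  have S2: "S = r\<^sup>2 + a\<^sup>2 - a\<^sup>2 * s\<^sup>2"
  proof -
    have n3: "(n$3)\<^sup>2 = 1 - s\<^sup>2" using f(6) by (simp add: s_def)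
    show ?thesis
      by (simp only: S_def Sgm_def p_eq fst_conv snd_conv n3) (simp add: algebra_simps)
  qed
  define N where "N = 1 / sqrt (S * q r)"
  define P where "P = 1 / sqrt S"
  define Q where "Q = sqrt (q r / S)"
  have N: "N * N * S * q r = 1" using S q_pos[of r] by (simp add: N_def field_simps)
  have P: "P * P * S = 1" using S by (simp add: P_def field_simps)
  have Q: "Q * Q * (S / q r) = 1" using S q_pos[of r] by (simp add: Q_def field_simps)
  \<comment> \<open>Carter's frame with q in place of \<Delta>, so that \<open>e1\<close> is
    timelike for either sign of \<Delta>. Its radial component cancels the cross term with \<beta>
    against \<open>e2\<close>.\<close>
  define e1 :: point where "e1 = ((r\<^sup>2 + a\<^sup>2) * N, - \<beta> r * q r * N, (a * s * N) *\<^sub>R f1)"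
  define e2 :: point where "e2 = (0, Q, 0)"
  define e3 :: point where "e3 = (a * s * P, 0, P *\<^sub>R f1)"
  define e4 :: point where "e4 = (0, 0, P *\<^sub>R f2)"
  have azs: "azimuth_form n (c *\<^sub>R w) = c * azimuth_form n w" "azimuth_form n 0 = 0" for c w
    by (simp_all add: azimuth_form_def algebra_simps)
  have om: "om p e1 = a * s * s * N" "om p e2 = 0" "om p e3 = s * P" "om p e4 = 0"
    by (simp_all add: om_def p_eq e1_def e2_def e3_def e4_def azs f s_def)
  have kf: "kf p e1 = S * N" "kf p e2 = 0" "kf p e3 = 0" "kf p e4 = 0"
    unfolding kf_def om by (simp_all add: e1_def e2_def e3_def e4_def S2 algebra_simps power2_eq_square)
  have q: "q r * (1 - \<beta> r * \<beta> r) = r\<^sup>2 + a\<^sup>2 - H r" using q_rel[of r] by (simp add: power2_eq_square)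
  have f21: "f2 \<bullet> f1 = 0" using f(3) by (simp add: inner_commute)
  have 1: "gm p e1 e1 = -1"
  proof -
    have "gm p e1 e1 = N * N * (- (r\<^sup>2 + a\<^sup>2)\<^sup>2 + S * (a * a * s * s) + a * a * (a * s * s) * (a * s * s)
       + H r * S + S * q r * (\<beta> r * \<beta> r) - 2 * S * q r * (\<beta> r * \<beta> r))"
      unfolding gm_def om kf S_def[symmetric] using S q_pos[of r]
      by (simp add: e1_def p_eq f power2_eq_square algebra_simps)
    also have "- (r\<^sup>2 + a\<^sup>2)\<^sup>2 + S * (a * a * s * s) + a * a * (a * s * s) * (a * s * s)
       + H r * S + S * q r * (\<beta> r * \<beta> r) - 2 * S * q r * (\<beta> r * \<beta> r) = - S * q r"
      using q S2 by algebra
    finally show ?thesis using N by (simp add: mult.assoc)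
  qed
  have 2: "gm p e2 e2 = 1"
  proof -
    have "gm p e2 e2 = Q * Q * (S / q r)"
      unfolding gm_def om kf S_def[symmetric] by (simp add: e2_def p_eq mult_ac)
    then show ?thesis by (simp only: Q)
  qed
  have 3: "gm p e3 e3 = 1"
  proof -
    have "gm p e3 e3 = P * P * (S - a * a * s * s + a * a * s * s)"
      unfolding gm_def om kf S_def[symmetric] by (simp add: e3_def p_eq f power2_eq_square algebra_simps)
    then show ?thesis using P by simp
  qed
  have 4: "gm p e4 e4 = 1"
    unfolding gm_def om kf S_def[symmetric] using P by (simp add: e4_def p_eq f mult_ac)
  have 5: "gm p e1 e2 = 0"
    unfolding gm_def om kf S_def[symmetric] using S q_pos[of r] by (simp add: e1_def e2_def p_eq)
  have 6: "gm p e1 e3 = 0"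
  proof -
    have "gm p e1 e3 = N * P * a * s * (S - (r\<^sup>2 + a\<^sup>2 - a\<^sup>2 * s\<^sup>2))"
      unfolding gm_def om kf S_def[symmetric] by (simp add: e1_def e3_def p_eq f power2_eq_square algebra_simps)
    then show ?thesis by (simp add: S2)
  qed
  have 7: "gm p e1 e4 = 0" "gm p e2 e3 = 0" "gm p e2 e4 = 0" "gm p e3 e4 = 0"
    unfolding gm_def om kf by (simp_all add: e1_def e2_def e3_def e4_def p_eq f f21)
  have 8: "gm p e2 e1 = 0" "gm p e3 e1 = 0" "gm p e4 e1 = 0" "gm p e3 e2 = 0" "gm p e4 e2 = 0" "gm p e4 e3 = 0"
    using 5 6 7 gm_sym[of p e2 e1] gm_sym[of p e3 e1] gm_sym[of p e4 e1] gm_sym[of p e3 e2]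
      gm_sym[of p e4 e2] gm_sym[of p e4 e3] by simp_all
  define e where "e i = (if i = 1 then e1 else if i = 2 then e2 else if i = 3 then e3 else e4)" for i :: 4
  have on: "\<forall>i j. gm p (e i) (e j) = (if i \<noteq> j then 0 else if i = 1 then -1 else 1)"
    unfolding forall_4 e_def by (simp add: 1 2 3 4 5 6 7 8)
  have tan: "tangent p = {u. (0, 0, n) \<bullet> u = 0}"
    by (auto simp: tangent_def p_eq)
  show ?thesis
  proof (rule lorentzianI[where e = e])
    show "subspace (tangent p)" unfolding tan by (rule subspace_hyperplane)
    have "n \<noteq> 0" using n by auto
    then show "dim (tangent p) = 4"
      unfolding tan by (subst dim_hyperplane) (auto simp: zero_prod_def)
    show "range e \<subseteq> tangent p"
      unfolding tan by (auto simp: e_def e1_def e2_def e3_def e4_def f)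
  qed (use gm_bilinear on in auto)
qed

lemma gm_smooth_metric: "smooth_metric spacetime tangent gm"
  unfolding smooth_metric_def lorentz_field_def
proof (intro conjI ballI allI)
  fix p u v assume p: "p \<in> spacetime"
  show "bilinear (gm p)" by (rule gm_bilinear)
  show "gm p u v = gm p v u" by (rule gm_sym)
  show "lorentzian (tangent p) (gm p)" by (rule gm_lorentzian[OF p])
next
  fix u v
  define U where "U = {p. Sgm p \<noteq> 0}"
  have "open U"
    unfolding U_def Sgm_def by (intro open_Collect_neq continuous_intros)
  moreover have "spacetime \<subseteq> U" using Sgm_pos by (force simp: U_def)
  moreover have "Ck_on k U (\<lambda>p. gm p u v)" for k
  proof -
    have l: "bounded_linear (\<lambda>p::point. fst (snd p))" "bounded_linear (\<lambda>p::point. snd (snd p) $ i)" for i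
      by (intro bounded_linear_fst_comp bounded_linear_compose[OF bounded_linear_vec_nth] bounded_linear_snd_comp
        bounded_linear_ident)+
    note c = Ck_on_bounded_linear[OF l(1)] Ck_on_bounded_linear[OF l(2)]
      Ck_on_linear_precompose[OF l(1) smooth_H] Ck_on_linear_precompose[OF l(1) smooth_q]
      Ck_on_linear_precompose[OF l(1) smooth_\<beta>]
    have o: "Ck_on k U (\<lambda>p. om p w)" for w
      unfolding om_def azimuth_form_def by (intro Ck_on_intros c)
    have K: "Ck_on k U (\<lambda>p. kf p w)" for w
      unfolding kf_def by (intro Ck_on_intros o)
    have S: "Ck_on k U Sgm"
      unfolding Sgm_def[abs_def] by (intro Ck_on_intros c)
    show ?thesis
      unfolding gm_def using q_pos by (intro Ck_on_intros o K S c) (auto simp: U_def less_imp_neq[THEN not_sym])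
  qed
  ultimately show "smooth_on spacetime (\<lambda>p. gm p u v)"
    by (intro smooth_onI[where U = U and F = "\<lambda>p. gm p u v"]) auto
qed

end

section \<open>Antiderivatives on open sets\<close>

text \<open>On each connected component one integrates from a base point. Components are open, so
  the local choices fit together into one function.\<close>

lemma antiderivative_open_set:
  fixes f :: "real \<Rightarrow> real"
  assumes "open S" "continuous_on S f"
  obtains F where "\<And>x. x \<in> S \<Longrightarrow> (F has_real_derivative f x) (at x)"
proof -
  define C where "C x = connected_component_set S x" for x
  have C: "open (C x)" "C x \<subseteq> S" "is_interval (C x)" for x
    using assms(1) by (auto simp: C_def open_connected_component connected_component_subset is_interval_connected_1)
  have ex: "\<exists>F. \<forall>y\<in>C x. (F has_real_derivative f y) (at y)" for x
  proof (cases "C x = {}")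
    case False
    then obtain z where z: "z \<in> C x" by blast
    show ?thesis
    proof (intro exI ballI)
      fix y assume y: "y \<in> C x"
      obtain e where e: "e > 0" "cball y e \<subseteq> C x"
        using C(1)[of x] y open_contains_cball by blast
      define p where "p = min z (y - e)"
      define q where "q = max z (y + e)"
      have "y - e \<in> C x" "y + e \<in> C x" using e by (auto simp: dist_real_def subset_iff)
      then have pq: "p \<in> C x" "q \<in> C x" using z by (auto simp: p_def q_def min_def max_def)
      have sub: "{p..q} \<subseteq> C x"
        using C(3)[of x] pq unfolding is_interval_1 by fastforce
      have cont: "continuous_on {p..q} f" using sub C(2) by (intro continuous_on_subset[OF assms(2)]) blast
      have y': "p < y" "y < q" using e(1) by (auto simp: p_def q_def)
      have "((\<lambda>u. integral {p..u} f) has_real_derivative f y) (at y within {p..q})"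
        by (rule integral_has_real_derivative[OF cont]) (use y' in auto)
      then have "((\<lambda>u. integral {p..u} f) has_real_derivative f y) (at y)"
        using y' by (simp add: at_within_Icc_at)
      then have d: "((\<lambda>u. integral {p..u} f - integral {p..z} f) has_real_derivative f y) (at y)"
        by (auto intro!: derivative_eq_intros)
      \<comment> \<open>The oriented integral from z to u; the sign has to be put in by hand because
        \<open>integral {z..u} f\<close> is 0 for u < z.\<close>
      define G where "G u = (if u < z then - integral {u..z} f else integral {z..u} f)" for u
      have eq: "integral {p..u} f - integral {p..z} f = G u" if u: "u \<in> {p<..<q}" for u
      proof -
        have zpq: "p \<le> z" "z \<le> q" by (auto simp: p_def q_def)
        have int: "f integrable_on {p..v}" if "v \<le> q" for v
          by (rule integrable_continuous_real, rule continuous_on_subset[OF cont]) (use that in auto)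
        show ?thesis
        proof (cases "u < z")
          case True
          have "integral {p..u} f + integral {u..z} f = integral {p..z} f"
            by (rule Henstock_Kurzweil_Integration.integral_combine) (use True u zpq int in auto)
          then show ?thesis using True by (simp add: G_def)
        next
          case False
          have "integral {p..z} f + integral {z..u} f = integral {p..u} f"
            by (rule Henstock_Kurzweil_Integration.integral_combine) (use False u zpq int in auto)
          then show ?thesis using False by (simp add: G_def)
        qed
      qed
      show "((\<lambda>u. if u < z then - integral {u..z} f else integral {z..u} f) has_real_derivative f y) (at y)"
        unfolding G_def[symmetric]
        by (rule has_field_derivative_transform_within_open[OF d, of "{p<..<q}"]) (use y' eq in auto)
    qed
  qed simp
  \<comment> \<open>The choice depends on the component and not on the point, so nearby points use
    the same antiderivative.\<close>
  define F where "F = (\<lambda>K. SOME F. \<forall>y\<in>K. (F has_real_derivative f y) (at y))"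
  have F: "(F (C x) has_real_derivative f y) (at y)" if "y \<in> C x" for x y
    using someI_ex[OF ex[of x]] that unfolding F_def by blast
  show ?thesis
  proof (rule that[of "\<lambda>x. F (C x) x"])
    fix x assume x: "x \<in> S"
    then have xC: "x \<in> C x" by (simp add: C_def)
    show "((\<lambda>x. F (C x) x) has_real_derivative f x) (at x)"
    proof (rule has_field_derivative_transform_within_open[OF F[OF xC] C(1) xC])
      fix y assume "y \<in> C x"
      then have "C y = C x" by (auto simp: C_def connected_component_eq)
      then show "F (C x) y = F (C y) y" by simp
    qed
  qed
qed

section \<open>The isometric chart\<close>

lemma sph_inner:
  "sph_tangent \<theta> \<phi> d1 e1 \<bullet> sph_tangent \<theta> \<phi> d2 e2 = d1 * d2 + (sin \<theta>)\<^sup>2 * (e1 * e2)"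
proof -
  have "sph_tangent \<theta> \<phi> d1 e1 \<bullet> sph_tangent \<theta> \<phi> d2 e2 =
      ((cos \<theta>)\<^sup>2 * ((cos \<phi>)\<^sup>2 + (sin \<phi>)\<^sup>2) + (sin \<theta>)\<^sup>2) * (d1 * d2)
      + (sin \<theta>)\<^sup>2 * ((cos \<phi>)\<^sup>2 + (sin \<phi>)\<^sup>2) * (e1 * e2)"
    unfolding inner_vec_def sph_tangent_def sum_3
    by (simp add: algebra_simps power2_eq_square
        del: sin_cos_squared_add sin_cos_squared_add2 sin_cos_squared_add3)
  then show ?thesis by simp
qed

lemma sph_azimuth:
  "azimuth_form (sph \<theta> \<phi>) (sph_tangent \<theta> \<phi> d e) = (sin \<theta>)\<^sup>2 * e"
proof -
  have "azimuth_form (sph \<theta> \<phi>) (sph_tangent \<theta> \<phi> d e) = (sin \<theta>)\<^sup>2 * ((cos \<phi>)\<^sup>2 + (sin \<phi>)\<^sup>2) * e"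
    unfolding azimuth_form_def sph_def sph_tangent_def
    by (simp add: algebra_simps power2_eq_square
        del: sin_cos_squared_add sin_cos_squared_add2 sin_cos_squared_add3)
  then show ?thesis by simp
qed

lemma norm_sph: "norm (sph \<theta> \<phi>) = 1"
proof -
  have "sph \<theta> \<phi> \<bullet> sph \<theta> \<phi> = (sin \<theta>)\<^sup>2 * ((cos \<phi>)\<^sup>2 + (sin \<phi>)\<^sup>2) + (cos \<theta>)\<^sup>2"
    unfolding sph_def inner_vec_def sum_3
    by (simp add: algebra_simps power2_eq_square
        del: sin_cos_squared_add sin_cos_squared_add2 sin_cos_squared_add3)
  then show ?thesis by (simp add: norm_eq_1)
qed

text \<open>For fixed r the shifts only translate t and \<phi>, so the image does not depend on
  them. Preimages come from the arc cosine of the third coordinate of n and an angle of the rescaled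
  first two, which requires being off the axis.\<close>

lemma bl_embed_image:
  "bl_embed F G ` bl_domain a l m = {(t, r, n) \<in> spacetime. Delta a l m r \<noteq> 0 \<and> (n$1, n$2) \<noteq> (0, 0)}"
proof (intro equalityI subsetI)
  fix p assume "p \<in> bl_embed F G ` bl_domain a l m"
  then obtain x where x: "x \<in> bl_domain a l m" and p: "p = bl_embed F G x" by blast
  have s: "sin (x$3) > 0" using x by (intro sin_gt_zero) (auto simp: bl_domain_def)
  have "\<not> (x$2 = 0 \<and> cos (x$3) = 0)"
  proof
    assume "x$2 = 0 \<and> cos (x$3) = 0"
    then have "x$3 = pi/2" using x cos_inj_pi[of "x$3" "pi/2"] by (auto simp: bl_domain_def)
    with \<open>x$2 = 0 \<and> _\<close> x show False by (auto simp: bl_domain_def)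
  qed
  moreover have "\<not> (sin (x$3) * cos b = 0 \<and> sin (x$3) * sin b = 0)" for b
    using s sin_zero_abs_cos_one[of b] by auto
  ultimately show "p \<in> {(t, r, n) \<in> spacetime. Delta a l m r \<noteq> 0 \<and> (n$1, n$2) \<noteq> (0, 0)}"
    using x norm_sph by (auto simp: p bl_embed_def spacetime_def all_points_def ring_set_def bl_domain_def sph_def)
next
  fix p assume "p \<in> {(t, r, n) \<in> spacetime. Delta a l m r \<noteq> 0 \<and> (n$1, n$2) \<noteq> (0, 0)}"
  then obtain t r n where p: "p = (t, r, n)" and D: "Delta a l m r \<noteq> 0" and n12: "\<not> (n$1 = 0 \<and> n$2 = 0)"
    and n: "norm n = 1" and nr: "\<not> (r = 0 \<and> n$3 = 0)"
    by (auto simp: spacetime_def all_points_def ring_set_def)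
  have n1: "(n$1)\<^sup>2 + (n$2)\<^sup>2 + (n$3)\<^sup>2 = 1"
    using n norm_eq_1[of n] by (simp add: inner_vec_def sum_3 power2_eq_square)
  define s where "s = sqrt (1 - (n$3)\<^sup>2)"
  have "0 < (n$1)\<^sup>2 + (n$2)\<^sup>2" using n12 by (simp add: sum_power2_gt_zero_iff)
  then have n3: "(n$3)\<^sup>2 < 1" using n1 by linarith
  then have s: "s > 0" "s\<^sup>2 = (n$1)\<^sup>2 + (n$2)\<^sup>2" using n1 by (simp_all add: s_def)
  have n3': "-1 < n$3" "n$3 < 1" using n3 by (simp_all add: abs_square_less_1 abs_less_iff)
  define \<theta> where "\<theta> = arccos (n$3)"
  have \<theta>: "0 < \<theta>" "\<theta> < pi" "cos \<theta> = n$3" using n3' arccos_lt_bounded[of "n$3"] by (auto simp: \<theta>_def)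
  have sin\<theta>: "sin \<theta> = s" using n3' by (simp add: \<theta>_def s_def sin_arccos)
  have "(n$1 / s)\<^sup>2 + (n$2 / s)\<^sup>2 = 1" 
    unfolding power_divide add_divide_distrib[symmetric] s(2)[symmetric] using s(1) by simp
  then obtain b where b: "n$1 / s = cos b" "n$2 / s = sin b"
    using sincos_total_2pi by metis
  have "p = bl_embed F G (vector [t - F r, r, \<theta>, b - G r])"
    using b s \<theta>(3) by (simp add: p bl_embed_def sph_def vec_eq_iff forall_3 sin\<theta> field_simps)
  moreover have "vector [t - F r, r, \<theta>, b - G r] \<in> bl_domain a l m"
  proof -
    have "\<not> (r = 0 \<and> \<theta> = pi/2)"
    proof
      assume "r = 0 \<and> \<theta> = pi/2"
      with \<theta>(3) nr show False by (metis cos_pi_half)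
    qed
    then show ?thesis using D \<theta>(1,2) unfolding bl_domain_def mem_Collect_eq vector_4 by blast
  qed
  ultimately show "p \<in> bl_embed F G ` bl_domain a l m" by blast
qed

lemma has_derivative_vector_3:
  fixes f g h :: "'a::real_normed_vector \<Rightarrow> real"
  assumes "(f has_derivative f') F" "(g has_derivative g') F" "(h has_derivative h') F"
  shows "((\<lambda>x. vector [f x, g x, h x] :: real^3) has_derivative (\<lambda>v. vector [f' v, g' v, h' v])) F"
proof -
  have e: "(vector [a, b, c] :: real^3) = a *\<^sub>R axis 1 1 + (b *\<^sub>R axis 2 1 + c *\<^sub>R axis 3 1)" for a b c
    by (auto simp: vec_eq_iff forall_3 axis_def)
  show ?thesis
    unfolding e by (intro has_derivative_add has_derivative_scaleR_left assms)
qed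

lemma has_derivative_bl_embed:
  assumes "(F has_real_derivative F') (at (x$2))" "(G has_real_derivative G') (at (x$2))"
  shows "(bl_embed F G has_derivative
    (\<lambda>u. (u$1 + F' * u$2, u$2, sph_tangent (x$3) (x$4 + G (x$2)) (u$3) (u$4 + G' * u$2)))) (at x)"
proof -
  have coord: "((\<lambda>y::real^4. y $ i) has_derivative (\<lambda>v. v $ i)) (at x)" for i
    by (rule bounded_linear.has_derivative[OF bounded_linear_vec_nth has_derivative_ident])
  have comp: "((\<lambda>y::real^4. f (y $ i)) has_derivative (\<lambda>v. d * v $ i)) (at x)"
    if "(f has_real_derivative d) (at (x$i))" for f d i
    using has_derivative_compose[OF coord that[unfolded has_field_derivative_def]] by simp
  have ang: "((\<lambda>y. y$4 + G (y$2)) has_derivative (\<lambda>v. v$4 + G' * v$2)) (at x)"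
    by (intro has_derivative_add coord comp assms)
  have trig: "((\<lambda>y. f (g y)) has_derivative (\<lambda>v. d * g' v)) (at x)"
    if "(f has_real_derivative d) (at (g x))" "(g has_derivative g') (at x)" for f :: "real \<Rightarrow> real" and g :: "real^4 \<Rightarrow> real" and d g'
    using has_derivative_compose[OF that(2) that(1)[unfolded has_field_derivative_def]] by simp
  note t = trig[OF DERIV_sin ang] trig[OF DERIV_cos ang] trig[OF DERIV_sin coord[of 3]] trig[OF DERIV_cos coord[of 3]]
  have S: "((\<lambda>y. sph (y$3) (y$4 + G (y$2))) has_derivative
    (\<lambda>u. sph_tangent (x$3) (x$4 + G (x$2)) (u$3) (u$4 + G' * u$2))) (at x)"
    unfolding sph_def sph_tangent_def
    by (rule has_derivative_eq_rhs[OF has_derivative_vector_3])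
      (rule derivative_intros t | simp add: algebra_simps)+
  show ?thesis
    unfolding bl_embed_def[abs_def]
    by (intro has_derivative_Pair has_derivative_add coord comp assms S)
qed

lemma Ck_on_antiderivative:
  fixes F f :: "real \<Rightarrow> real"
  assumes "\<And>x. x \<in> S \<Longrightarrow> (F has_real_derivative f x) (at x)" "\<And>k. Ck_on k S f"
  shows "Ck_on k S F"
proof -
  have "Ck_on (Suc k) S F"
  proof (rule Ck_on_SucI[where f' = "\<lambda>x v. f x * v"])
    show "(F has_derivative (\<lambda>v. f x * v)) (at x)" if "x \<in> S" for x
      using assms(1)[OF that] by (simp add: has_field_derivative_def)
    show "Ck_on k S (\<lambda>x. f x * v)" for v
      by (intro Ck_on_mult Ck_on_const assms(2))
  qed
  then show ?thesis by (rule Ck_on_SucD)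
qed

lemma Ck_on_precompose_coordinate:
  assumes "\<And>x. x \<in> U \<Longrightarrow> x $ i \<in> S" "open S" "Ck_on k S f"
  shows "Ck_on k U (\<lambda>x::real^4. f (x $ i))"
  using assms(3)
proof (induction k arbitrary: f)
  case 0
  have "continuous_on U (\<lambda>x. f (x $ i))"
    by (rule continuous_on_compose2[of S f]) (use 0 assms(1) in \<open>auto intro: continuous_intros\<close>)
  then show ?case by simp
next
  case (Suc k)
  from Suc.prems obtain f' where "\<forall>x\<in>S. (f has_derivative f' x) (at x)" "\<forall>v. Ck_on k S (\<lambda>x. f' x v)"
    unfolding Ck_on.simps(2) by (elim exE conjE)
  note f' = this[rule_format]
  show ?case
  proof (rule Ck_on_SucI[where f' = "\<lambda>x v. f' (x $ i) (v $ i)"])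
    show "((\<lambda>x. f (x $ i)) has_derivative (\<lambda>v. f' (x $ i) (v $ i))) (at x)" if "x \<in> U" for x
      by (rule has_derivative_compose[OF bounded_linear_imp_has_derivative[OF bounded_linear_vec_nth] f'(1)[OF assms(1)[OF that]]])
    show "Ck_on k U (\<lambda>x. f' (x $ i) (v $ i))" for v
      by (rule Suc.IH[OF f'(2)])
  qed
qed

context shifted_metric
begin

text \<open>Pull-back under dt -> dt + F' dr and d\<phi> -> d\<phi> + G' dr. These shifts are the
  ones that remove the cross terms of dr with dt and d\<phi>; the relation between q, \<beta> and
  \<Delta> then turns the coefficient of dr^2 into \<Sigma> / \<Delta>.\<close>

lemma chart_identity:
  assumes \<Sigma>: "\<Sigma> = r\<^sup>2 + a\<^sup>2 * c\<^sup>2" "\<Sigma> \<noteq> 0" and s: "s\<^sup>2 = 1 - c\<^sup>2" and D: "D = r\<^sup>2 + a\<^sup>2 - H r" "D \<noteq> 0"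
    and F: "F' = \<beta> r * (r\<^sup>2 + a\<^sup>2) / D" and G: "G' = a * \<beta> r / D"
  shows "- ((u1 + F' * u2) * (v1 + F' * v2)) + \<Sigma> * (u3 * v3 + s\<^sup>2 * ((u4 + G' * u2) * (v4 + G' * v2)))
     + a\<^sup>2 * (s\<^sup>2 * (u4 + G' * u2)) * (s\<^sup>2 * (v4 + G' * v2))
     + H r / \<Sigma> * (u1 + F' * u2 - a * (s\<^sup>2 * (u4 + G' * u2))) * (v1 + F' * v2 - a * (s\<^sup>2 * (v4 + G' * v2)))
     + \<Sigma> / q r * u2 * v2
     + \<beta> r * (u2 * (v1 + F' * v2 - a * (s\<^sup>2 * (v4 + G' * v2))) + v2 * (u1 + F' * u2 - a * (s\<^sup>2 * (u4 + G' * u2))))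
   = - (1 - H r / \<Sigma>) * u1 * v1 - a * H r * s\<^sup>2 / \<Sigma> * (u1 * v4 + u4 * v1) + \<Sigma> / D * u2 * v2 + \<Sigma> * u3 * v3
     + (r\<^sup>2 + a\<^sup>2 + a\<^sup>2 * H r * s\<^sup>2 / \<Sigma>) * s\<^sup>2 * u4 * v4" (is "?L = ?R")
proof -
  define A2 where "A2 = r\<^sup>2 + a\<^sup>2"
  define b where "b = \<beta> r / D"
  define z where "z = s\<^sup>2"
  define h where "h = H r / \<Sigma>"
  have A2: "A2 \<noteq> 0" using a by (simp add: A2_def sum_power2_eq_zero_iff)
  have S: "\<Sigma> = A2 - a * a * z" unfolding \<Sigma>(1) z_def s A2_def by (simp add: algebra_simps power2_eq_square)
  have hS: "h * \<Sigma> = A2 - D" using \<Sigma>(2) D(1) by (simp add: h_def A2_def)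
  have F1: "F' = A2 * b" "G' = a * b" by (simp_all add: F G b_def A2_def)
  have \<beta>: "\<beta> r = b * D" using D(2) by (simp add: b_def)
  have "q r * (1 - (\<beta> r)\<^sup>2) = D" using q_rel D(1) by simp
  \<comment> \<open>With \<beta> = b D the relation is solved for 1 / q, which leaves a polynomial
    identity in b, D and i = 1 / D.\<close>
  then have qD: "1 / q r = 1 / D - b * b * D"
    using q_pos[of r] D(2) unfolding \<beta> by (simp add: divide_simps power2_eq_square) (simp add: algebra_simps)
  define i where "i = 1 / D"
  have iD: "i * D = 1" using D(2) by (simp add: i_def)
  have q: "x / q r = x * (i - b * b * D)" for x using qD by (simp add: i_def divide_inverse)
  have L: "?L = - ((u1 + A2 * b * u2) * (v1 + A2 * b * v2)) + \<Sigma> * (u3 * v3 + z * ((u4 + a * b * u2) * (v4 + a * b * v2)))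
     + a * a * (z * (u4 + a * b * u2)) * (z * (v4 + a * b * v2))
     + h * (u1 + A2 * b * u2 - a * (z * (u4 + a * b * u2))) * (v1 + A2 * b * v2 - a * (z * (v4 + a * b * v2)))
     + \<Sigma> * (i - b * b * D) * u2 * v2
     + b * D * (u2 * (v1 + A2 * b * v2 - a * (z * (v4 + a * b * v2))) + v2 * (u1 + A2 * b * u2 - a * (z * (u4 + a * b * u2))))"
    unfolding F1 \<beta> q z_def[symmetric] h_def[symmetric] power2_eq_square[of a] ..
  have R: "?R = - (1 - h) * u1 * v1 - a * h * z * (u1 * v4 + u4 * v1) + \<Sigma> * i * u2 * v2 + \<Sigma> * u3 * v3
     + (A2 + a * a * h * z) * z * u4 * v4"
    unfolding z_def[symmetric] A2_def[symmetric] by (simp add: h_def i_def power2_eq_square)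
  show ?thesis
    unfolding L R using S hS by algebra
qed

lemma isometric_chart_gm:
  assumes "l > 0" and H: "\<And>r. H r = 2 * mass l m r * r"
  obtains F G where "isometric_chart (bl_domain a l m) (bl_metric a l m) (bl_embed F G) gm"
proof -
  define O' where "O' = {r. Delta a l m r \<noteq> 0}"
  have Del: "Delta a l m r = r\<^sup>2 + a\<^sup>2 - H r" for r by (simp add: Delta_def H)
  have CDel: "Ck_on k UNIV (Delta a l m)" for k
    unfolding Del[abs_def]
    by (intro Ck_on_intros smooth_H Ck_on_bounded_linear[OF bounded_linear_ident])
  have "continuous_on UNIV (Delta a l m)" using CDel[of 0] by simp
  then have O': "open O'" unfolding O'_def by (intro open_Collect_neq continuous_on_const)
  define f where "f r = \<beta> r * (r\<^sup>2 + a\<^sup>2) / Delta a l m r" for r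
  define g where "g r = a * \<beta> r / Delta a l m r" for r
  have id: "Ck_on k O' (\<lambda>r::real. r)" for k by (rule Ck_on_bounded_linear[OF bounded_linear_ident])
  have sub: "Ck_on k O' \<phi>" if "Ck_on k UNIV \<phi>" for k and \<phi> :: "real \<Rightarrow> real"
    using Ck_on_linear_precompose[OF bounded_linear_ident that] by simp
  have f: "Ck_on k O' f" and g: "Ck_on k O' g" for k
    unfolding f_def[abs_def] g_def[abs_def]
    by (intro Ck_on_intros id sub[OF smooth_\<beta>] sub[OF CDel]; simp add: O'_def)+
  obtain F where F: "\<And>r. r \<in> O' \<Longrightarrow> (F has_real_derivative f r) (at r)"
    using antiderivative_open_set[OF O', of f] f[of 0] by auto
  obtain G where G: "\<And>r. r \<in> O' \<Longrightarrow> (G has_real_derivative g r) (at r)"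
    using antiderivative_open_set[OF O', of g] g[of 0] by auto
  have x2: "x$2 \<in> O'" if "x \<in> bl_domain a l m" for x using that by (simp add: bl_domain_def O'_def)
  have CF: "Ck_on k O' F" "Ck_on k O' G" for k
    by (rule Ck_on_antiderivative, erule F, rule f) (rule Ck_on_antiderivative, erule G, rule g)
  have c: "Ck_on k U (\<lambda>x::real^4. x $ i)" for k U i
    by (rule Ck_on_bounded_linear[OF bounded_linear_vec_nth])
  have smooth: "smooth_on (bl_domain a l m) (bl_embed F G)"
  proof (rule smooth_onI[OF open_bl_domain[OF assms(1)] subset_refl])
    show "Ck_on k (bl_domain a l m) (bl_embed F G)" for k
      unfolding bl_embed_def[abs_def] sph_def
      by (intro Ck_on_intros c Ck_on_precompose_coordinate[OF x2 O'] CF)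
  qed simp
  have iso: "\<exists>D. (bl_embed F G has_derivative D) (at x) \<and>
      (\<forall>u v. gm (bl_embed F G x) (D u) (D v) = form_of (bl_metric a l m) x u v)"
    if x: "x \<in> bl_domain a l m" for x
  proof (intro exI conjI allI)
    show "(bl_embed F G has_derivative
      (\<lambda>u. (u$1 + f (x$2) * u$2, u$2, sph_tangent (x$3) (x$4 + G (x$2)) (u$3) (u$4 + g (x$2) * u$2)))) (at x)"
      by (rule has_derivative_bl_embed[OF F[OF x2[OF x]] G[OF x2[OF x]]])
    fix u v
    have S: "(x$2)\<^sup>2 + a\<^sup>2 * (cos (x$3))\<^sup>2 \<noteq> 0"
      using x Sigma_pos[OF a, of "x$3" "x$2"] by (auto simp: bl_domain_def)
    have D: "Delta a l m (x$2) \<noteq> 0" using x by (simp add: bl_domain_def)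
    show "gm (bl_embed F G x)
       (u$1 + f (x$2) * u$2, u$2, sph_tangent (x$3) (x$4 + G (x$2)) (u$3) (u$4 + g (x$2) * u$2))
       (v$1 + f (x$2) * v$2, v$2, sph_tangent (x$3) (x$4 + G (x$2)) (v$3) (v$4 + g (x$2) * v$2))
      = form_of (bl_metric a l m) x u v"
      unfolding form_of_bl_metric[OF refl H refl] gm_def kf_def om_def Sgm_def bl_embed_def fst_conv snd_conv
        sph_azimuth sph_inner
      using chart_identity[OF refl S sin_squared_eq Del D f_def g_def]
      by (simp add: sph_def)
  qed
  show ?thesis
    by (rule that[of F G]) (use smooth iso in \<open>simp add: isometric_chart_def\<close>)
qed

end

section \<open>The Doran form and the case of negative mass\<close>

text \<open>Write M(r) as the integral of r M'(t r) over t in [0,1]; M' is explicit and carries the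
  factor (t r)^2.\<close>

lemma mass_eq_moment_int:
  assumes "l > 0"
  shows "mass l m r = 4 * m * l / pi * r ^ 3 * moment_int l 2 2 r"
proof -
  have nz: "t\<^sup>2 * r\<^sup>2 + l\<^sup>2 \<noteq> 0" for t
    using moment_denom_pos[of l t r] assms by simp
  have I: "((\<lambda>t. mass' l m (t * r) * r) has_integral mass l m (1 * r) - mass l m (0 * r)) {0..1}"
  proof (rule fundamental_theorem_of_calculus)
    fix t :: real assume "t \<in> {0..1}"
    have "((\<lambda>t. mass l m (t * r)) has_real_derivative mass' l m (t * r) * r) (at t within {0..1})"
      by (rule DERIV_chain2[OF DERIV_mass[OF assms]]) (auto intro!: derivative_eq_intros)
    then show "((\<lambda>t. mass l m (t * r)) has_vector_derivative mass' l m (t * r) * r) (at t within {0..1})"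
      by (simp add: has_real_derivative_iff_has_vector_derivative)
  qed simp
  have "mass l m (0 * r) = 0" by (simp add: mass_def)
  then have "mass l m r = integral {0..1} (\<lambda>t. mass' l m (t * r) * r)"
    by (simp only: integral_unique[OF I] mult_1_left diff_zero)
  also have "(\<lambda>t. mass' l m (t * r) * r) = (\<lambda>t. 4 * m * l / pi * r ^ 3 * (t\<^sup>2 * (inverse (t\<^sup>2 * r\<^sup>2 + l\<^sup>2))\<^sup>2))"
  proof
    fix t
    show "mass' l m (t * r) * r = 4 * m * l / pi * r ^ 3 * (t\<^sup>2 * (inverse (t\<^sup>2 * r\<^sup>2 + l\<^sup>2))\<^sup>2)"
      using nz[of t] by (simp add: mass'_def field_simps power2_eq_square power3_eq_cube)
  qed
  also have "integral {0..1} \<dots> = 4 * m * l / pi * r ^ 3 * moment_int l 2 2 r"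
    unfolding moment_int_def by (rule integral_mult_right)
  finally show ?thesis .
qed

text \<open>The square root of 2 r M(r) / (r^2 + a^2), with r^2 extracted so that the remaining
  radicand is positive and the function is smooth across r = 0. It plays the role of \<beta> for the
  Doran form.\<close>

definition sqrt_factor :: "real \<Rightarrow> real \<Rightarrow> real \<Rightarrow> real \<Rightarrow> real" where
  "sqrt_factor a l m r = r\<^sup>2 * sqrt (8 * m * l / pi * moment_int l 2 2 r / (r\<^sup>2 + a\<^sup>2))"

lemma mass_r_nonneg:
  assumes "l > 0" "m > 0"
  shows "0 \<le> mass l m r * r"
proof -
  have "mass l m r * r = 4 * m * l / pi * r ^ 4 * moment_int l 2 2 r"
    by (simp add: mass_eq_moment_int[OF assms(1)] power4_eq_xxxx power3_eq_cube mult_ac)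
  then show ?thesis
    using assms moment_int_pos[of l r] by (auto intro!: mult_nonneg_nonneg divide_nonneg_nonneg)
qed

lemma sqrt_factor:
  assumes "l > 0" "m > 0" "a \<noteq> 0"
  shows "sqrt (2 * mass l m r * r * (r\<^sup>2 + a\<^sup>2)) = sqrt_factor a l m r * (r\<^sup>2 + a\<^sup>2)"
proof -
  have A: "r\<^sup>2 + a\<^sup>2 > 0" using assms(3) by (simp add: add_nonneg_pos)
  have J: "moment_int l 2 2 r > 0" using assms(1) by (intro moment_int_pos) simp
  have "2 * mass l m r * r * (r\<^sup>2 + a\<^sup>2) = (r\<^sup>2 * (r\<^sup>2 + a\<^sup>2))\<^sup>2 * (8 * m * l / pi * moment_int l 2 2 r / (r\<^sup>2 + a\<^sup>2))"
  proof -
    have e: "2 * (4 * m * l / pi * r ^ 3 * J) * r * y = (r\<^sup>2 * y)\<^sup>2 * (8 * m * l / pi * J / y)" if "y \<noteq> 0" for J y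
      using that by (simp add: field_simps power2_eq_square power3_eq_cube)
    show ?thesis unfolding mass_eq_moment_int[OF assms(1)] by (rule e) (use A in linarith)
  qed
  then have "sqrt (2 * mass l m r * r * (r\<^sup>2 + a\<^sup>2))
      = r\<^sup>2 * (r\<^sup>2 + a\<^sup>2) * sqrt (8 * m * l / pi * moment_int l 2 2 r / (r\<^sup>2 + a\<^sup>2))"
    using A by (simp only: real_sqrt_mult real_sqrt_abs) simp
  then show ?thesis by (simp add: sqrt_factor_def)
qed

lemma sqrt_factor_square:
  assumes "l > 0" "m > 0" "a \<noteq> 0"
  shows "(sqrt_factor a l m r)\<^sup>2 * (r\<^sup>2 + a\<^sup>2) = 2 * mass l m r * r"
proof -
  have A: "0 < r\<^sup>2 + a\<^sup>2" using assms(3) by (simp add: add_nonneg_pos)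
  have "0 \<le> 2 * (mass l m r * r) * (r\<^sup>2 + a\<^sup>2)"
    using mult_nonneg_nonneg[of "2 * (mass l m r * r)" "r\<^sup>2 + a\<^sup>2"] mass_r_nonneg[OF assms(1,2), of r] A
    by simp
  then have "(sqrt_factor a l m r * (r\<^sup>2 + a\<^sup>2))\<^sup>2 = 2 * mass l m r * r * (r\<^sup>2 + a\<^sup>2)"
    unfolding sqrt_factor[OF assms, symmetric] by (intro real_sqrt_pow2) (simp add: mult.assoc)
  then have "((sqrt_factor a l m r)\<^sup>2 * (r\<^sup>2 + a\<^sup>2)) * (r\<^sup>2 + a\<^sup>2) = (2 * mass l m r * r) * (r\<^sup>2 + a\<^sup>2)"
    by (simp add: power2_eq_square mult_ac)
  then show ?thesis using A by (metis less_irrefl mult_right_cancel)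
qed

lemma smooth_twice_mass_r:
  assumes "l > 0"
  shows "Ck_on k UNIV (\<lambda>r. 2 * mass l m r * r)"
  unfolding mass_eq_moment_int[OF assms] using assms
  by (intro Ck_on_intros Ck_on_moment_int Ck_on_bounded_linear[OF bounded_linear_ident]) auto

lemma shifted_metric_doran:
  assumes "l > 0" "m > 0" "a \<noteq> 0"
  shows "shifted_metric a (\<lambda>r. 2 * mass l m r * r) (\<lambda>r. r\<^sup>2 + a\<^sup>2) (sqrt_factor a l m)"
proof
  fix r k
  show A: "0 < r\<^sup>2 + a\<^sup>2" for r using assms(3) by (simp add: add_nonneg_pos)
  have "(sqrt_factor a l m r)\<^sup>2 * (r\<^sup>2 + a\<^sup>2) = 2 * mass l m r * r"
    by (rule sqrt_factor_square[OF assms])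
  then show "(r\<^sup>2 + a\<^sup>2) * (1 - (sqrt_factor a l m r)\<^sup>2) = r\<^sup>2 + a\<^sup>2 - 2 * mass l m r * r"
    by (simp add: algebra_simps)
  have "0 < 8 * m * l / pi * moment_int l 2 2 r / (r\<^sup>2 + a\<^sup>2)" for r
    using assms A moment_int_pos[of l r] by (intro divide_pos_pos mult_pos_pos) auto
  then show "Ck_on k UNIV (sqrt_factor a l m)"
    unfolding sqrt_factor_def[abs_def] using assms A
    by (intro Ck_on_intros Ck_on_sqrt Ck_on_moment_int Ck_on_bounded_linear[OF bounded_linear_ident])
      (auto simp: less_imp_neq[THEN not_sym])
  show "Ck_on k UNIV (\<lambda>r. 2 * mass l m r * r)" by (rule smooth_twice_mass_r[OF assms(1)])
  show "Ck_on k UNIV (\<lambda>r. r\<^sup>2 + a\<^sup>2)"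
    by (intro Ck_on_intros Ck_on_bounded_linear[OF bounded_linear_ident])
qed (rule assms)

lemma doran_metric_eq:
  assumes "l > 0" "m > 0" "a \<noteq> 0" "p \<in> spacetime"
  shows "doran_metric a l m p = shifted_metric.gm a (\<lambda>r. 2 * mass l m r * r) (\<lambda>r. r\<^sup>2 + a\<^sup>2) (sqrt_factor a l m) p"
proof (intro ext)
  fix u v :: point
  interpret shifted_metric a "\<lambda>r. 2 * mass l m r * r" "\<lambda>r. r\<^sup>2 + a\<^sup>2" "sqrt_factor a l m"
    by (rule shifted_metric_doran[OF assms(1-3)])
  obtain t r n where p: "p = (t, r, n)" by (cases p)
  obtain \<tau>1 \<rho>1 w1 where u: "u = (\<tau>1, \<rho>1, w1)" by (cases u)
  obtain \<tau>2 \<rho>2 w2 where v: "v = (\<tau>2, \<rho>2, w2)" by (cases v)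
  have A: "r\<^sup>2 + a\<^sup>2 \<noteq> 0" using assms(3) by (simp add: sum_power2_eq_zero_iff)
  have S: "r\<^sup>2 + a\<^sup>2 * (n$3)\<^sup>2 \<noteq> 0" using Sgm_pos[OF assms(4)] by (simp add: Sgm_def p)
  have id: "S / A * (x + b * A / S * k1) * (y + b * A / S * k2)
      = b\<^sup>2 * A / S * k1 * k2 + S / A * x * y + b * (x * k2 + y * k1)"
    if "S \<noteq> 0" "A \<noteq> 0" for S A x y k1 k2 b :: real
    using that by (simp add: field_simps power2_eq_square)
  show "doran_metric a l m p u v = gm p u v"
    unfolding doran_metric_def p u v split_conv Let_def sqrt_factor[OF assms(1-3)] id[OF S A]
      sqrt_factor_square[OF assms(1-3)] gm_def kf_def om_def Sgm_def fst_conv snd_conv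
    by simp
qed

text \<open>M is linear in m, so here r M(r) is nonpositive by the positive case. Hence \<Delta> is
  positive everywhere and there is no horizon to cross.\<close>

lemma shifted_metric_negative:
  assumes "l > 0" "m < 0" "a \<noteq> 0"
  shows "shifted_metric a (\<lambda>r. 2 * mass l m r * r) (Delta a l m) (\<lambda>r. 0)"
proof
  fix r k
  have "mass l m r * r \<le> 0"
    using mass_r_nonneg[of l "- m" r] assms by (simp add: mass_def mult_ac)
  moreover have "0 < r\<^sup>2 + a\<^sup>2" using assms(3) by (simp add: add_nonneg_pos)
  ultimately show "0 < Delta a l m r" by (simp add: Delta_def mult_ac)
  show "Delta a l m r * (1 - 0\<^sup>2) = r\<^sup>2 + a\<^sup>2 - 2 * mass l m r * r" by (simp add: Delta_def mult_ac)
  show "Ck_on k UNIV (\<lambda>r. 2 * mass l m r * r)" by (rule smooth_twice_mass_r[OF assms(1)])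
  have "Delta a l m = (\<lambda>r. r\<^sup>2 + a\<^sup>2 - 2 * mass l m r * r)" by (simp add: Delta_def fun_eq_iff mult_ac)
  then show "Ck_on k UNIV (Delta a l m)"
    by (simp only:) (intro Ck_on_intros smooth_twice_mass_r[OF assms(1)] Ck_on_bounded_linear[OF bounded_linear_ident])
qed (simp_all add: assms)

section \<open>Stable causality of the Doran form\<close>

lemma tangent_eq: "tangent p = {u. (0, 0, snd (snd p)) \<bullet> u = 0}"
  by (auto simp: tangent_def)

text \<open>Differentiate the constant square of the unit vector n along the curve.\<close>

lemma curve_velocity_tangent:
  assumes \<gamma>: "\<gamma> ` {0..1} \<subseteq> spacetime" and s: "0 < s" "s < 1" and d: "(\<gamma> has_vector_derivative v) (at s)"
  shows "v \<in> tangent (\<gamma> s)"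
proof -
  have l: "bounded_linear (\<lambda>p::point. snd (snd p))"
    by (intro bounded_linear_snd_comp bounded_linear_ident)
  have N: "((\<lambda>x. snd (snd (\<gamma> x))) has_vector_derivative snd (snd v)) (at s)"
    by (rule bounded_linear.has_vector_derivative[OF l d])
  have unit: "snd (snd (\<gamma> x)) \<bullet> snd (snd (\<gamma> x)) = 1" if "0 < x" "x < 1" for x
  proof -
    have "\<gamma> x \<in> spacetime" using \<gamma> that by (auto simp: image_subset_iff)
    then show ?thesis by (auto simp: spacetime_def all_points_def norm_eq_1)
  qed
  have "((\<lambda>x. snd (snd (\<gamma> x)) \<bullet> snd (snd (\<gamma> x))) has_derivative
      (\<lambda>h. snd (snd (\<gamma> s)) \<bullet> (h *\<^sub>R snd (snd v)) + (h *\<^sub>R snd (snd v)) \<bullet> snd (snd (\<gamma> s)))) (at s)"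
    by (rule has_derivative_inner[OF N[unfolded has_vector_derivative_def] N[unfolded has_vector_derivative_def]])
  then have "((\<lambda>x. snd (snd (\<gamma> x)) \<bullet> snd (snd (\<gamma> x))) has_real_derivative 2 * (snd (snd (\<gamma> s)) \<bullet> snd (snd v))) (at s)"
    unfolding has_field_derivative_def by (rule has_derivative_eq_rhs) (simp add: fun_eq_iff inner_commute)
  then have "2 * (snd (snd (\<gamma> s)) \<bullet> snd (snd v)) = 0"
  proof (rule DERIV_local_const)
    show "0 < min s (1 - s)" using s by simp
    show "\<forall>y. \<bar>s - y\<bar> < min s (1 - s) \<longrightarrow> snd (snd (\<gamma> s)) \<bullet> snd (snd (\<gamma> s)) = snd (snd (\<gamma> y)) \<bullet> snd (snd (\<gamma> y))"
      using unit s by (auto simp: abs_less_iff)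
  qed
  then show ?thesis by (simp add: tangent_eq inner_prod_def)
qed

text \<open>Lagrange's identity in the first two components exhibits the difference as a sum of
  squares.\<close>

lemma azimuth_bound:
  assumes "norm n = 1"
  shows "(azimuth_form n w)\<^sup>2 \<le> w \<bullet> w"
proof -
  have n: "n$1 * n$1 + n$2 * n$2 + n$3 * n$3 = 1"
    using assms norm_eq_1[of n] by (simp add: inner_vec_def sum_3)
  have "w \<bullet> w = (n$1 * n$1 + n$2 * n$2 + n$3 * n$3) * (w$1 * w$1 + w$2 * w$2 + w$3 * w$3)"
    unfolding n by (simp add: inner_vec_def sum_3)
  also have "\<dots> = (azimuth_form n w)\<^sup>2 + (n$1 * w$1 + n$2 * w$2)\<^sup>2
      + (n$3)\<^sup>2 * ((w$1)\<^sup>2 + (w$2)\<^sup>2 + (w$3)\<^sup>2) + ((n$1)\<^sup>2 + (n$2)\<^sup>2) * (w$3)\<^sup>2"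
    by (simp add: azimuth_form_def power2_eq_square algebra_simps)
  finally show ?thesis by (simp add: add_nonneg_nonneg)
qed

context shifted_metric
begin

text \<open>For q = r^2 + a^2 completing the square in dr leaves -dt^2 plus nonnegative squares, so
  the level sets of t are spacelike and t serves as the time function.\<close>

theorem stably_causal_gm:
  assumes q: "\<And>r. q r = r\<^sup>2 + a\<^sup>2"
  shows "stably_causal spacetime tangent gm"
proof -
  have H: "H r = (\<beta> r)\<^sup>2 * q r" for r
    using q_rel[of r] q[of r] by (simp add: algebra_simps)
  define b where "b p = \<beta> (fst (snd p)) * q (fst (snd p)) / Sgm p" for p
  \<comment> \<open>The field \<partial>t - b \<partial>r makes the completed square vanish, since
    \<open>kf\<close> is 1 on it; hence its square is exactly -1.\<close>
  define X :: "point \<Rightarrow> point" where "X p = (1, - b p, 0)" for p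
  \<comment> \<open>On the level sets |v|^2 is at most 2 y^2 + c |w|^2 with c = 1 + 2 a^2 b^2, where
    y is the completed radial component. Dividing \<Sigma> by c + 2 q makes this at most \<Sigma>
    |w|^2 + \<Sigma> y^2 / q.\<close>
  define L where "L p = Sgm p / (1 + 2 * a\<^sup>2 * (b p)\<^sup>2 + 2 * q (fst (snd p)))" for p
  have square: "gm p v v = - (fst v)\<^sup>2 + Sgm p * (snd (snd v) \<bullet> snd (snd v)) + a\<^sup>2 * (om p v)\<^sup>2
      + Sgm p / q (fst (snd p)) * (fst (snd v) + b p * kf p v)\<^sup>2" if p: "p \<in> spacetime" for p v
  proof -
    have id: "B\<^sup>2 * A / S * k * k + S / A * x * x + B * (x * k + x * k) = S / A * (x + B * A / S * k)\<^sup>2"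
      if "S \<noteq> 0" "A \<noteq> 0" for S A x k B :: real
      using that by (simp add: field_simps power2_eq_square)
    have "Sgm p \<noteq> 0" "q (fst (snd p)) \<noteq> 0" using Sgm_pos[OF p] q_pos[of "fst (snd p)"] by auto
    from id[OF this, of "\<beta> (fst (snd p))" "kf p v" "fst (snd v)"] show ?thesis
      unfolding gm_def b_def H by (simp add: power2_eq_square mult_ac)
  qed
  have cq: "continuous_on UNIV q" and c\<beta>: "continuous_on UNIV \<beta>"
    using smooth_q[of 0] smooth_\<beta>[of 0] by simp_all
  have cS: "continuous_on spacetime Sgm"
    unfolding Sgm_def[abs_def] by (intro continuous_intros)
  have cr: "continuous_on spacetime (\<lambda>p. fst (snd p))"
    by (intro continuous_intros)
  have cq': "continuous_on spacetime (\<lambda>p. q (fst (snd p)))"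
    by (rule continuous_on_compose2[OF cq cr]) simp
  have c\<beta>': "continuous_on spacetime (\<lambda>p. \<beta> (fst (snd p)))"
    by (rule continuous_on_compose2[OF c\<beta> cr]) simp
  have nz: "Sgm p \<noteq> 0" if "p \<in> spacetime" for p using Sgm_pos[OF that] by simp
  have cb: "continuous_on spacetime b"
    unfolding b_def[abs_def] by (intro continuous_intros cS cq' c\<beta>') (use nz in auto)
  have den: "0 < 1 + 2 * a\<^sup>2 * (b p)\<^sup>2 + 2 * q (fst (snd p))" for p
    using q_pos[of "fst (snd p)"] by (simp add: add_nonneg_pos add_pos_nonneg)
  have cL: "continuous_on spacetime L"
    unfolding L_def[abs_def] using den by (intro continuous_intros cS cq' cb) (auto simp: less_imp_neq[THEN not_sym])
  have cX: "continuous_on spacetime X"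
    unfolding X_def[abs_def] by (intro continuous_intros cb)
  show ?thesis
  proof (rule stably_causal_time_function[where T = fst and X = X and L = L])
    show "bounded_linear (fst :: point \<Rightarrow> real)" by (rule bounded_linear_fst)
    fix p assume p: "p \<in> spacetime"
    show "subspace (tangent p)" unfolding tangent_eq by (rule subspace_hyperplane)
    show "X p \<in> tangent p" by (simp add: X_def tangent_eq)
    show "gm p (X p) (X p) = -1"
      unfolding square[OF p] by (simp add: X_def kf_def om_def azimuth_form_def)
    show "0 < L p" unfolding L_def using Sgm_pos[OF p] den[of p] by simp
    fix v :: point assume v: "v \<in> tangent p" "fst v = 0"
    obtain \<tau> \<rho> w where v_eq: "v = (\<tau>, \<rho>, w)" by (cases v)
    define y where "y = \<rho> + b p * kf p v"
    define S where "S = Sgm p"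
    define A where "A = q (fst (snd p))"
    have SA: "S > 0" "A > 0" using Sgm_pos[OF p] q_pos by (auto simp: S_def A_def)
    have n: "norm (snd (snd p)) = 1" using p by (auto simp: spacetime_def all_points_def)
    have om: "(om p v)\<^sup>2 \<le> w \<bullet> w" using azimuth_bound[OF n] by (simp add: om_def v_eq)
    have k: "kf p v = - a * om p v" using v(2) by (simp add: kf_def)
    have "\<rho> = y + a * b p * om p v" by (simp add: y_def k)
    then have "\<rho>\<^sup>2 \<le> 2 * y\<^sup>2 + 2 * (a * b p * om p v)\<^sup>2"
      using sum_squares_bound[of y "a * b p * om p v"] by (simp add: power2_sum)
    moreover have "(a * b p * om p v)\<^sup>2 \<le> a\<^sup>2 * (b p)\<^sup>2 * (w \<bullet> w)"
      unfolding power_mult_distrib by (rule mult_left_mono[OF om]) simp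
    ultimately have "\<rho>\<^sup>2 + w \<bullet> w \<le> 2 * y\<^sup>2 + (1 + 2 * a\<^sup>2 * (b p)\<^sup>2) * (w \<bullet> w)"
      by (simp add: algebra_simps)
    moreover have "(norm v)\<^sup>2 = \<rho>\<^sup>2 + w \<bullet> w"
      unfolding power2_norm_eq_inner v_eq inner_Pair using v(2) by (simp add: v_eq power2_eq_square)
    ultimately have nv: "(norm v)\<^sup>2 \<le> 2 * y\<^sup>2 + (1 + 2 * a\<^sup>2 * (b p)\<^sup>2) * (w \<bullet> w)" by simp
    define c where "c = 1 + 2 * a\<^sup>2 * (b p)\<^sup>2"
    have c: "c > 0" by (simp add: c_def add_pos_nonneg)
    have "gm p v v \<ge> S * (w \<bullet> w) + S / A * y\<^sup>2"
      unfolding square[OF p] using v(2) by (simp add: v_eq S_def A_def y_def)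
    moreover have "S / (c + 2 * A) * (2 * y\<^sup>2 + c * (w \<bullet> w)) \<le> S * (w \<bullet> w) + S / A * y\<^sup>2"
    proof -
      have "c * (w \<bullet> w) \<le> (c + 2 * A) * (w \<bullet> w)" "2 * y\<^sup>2 \<le> (c + 2 * A) * (y\<^sup>2 / A)"
      proof -
        show "c * (w \<bullet> w) \<le> (c + 2 * A) * (w \<bullet> w)"
          using SA by (intro mult_right_mono) auto
        have "0 \<le> c * (y\<^sup>2 / A)" using c SA by simp
        moreover have "(c + 2 * A) * (y\<^sup>2 / A) = c * (y\<^sup>2 / A) + 2 * y\<^sup>2"
          using SA by (simp add: field_simps)
        ultimately show "2 * y\<^sup>2 \<le> (c + 2 * A) * (y\<^sup>2 / A)" by linarith
      qed
      then have "S * (2 * y\<^sup>2 + c * (w \<bullet> w)) \<le> S * ((c + 2 * A) * (y\<^sup>2 / A) + (c + 2 * A) * (w \<bullet> w))"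
        using SA by (intro mult_left_mono) auto
      also have "\<dots> = (S * (w \<bullet> w) + S / A * y\<^sup>2) * (c + 2 * A)"
        by (simp add: algebra_simps)
      finally show ?thesis using c SA by (simp add: pos_divide_le_eq)
    qed
    moreover have "L p * (norm v)\<^sup>2 \<le> S / (c + 2 * A) * (2 * y\<^sup>2 + c * (w \<bullet> w))"
      unfolding L_def c_def[symmetric] S_def[symmetric] A_def[symmetric]
      using nv c SA unfolding c_def[symmetric] by (intro mult_left_mono) auto
    ultimately show "L p * (norm v)\<^sup>2 \<le> gm p v v" by linarith
  next
    fix \<gamma> :: "real \<Rightarrow> point" and s v
    assume "\<gamma> ` {0..1} \<subseteq> spacetime" "0 < s" "s < 1" "(\<gamma> has_vector_derivative v) (at s)"
    then show "v \<in> tangent (\<gamma> s)" by (rule curve_velocity_tangent)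
  qed (rule cX cL)+
qed

end

section \<open>Transfer to the Doran form and conclusion\<close>

lemma smooth_metric_cong:
  assumes eq: "\<And>p. p \<in> M \<Longrightarrow> h p = g p" and g: "smooth_metric M T g"
  shows "smooth_metric M T h"
  unfolding smooth_metric_def
proof (intro conjI allI)
  show "lorentz_field M T h"
    using g unfolding smooth_metric_def lorentz_field_def by (simp add: eq)
  fix u v
  have "smooth_on M (\<lambda>p. g p u v)" using g by (simp add: smooth_metric_def)
  then show "smooth_on M (\<lambda>p. h p u v)"
    unfolding smooth_on_def by (simp add: eq)
qed

lemma stably_causal_cong:
  assumes eq: "\<And>p. p \<in> M \<Longrightarrow> h p = g p" and "stably_causal M T g"
  shows "stably_causal M T h"
proof -
  have "time_orientable M T h \<longleftrightarrow> time_orientable M T g"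
    unfolding time_orientable_def time_orientation_def using eq by simp
  moreover have "(\<forall>p\<in>M. \<forall>u\<in>T p. \<forall>v\<in>T p. \<bar>k p u v - h p u v\<bar> \<le> \<epsilon> p * norm u * norm v) \<longleftrightarrow>
      (\<forall>p\<in>M. \<forall>u\<in>T p. \<forall>v\<in>T p. \<bar>k p u v - g p u v\<bar> \<le> \<epsilon> p * norm u * norm v)" for k \<epsilon>
    using eq by simp
  ultimately show ?thesis using assms(2) unfolding stably_causal_def by simp
qed

text \<open>The metric is one of its own admissible perturbations.\<close>

lemma stably_causal_no_ccc:
  assumes "stably_causal M T g" "continuous_metric M T g"
  shows "\<not> contains_ccc M T g"
proof -
  obtain \<epsilon> where \<epsilon>: "\<forall>p\<in>M. 0 < \<epsilon> p" and "\<forall>h. continuous_metric M T h \<and>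
      (\<forall>p\<in>M. \<forall>u\<in>T p. \<forall>v\<in>T p. \<bar>h p u v - g p u v\<bar> \<le> \<epsilon> p * norm u * norm v)
      \<longrightarrow> time_orientable M T h \<and> \<not> contains_ccc M T h"
    using assms(1) unfolding stably_causal_def by (elim exE conjE)
  from this(2)[rule_format, of g] show ?thesis
    using assms(2) \<epsilon> by (simp add: less_imp_le)
qed

text \<open>Scalars are bounded on the whole chart, so the full ambient space is a neighbourhood
  that refutes a singularity at any S, the ring included.\<close>

lemma no_scalar_polynomial_singularity:
  assumes "l > 0" "a \<noteq> 0"
  shows "\<not> scalar_polynomial_singularity (bl_metric a l m) (bl_domain a l m) \<Phi> S"
proof
  assume "scalar_polynomial_singularity (bl_metric a l m) (bl_domain a l m) \<Phi> S"
  then obtain I where I: "scalar_polynomial (bl_metric a l m) I"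
    and "\<forall>V. open V \<and> S \<subseteq> V \<longrightarrow> \<not> bounded (I ` {x \<in> bl_domain a l m. \<Phi> x \<in> V})"
    unfolding scalar_polynomial_singularity_def by (elim exE conjE)
  from this(2)[rule_format, of UNIV] have "\<not> bounded (I ` bl_domain a l m)" by simp
  with bl_scalar_polynomial_bounded[OF assms I] show False by blast
qed

theorem mainTheorem3:
  fixes a l m :: real
  assumes "l > 0" and "a \<noteq> 0" and "m \<noteq> 0"
  shows
    "smooth_metric (bl_domain a l m) (\<lambda>_. UNIV) (form_of (bl_metric a l m)) \<and>
     (\<exists>F G h.
        (m > 0 \<longrightarrow> h = doran_metric a l m) \<and>
        smooth_metric spacetime tangent h \<and>
        isometric_chart (bl_domain a l m) (bl_metric a l m) (bl_embed F G) h \<and>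
        bl_embed F G ` bl_domain a l m =
          {(t, r, n) \<in> spacetime. Delta a l m r \<noteq> 0 \<and> (n$1, n$2) \<noteq> (0, 0)} \<and>
        (\<forall>S \<subseteq> all_points.
           \<not> scalar_polynomial_singularity (bl_metric a l m) (bl_domain a l m) (bl_embed F G) S) \<and>
        \<not> scalar_polynomial_singularity (bl_metric a l m) (bl_domain a l m) (bl_embed F G) ring_set) \<and>
     (m > 0 \<longrightarrow>
        stably_causal spacetime tangent (doran_metric a l m) \<and>
        \<not> contains_ccc spacetime tangent (doran_metric a l m))"
proof (intro conjI impI)
  show "smooth_metric (bl_domain a l m) (\<lambda>_. UNIV) (form_of (bl_metric a l m))"
    by (rule bl_metric_smooth[OF assms(1,2)])
  have chart: "\<exists>F G h. (m > 0 \<longrightarrow> h = doran_metric a l m) \<and> smooth_metric spacetime tangent h \<and>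
      isometric_chart (bl_domain a l m) (bl_metric a l m) (bl_embed F G) h"
  proof (cases "m > 0")
    case True
    interpret shifted_metric a "\<lambda>r. 2 * mass l m r * r" "\<lambda>r. r\<^sup>2 + a\<^sup>2" "sqrt_factor a l m"
      by (rule shifted_metric_doran[OF assms(1) True assms(2)])
    note eq = doran_metric_eq[OF assms(1) True assms(2)]
    obtain F G where FG: "isometric_chart (bl_domain a l m) (bl_metric a l m) (bl_embed F G) gm"
      by (rule isometric_chart_gm[OF assms(1) refl])
    \<comment> \<open>\<open>doran_metric_eq\<close> is available at points of
      \<open>spacetime\<close>, so the chart has to be placed there before the isometry can be
      transferred.\<close>
    have "bl_embed F G x \<in> spacetime" if "x \<in> bl_domain a l m" for x
    proof -
      have "bl_embed F G x \<in> {(t, r, n) \<in> spacetime. Delta a l m r \<noteq> 0 \<and> (n$1, n$2) \<noteq> (0, 0)}"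
        unfolding bl_embed_image[of F G a l m, symmetric] by (rule imageI[OF that])
      then show ?thesis by auto
    qed
    then have "doran_metric a l m (bl_embed F G x) = gm (bl_embed F G x)" if "x \<in> bl_domain a l m" for x
      using that by (intro eq)
    then have "isometric_chart (bl_domain a l m) (bl_metric a l m) (bl_embed F G) (doran_metric a l m)"
      using FG unfolding isometric_chart_def by simp
    moreover have "smooth_metric spacetime tangent (doran_metric a l m)"
      by (rule smooth_metric_cong[OF eq gm_smooth_metric])
    ultimately show ?thesis
      by (intro exI[of _ F] exI[of _ G] exI[of _ "doran_metric a l m"]) simp
  next
    case False
    then have "m < 0" using assms(3) by simp
    interpret shifted_metric a "\<lambda>r. 2 * mass l m r * r" "Delta a l m" "\<lambda>r. 0"
      by (rule shifted_metric_negative[OF assms(1) \<open>m < 0\<close> assms(2)])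
    obtain F G where "isometric_chart (bl_domain a l m) (bl_metric a l m) (bl_embed F G) gm"
      by (rule isometric_chart_gm[OF assms(1) refl])
    with gm_smooth_metric False show ?thesis
      by (intro exI[of _ F] exI[of _ G] exI[of _ gm]) simp
  qed
  then obtain F G h where FGh: "m > 0 \<longrightarrow> h = doran_metric a l m" "smooth_metric spacetime tangent h"
      "isometric_chart (bl_domain a l m) (bl_metric a l m) (bl_embed F G) h"
    by (elim exE conjE)
  then show "\<exists>F G h.
        (m > 0 \<longrightarrow> h = doran_metric a l m) \<and>
        smooth_metric spacetime tangent h \<and>
        isometric_chart (bl_domain a l m) (bl_metric a l m) (bl_embed F G) h \<and>
        bl_embed F G ` bl_domain a l m =
          {(t, r, n) \<in> spacetime. Delta a l m r \<noteq> 0 \<and> (n$1, n$2) \<noteq> (0, 0)} \<and>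
        (\<forall>S \<subseteq> all_points.
           \<not> scalar_polynomial_singularity (bl_metric a l m) (bl_domain a l m) (bl_embed F G) S) \<and>
        \<not> scalar_polynomial_singularity (bl_metric a l m) (bl_domain a l m) (bl_embed F G) ring_set"
    by (intro exI[of _ F] exI[of _ G] exI[of _ h] conjI allI impI bl_embed_image
        no_scalar_polynomial_singularity[OF assms(1,2)]) simp_all
  assume m: "m > 0"
  interpret shifted_metric a "\<lambda>r. 2 * mass l m r * r" "\<lambda>r. r\<^sup>2 + a\<^sup>2" "sqrt_factor a l m"
    by (rule shifted_metric_doran[OF assms(1) m assms(2)])
  show stable: "stably_causal spacetime tangent (doran_metric a l m)"
    by (rule stably_causal_cong[OF doran_metric_eq[OF assms(1) m assms(2)] stably_causal_gm]) simp_all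
  have "smooth_metric spacetime tangent (doran_metric a l m)"
    using FGh(1,2) m by simp
  then show "\<not> contains_ccc spacetime tangent (doran_metric a l m)"
    by (intro stably_causal_no_ccc stable smooth_metric_imp_continuous)
qed

end
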